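(* Let $q$ be a non-zero complex number with $|q|\neq 1$. (1) If $q$ is real, then the center $\mathcal{Z}(C(U_q(2)))$ is isomorphic, as a $C^*$-algebra, to $C(\mathbb{T})$, the algebra of continuous functions on the unit circle $\mathbb{T}$. (2) If $q$ is non-real and $\theta=\frac{1}{\pi}\arg(q)$ is irrational, then $\mathcal{Z}(C(U_q(2)))=\mathbb{C}$, i.e. the center consists only of the scalar multiples of the identity.
   Context: For a non-zero complex number $q$, $C(U_q(2))$ denotes the universal unital $C^*$-algebra generated by elements $a,b,D$ satisfying the relations $$ba=q\,ab,\quad a^*b=q\,ba^*,\quad bb^*=b^*b,\quad aa^*+bb^*=1,$$ $$aD=Da,\quad bD=q^2|q|^{-2}Db,\quad DD^*=D^*D=1,\quad a^*a+|q|^2b^*b=1.$$ For an algebra $\mathscr{A}$, $\mathcal{Z}(\mathscr{A})$ denotes its center. *)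

theory Defs
  imports "HOL-Analysis.Analysis" "HOL-Algebra.QuotRing" "HOL-Algebra.Module" "HOL-Library.Poly_Mapping"
begin

section \<open>Unital C*-algebras\<close>

record 'a star_alg = "(complex, 'a) module" +
  involution :: "'a \<Rightarrow> 'a" (\<open>star\<index>\<close>)
  cnorm :: "'a \<Rightarrow> real" (\<open>nrm\<index>\<close>)

text \<open>The zero algebra is allowed (its unit has norm 0).\<close>

locale cstar_algebra = ring A for A :: "('a, 'm) star_alg_scheme" (structure) +
  assumes smult_closed [simp, intro]: "x \<in> carrier A \<Longrightarrow> c \<odot> x \<in> carrier A"
    and smult_l_distr: "x \<in> carrier A \<Longrightarrow> (c + d) \<odot> x = c \<odot> x \<oplus> d \<odot> x"
    and smult_r_distr: "x \<in> carrier A \<Longrightarrow> y \<in> carrier A \<Longrightarrow> c \<odot> (x \<oplus> y) = c \<odot> x \<oplus> c \<odot> y"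
    and smult_assoc: "x \<in> carrier A \<Longrightarrow> (c * d) \<odot> x = c \<odot> (d \<odot> x)"
    and smult_one [simp]: "x \<in> carrier A \<Longrightarrow> 1 \<odot> x = x"
    and smult_mult_left: "x \<in> carrier A \<Longrightarrow> y \<in> carrier A \<Longrightarrow> (c \<odot> x) \<otimes> y = c \<odot> (x \<otimes> y)"
    and smult_mult_right: "x \<in> carrier A \<Longrightarrow> y \<in> carrier A \<Longrightarrow> x \<otimes> (c \<odot> y) = c \<odot> (x \<otimes> y)"
    and star_closed [simp, intro]: "x \<in> carrier A \<Longrightarrow> star x \<in> carrier A"
    and star_star [simp]: "x \<in> carrier A \<Longrightarrow> star (star x) = x"
    and star_add: "x \<in> carrier A \<Longrightarrow> y \<in> carrier A \<Longrightarrow> star (x \<oplus> y) = star x \<oplus> star y"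
    and star_smult: "x \<in> carrier A \<Longrightarrow> star (c \<odot> x) = cnj c \<odot> star x"
    and star_mult: "x \<in> carrier A \<Longrightarrow> y \<in> carrier A \<Longrightarrow> star (x \<otimes> y) = star y \<otimes> star x"
    and nrm_nonneg: "x \<in> carrier A \<Longrightarrow> 0 \<le> nrm x"
    and nrm_eq_0: "x \<in> carrier A \<Longrightarrow> nrm x = 0 \<longleftrightarrow> x = \<zero>"
    and nrm_triangle: "x \<in> carrier A \<Longrightarrow> y \<in> carrier A \<Longrightarrow> nrm (x \<oplus> y) \<le> nrm x + nrm y"
    and nrm_smult: "x \<in> carrier A \<Longrightarrow> nrm (c \<odot> x) = cmod c * nrm x"
    and nrm_mult: "x \<in> carrier A \<Longrightarrow> y \<in> carrier A \<Longrightarrow> nrm (x \<otimes> y) \<le> nrm x * nrm y"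
    and cstar_identity: "x \<in> carrier A \<Longrightarrow> nrm (star x \<otimes> x) = (nrm x)\<^sup>2"
    and nrm_complete:
      "(\<And>n. X n \<in> carrier A) \<Longrightarrow> \<forall>e>0. \<exists>N. \<forall>m\<ge>N. \<forall>n\<ge>N. nrm (X m \<ominus> X n) < e
        \<Longrightarrow> \<exists>x\<in>carrier A. (\<lambda>n. nrm (X n \<ominus> x)) \<longlonglongrightarrow> 0"

text \<open>Unital *-homomorphisms; the bijective ones are the isomorphisms of C*-algebras
  (they are automatically isometric).\<close>

definition star_hom ::
  "('a, 'm) star_alg_scheme \<Rightarrow> ('b, 'n) star_alg_scheme \<Rightarrow> ('a \<Rightarrow> 'b) set" where
  "star_hom A B = {\<phi> \<in> ring_hom A B.
     (\<forall>c. \<forall>x\<in>carrier A. \<phi> (c \<odot>\<^bsub>A\<^esub> x) = c \<odot>\<^bsub>B\<^esub> \<phi> x) \<and>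
     (\<forall>x\<in>carrier A. \<phi> (star\<^bsub>A\<^esub> x) = star\<^bsub>B\<^esub> (\<phi> x))}"

definition cstar_isomorphic ::
  "('a, 'm) star_alg_scheme \<Rightarrow> ('b, 'n) star_alg_scheme \<Rightarrow> bool" where
  "cstar_isomorphic A B \<longleftrightarrow> (\<exists>\<phi>\<in>star_hom A B. bij_betw \<phi> (carrier A) (carrier B))"

definition center :: "('a, 'm) star_alg_scheme \<Rightarrow> 'a set" where
  "center A = {z \<in> carrier A. \<forall>x\<in>carrier A. z \<otimes>\<^bsub>A\<^esub> x = x \<otimes>\<^bsub>A\<^esub> z}"

definition center_algebra :: "('a, 'm) star_alg_scheme \<Rightarrow> ('a, 'm) star_alg_scheme" where
  "center_algebra A = A\<lparr>carrier := center A\<rparr>"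

text \<open>The algebra \<open>C(K)\<close>. HOL functions are total, so a function on \<open>K\<close> is
  represented by its extension with value \<^term>\<open>undefined\<close> outside \<open>K\<close>.\<close>

definition continuous_functions :: "'k::topological_space set \<Rightarrow> ('k \<Rightarrow> complex) star_alg" where
  "continuous_functions K =
    \<lparr>carrier = {f \<in> extensional K. continuous_on K f},
     mult = (\<lambda>f g. \<lambda>x\<in>K. f x * g x), one = (\<lambda>x\<in>K. 1),
     zero = (\<lambda>x\<in>K. 0), add = (\<lambda>f g. \<lambda>x\<in>K. f x + g x),
     smult = (\<lambda>c f. \<lambda>x\<in>K. c * f x),
     involution = (\<lambda>f. \<lambda>x\<in>K. cnj (f x)),
     cnorm = (\<lambda>f. SUP x\<in>K. cmod (f x))\<rparr>"


section \<open>The free unital *-algebra\<close>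

text \<open>Words over the generators and their formal adjoints, written additively (concatenation
  is \<open>+\<close>, the empty word is \<open>0\<close>), since the product of \<^type>\<open>poly_mapping\<close> is
  the convolution product of the monoid ring over an additive monoid. In particular this \<open>+\<close>
  is not commutative.\<close>

datatype 'g letter = Gen 'g | Adj 'g

datatype 'g word = Word "'g letter list"

instantiation word :: (type) monoid_add
begin
definition zero_word :: "'a word" where "0 = Word []"
fun plus_word :: "'a word \<Rightarrow> 'a word \<Rightarrow> 'a word" where "Word u + Word v = Word (u @ v)"
instance
proof
  fix a b c :: "'a word"
  show "a + b + c = a + (b + c)" by (cases a; cases b; cases c) simp
  show "0 + a = a" "a + 0 = a" by (cases a; simp add: zero_word_def)+
qed
end

type_synonym 'g star_poly = "'g word \<Rightarrow>\<^sub>0 complex"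

definition gen :: "'g \<Rightarrow> 'g star_poly" where "gen g = Poly_Mapping.single (Word [Gen g]) 1"

definition const :: "complex \<Rightarrow> 'g star_poly" where "const c = Poly_Mapping.single 0 c"

fun adj_letter :: "'g letter \<Rightarrow> 'g letter" where
  "adj_letter (Gen g) = Adj g"
| "adj_letter (Adj g) = Gen g"

fun adj_word :: "'g word \<Rightarrow> 'g word" where
  "adj_word (Word u) = Word (rev (map adj_letter u))"

text \<open>The coefficient of \<open>adj f\<close> at \<open>w\<close> is the conjugate of the coefficient of
  \<open>f\<close> at the adjoint word.\<close>

definition adj :: "'g star_poly \<Rightarrow> 'g star_poly" where
  "adj f = Poly_Mapping.map cnj (Poly_Mapping.map_key adj_word f)"


section \<open>The universal unital C*-algebra of a set of relations\<close>

locale cstar_seminorm =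
  fixes p :: "'g star_poly \<Rightarrow> real"
  assumes p_nonneg: "0 \<le> p x"
    and p_triangle: "p (x + y) \<le> p x + p y"
    and p_scale: "p (const c * x) = cmod c * p x"
    and p_mult: "p (x * y) \<le> p x * p y"
    and p_cstar: "p (adj x * x) = (p x)\<^sup>2"

definition rel_seminorms :: "'g star_poly set \<Rightarrow> ('g star_poly \<Rightarrow> real) set" where
  "rel_seminorms R = {p. cstar_seminorm p \<and> (\<forall>r\<in>R. p r = 0)}"

text \<open>The universal C*-seminorm: the supremum of \<open>\<parallel>\<pi>(x)\<parallel>\<close> over all *-homomorphisms \<open>\<pi>\<close>
  into C*-algebras with \<open>\<pi>(r) = 0\<close> for \<open>r \<in> R\<close>. Since HOL cannot quantify over the
  type of the target algebra, the supremum runs over the C*-seminorms \<open>x \<mapsto> \<parallel>\<pi>(x)\<parallel>\<close>.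
  It is meaningful if it is finite at every point.\<close>

definition universal_seminorm :: "'g star_poly set \<Rightarrow> 'g star_poly \<Rightarrow> real" where
  "universal_seminorm R x = (SUP p\<in>rel_seminorms R. p x)"

text \<open>The Hausdorff completion of the free *-algebra with respect to a C*-seminorm:
  Cauchy sequences modulo null sequences.\<close>

definition cauchy_ring :: "('g star_poly \<Rightarrow> real) \<Rightarrow> (nat \<Rightarrow> 'g star_poly) ring" where
  "cauchy_ring p =
    \<lparr>carrier = {x. \<forall>e>0. \<exists>N. \<forall>m\<ge>N. \<forall>n\<ge>N. p (x m - x n) < e},
     mult = (\<lambda>x y n. x n * y n), one = (\<lambda>n. 1),
     zero = (\<lambda>n. 0), add = (\<lambda>x y n. x n + y n)\<rparr>"

definition null_ideal :: "('g star_poly \<Rightarrow> real) \<Rightarrow> (nat \<Rightarrow> 'g star_poly) set" where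
  "null_ideal p = {x. (\<lambda>n. p (x n)) \<longlonglongrightarrow> 0}"

abbreviation cauchy_class ::
  "('g star_poly \<Rightarrow> real) \<Rightarrow> (nat \<Rightarrow> 'g star_poly) \<Rightarrow> (nat \<Rightarrow> 'g star_poly) set" where
  "cauchy_class p x \<equiv> null_ideal p +>\<^bsub>cauchy_ring p\<^esub> x"

definition rep :: "'a set \<Rightarrow> 'a" where "rep X = (SOME x. x \<in> X)"

definition cstar_completion ::
  "('g star_poly \<Rightarrow> real) \<Rightarrow> (nat \<Rightarrow> 'g star_poly) set star_alg" where
  "cstar_completion p = (let Q = cauchy_ring p Quot null_ideal p in
    \<lparr>carrier = carrier Q, mult = mult Q, one = one Q, zero = zero Q, add = add Q,
     smult = (\<lambda>c X. cauchy_class p (\<lambda>n. const c * rep X n)),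
     involution = (\<lambda>X. cauchy_class p (\<lambda>n. adj (rep X n))),
     cnorm = (\<lambda>X. lim (\<lambda>n. p (rep X n)))\<rparr>)"

definition universal_cstar :: "'g star_poly set \<Rightarrow> (nat \<Rightarrow> 'g star_poly) set star_alg" where
  "universal_cstar R = cstar_completion (universal_seminorm R)"

definition universal_elem ::
  "'g star_poly set \<Rightarrow> 'g star_poly \<Rightarrow> (nat \<Rightarrow> 'g star_poly) set" where
  "universal_elem R x = cauchy_class (universal_seminorm R) (\<lambda>n. x)"


section \<open>The algebra \<open>C(U\<^sub>q(2))\<close>\<close>

datatype Uq2_gen = Gen_a | Gen_b | Gen_D

definition Uq2_relations :: "complex \<Rightarrow> Uq2_gen star_poly set" where
  "Uq2_relations q = (let a = gen Gen_a; b = gen Gen_b; D = gen Gen_D in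
    {b * a - const q * (a * b),
     adj a * b - const q * (b * adj a),
     b * adj b - adj b * b,
     a * adj a + b * adj b - 1,
     a * D - D * a,
     b * D - const (q\<^sup>2 / (complex_of_real (cmod q))\<^sup>2) * (D * b),
     D * adj D - 1,
     adj D * D - 1,
     adj a * a + const ((complex_of_real (cmod q))\<^sup>2) * (adj b * b) - 1})"

definition C_Uq2 :: "complex \<Rightarrow> (nat \<Rightarrow> Uq2_gen star_poly) set star_alg" where
  "C_Uq2 q = universal_cstar (Uq2_relations q)"


section \<open>The universal property\<close>

text \<open>For \<open>cmod q \<noteq> 1\<close> the following shows that \<^term>\<open>C_Uq2 q\<close> is a
  C*-algebra whose generators satisfy the defining relations and which maps to every C*-algebra
  (over an arbitrary type) containing elements that satisfy these relations. The supremum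
  defining the universal seminorm is finite by \<open>Uq2_admissible\<close>.\<close>

subsection \<open>Algebra of *-polynomials\<close>

lemma adj_letter_adj_letter [simp]: "adj_letter (adj_letter l) = l"
  by (cases l) auto

lemma adj_word_adj_word [simp]: "adj_word (adj_word w) = w"
  by (cases w) (simp add: rev_map comp_def)

lemma adj_word_add: "adj_word (v + w) = adj_word w + adj_word v"
  by (cases v; cases w) simp

lemma adj_word_0 [simp]: "adj_word 0 = 0"
  by (simp add: zero_word_def)

lemma inj_adj_word: "inj adj_word"
  by (metis adj_word_adj_word injI)

lemma lookup_adj: "Poly_Mapping.lookup (adj f) w = cnj (Poly_Mapping.lookup f (adj_word w))"
  by (simp add: adj_def map.rep_eq map_key.rep_eq[OF inj_adj_word] when_def)

lemma adj_add: "adj (f + g) = adj f + adj g"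
  by (rule poly_mapping_eqI) (simp add: lookup_adj lookup_add)

lemma adj_diff: "adj (f - g) = adj f - adj g"
  by (rule poly_mapping_eqI) (simp add: lookup_adj lookup_minus)

lemma adj_zero [simp]: "adj 0 = 0"
  by (rule poly_mapping_eqI) (simp add: lookup_adj)

lemma adj_adj [simp]: "adj (adj f) = f"
  by (rule poly_mapping_eqI) (simp add: lookup_adj)

lemma adj_single: "adj (Poly_Mapping.single w c) = Poly_Mapping.single (adj_word w) (cnj c)"
  by (rule poly_mapping_eqI) (auto simp add: lookup_adj lookup_single when_def)

lemma adj_const: "adj (const c) = const (cnj c)"
  by (simp add: const_def adj_single)

lemma const_1 [simp]: "const 1 = 1"
  by (simp add: const_def)

lemma adj_one [simp]: "adj 1 = 1"
  by (metis adj_const const_1 complex_cnj_one)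

lemma star_poly_induct [case_names zero add]:
  fixes P :: "'g star_poly \<Rightarrow> bool"
  assumes "P 0" "\<And>w c f. P f \<Longrightarrow> P (Poly_Mapping.single w c + f)"
  shows "P f"
proof (induction f rule: Poly_Mapping.update_induct)
  case const then show ?case using assms(1) by simp
next
  case (update f a b)
  have "Poly_Mapping.update a b f = Poly_Mapping.single a b + f"
    using update.hyps
    by (intro poly_mapping_eqI) (auto simp: lookup_update lookup_add lookup_single when_def in_keys_iff)
  then show ?case using assms(2) update by simp
qed

lemma adj_mult: "adj (f * g) = adj g * adj f"
proof (induction f rule: star_poly_induct)
  case (add v c f)
  have "adj (Poly_Mapping.single v c * g) = adj g * adj (Poly_Mapping.single v c)"
    by (induction g rule: star_poly_induct)
      (simp_all add: algebra_simps mult_single adj_add adj_single adj_word_add)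
  with add show ?case by (simp add: algebra_simps adj_add)
qed simp

lemma const_central: "const c * f = f * const c"
  by (induction f rule: star_poly_induct)
    (simp_all add: algebra_simps const_def mult_single)

lemma const_mult_left: "f * (const c * g) = const c * (f * g)"
  by (metis const_central mult.assoc)

lemma const_add: "const (c + d) = const c + const d"
  by (simp add: const_def single_add)

lemma const_mult: "const (c * d) = const c * const d"
  by (simp add: const_def mult_single)

lemma const_uminus: "const (- c) = - const c"
  by (simp add: const_def single_uminus)

lemma const_0 [simp]: "const 0 = 0" by (simp add: const_def)

subsection \<open>The completion is a C*-algebra\<close>

context cstar_seminorm begin

lemma p_zero [simp]: "p 0 = 0"
  using p_scale[of 0 0] by simp

lemma p_uminus [simp]: "p (- x) = p x"
  using p_scale[of "-1" x] by (simp add: const_uminus)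

lemma p_minus_commute: "p (x - y) = p (y - x)"
  by (metis p_uminus minus_diff_eq)

lemma p_adj_le: "p x \<le> p (adj x)"
proof (cases "p x = 0")
  case False
  have "p x * p x \<le> p (adj x) * p x"
    using p_mult[of "adj x" x] by (simp add: p_cstar power2_eq_square)
  then show ?thesis using False p_nonneg[of x]
    by (simp add: mult_le_cancel_right)
qed (simp add: p_nonneg)

lemma p_adj [simp]: "p (adj x) = p x"
  using p_adj_le[of x] p_adj_le[of "adj x"] by simp

lemma p_triangle_diff: "p (x - z) \<le> p (x - y) + p (y - z)"
  using p_triangle[of "x - y" "y - z"] by simp

lemma p_abs_diff: "\<bar>p x - p y\<bar> \<le> p (x - y)"
  using p_triangle[of "x - y" y] p_triangle[of "y - x" x] p_minus_commute[of x y] by simp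

lemma p_one: "p 1 \<le> 1"
  using p_cstar[of 1] p_nonneg[of 1]
  by (cases "p 1 = 0") (auto simp: power2_eq_square)

abbreviation "CR \<equiv> cauchy_ring p"
abbreviation "NI \<equiv> null_ideal p"

definition cauchy :: "(nat \<Rightarrow> 'g star_poly) \<Rightarrow> bool" where
  "cauchy x \<longleftrightarrow> (\<forall>e>0. \<exists>N. \<forall>m\<ge>N. \<forall>n\<ge>N. p (x m - x n) < e)"

lemma CR_simps [simp]:
  "x \<in> carrier CR \<longleftrightarrow> cauchy x"
  "mult CR = (\<lambda>x y n. x n * y n)" "one CR = (\<lambda>n. 1)"
  "zero CR = (\<lambda>n. 0)" "add CR = (\<lambda>x y n. x n + y n)"
  by (simp_all add: cauchy_ring_def cauchy_def)

lemma cauchy_const [simp]: "cauchy (\<lambda>n. x)" by (simp add: cauchy_def)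

lemma cauchy_dominated:
  assumes "cauchy x" "\<And>m n. p (y m - y n) \<le> K * p (x m - x n)"
  shows "cauchy y"
  unfolding cauchy_def
proof (intro allI impI)
  fix e :: real assume "e > 0"
  then have "e / (\<bar>K\<bar> + 1) > 0" by simp
  then obtain N where N: "\<forall>m\<ge>N. \<forall>n\<ge>N. p (x m - x n) < e / (\<bar>K\<bar> + 1)"
    using assms(1) unfolding cauchy_def by blast
  have "p (y m - y n) < e" if "m \<ge> N" "n \<ge> N" for m n
  proof -
    have "p (y m - y n) \<le> K * p (x m - x n)" by (rule assms)
    also have "\<dots> \<le> (\<bar>K\<bar> + 1) * p (x m - x n)"
      by (intro mult_right_mono p_nonneg) auto
    also have "\<dots> < e" using N that by (simp add: field_simps)
    finally show ?thesis .
  qed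
  then show "\<exists>N. \<forall>m\<ge>N. \<forall>n\<ge>N. p (y m - y n) < e" by blast
qed

lemma cauchy_add:
  assumes "cauchy x" "cauchy y" shows "cauchy (\<lambda>n. x n + y n)"
  unfolding cauchy_def
proof (intro allI impI)
  fix e :: real assume "e > 0"
  then obtain M N where *: "\<forall>m\<ge>M. \<forall>n\<ge>M. p (x m - x n) < e/2" "\<forall>m\<ge>N. \<forall>n\<ge>N. p (y m - y n) < e/2"
    using assms unfolding cauchy_def by (meson half_gt_zero)
  then have "p (x m + y m - (x n + y n)) < e" if "m \<ge> max M N" "n \<ge> max M N" for m n
  proof -
    have "p (x m - x n) < e/2" "p (y m - y n) < e/2" using * that by auto
    then show ?thesis using p_triangle[of "x m - x n" "y m - y n"] by (simp add: add_diff_add)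
  qed
  then show "\<exists>N. \<forall>m\<ge>N. \<forall>n\<ge>N. p (x m + y m - (x n + y n)) < e" by blast
qed

lemma cauchy_bounded: assumes "cauchy x" obtains K where "K > 0" "\<And>n. p (x n) \<le> K"
proof -
  obtain N where N: "\<forall>m\<ge>N. \<forall>n\<ge>N. p (x m - x n) < 1"
    using assms unfolding cauchy_def by (meson zero_less_one)
  define K where "K = Max ((\<lambda>n. p (x n)) ` {..N}) + 1"
  have le: "p (x n) \<le> K - 1" if "n \<le> N" for n
    unfolding K_def using that by simp
  have "p (x n) \<le> K" for n
  proof (cases "n \<le> N")
    case False
    then have "p (x n - x N) < 1" using N by simp
    then show ?thesis using le[of N] p_triangle[of "x n - x N" "x N"] by simp
  qed (use le in fastforce)
  moreover have "K > 0" using le[of 0] p_nonneg[of "x 0"] by simp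
  ultimately show ?thesis using that by blast
qed

lemma cauchy_mult:
  assumes "cauchy x" "cauchy y" shows "cauchy (\<lambda>n. x n * y n)"
proof -
  obtain K where K: "K > 0" "\<And>n. p (x n) \<le> K" using cauchy_bounded assms(1) by blast
  obtain L where L: "L > 0" "\<And>n. p (y n) \<le> L" using cauchy_bounded assms(2) by blast
  have *: "p (x m * y m - x n * y n) \<le> K * p (y m - y n) + L * p (x m - x n)" for m n
  proof -
    have "x m * y m - x n * y n = x m * (y m - y n) + (x m - x n) * y n"
      by (simp add: algebra_simps)
    then have "p (x m * y m - x n * y n) \<le> p (x m) * p (y m - y n) + p (x m - x n) * p (y n)"
      using p_mult[of "x m" "y m - y n"] p_mult[of "x m - x n" "y n"]
        p_triangle[of "x m * (y m - y n)" "(x m - x n) * y n"] by simp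
    also have "\<dots> \<le> K * p (y m - y n) + p (x m - x n) * L"
      using K L p_nonneg by (intro add_mono mult_mono) (auto intro: less_imp_le)
    finally show ?thesis by (simp add: mult.commute)
  qed
  show ?thesis unfolding cauchy_def
  proof (intro allI impI)
    fix e :: real assume "e > 0"
    then have "e / (2 * K) > 0" "e / (2 * L) > 0" using K L by auto
    then obtain M N where MN: "\<forall>m\<ge>M. \<forall>n\<ge>M. p (x m - x n) < e/(2*L)" "\<forall>m\<ge>N. \<forall>n\<ge>N. p (y m - y n) < e/(2*K)"
      using assms unfolding cauchy_def by meson
    have "p (x m * y m - x n * y n) < e" if "m \<ge> max M N" "n \<ge> max M N" for m n
    proof -
      have "p (x m - x n) < e/(2*L)" "p (y m - y n) < e/(2*K)" using MN that by auto
      then have "L * p (x m - x n) < e/2" "K * p (y m - y n) < e/2"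
        using K L by (auto simp: field_simps)
      then show ?thesis using *[of m n] by linarith
    qed
    then show "\<exists>N. \<forall>m\<ge>N. \<forall>n\<ge>N. p (x m * y m - x n * y n) < e" by blast
  qed
qed

lemma cauchy_scale: assumes "cauchy x" shows "cauchy (\<lambda>n. const c * x n)"
  by (rule cauchy_dominated[OF assms, where K = "cmod c"])
    (simp add: p_scale flip: right_diff_distrib)

lemma cauchy_adj: assumes "cauchy x" shows "cauchy (\<lambda>n. adj (x n))"
  by (rule cauchy_dominated[OF assms, where K = 1]) (simp flip: adj_diff)

lemma cauchy_uminus: assumes "cauchy x" shows "cauchy (\<lambda>n. - x n)"
  using cauchy_scale[OF assms, of "-1"] by (simp add: const_uminus)

lemma CR_ring: "ring CR"
proof (rule ringI)
  show "abelian_group CR"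
  proof (rule abelian_groupI)
    fix x assume "x \<in> carrier CR"
    then show "\<exists>y\<in>carrier CR. y \<oplus>\<^bsub>CR\<^esub> x = \<zero>\<^bsub>CR\<^esub>"
      by (intro bexI[of _ "\<lambda>n. - x n"]) (auto simp: cauchy_uminus)
  qed (auto simp: cauchy_add algebra_simps)
  show "Group.monoid CR"
    by (rule monoidI) (auto simp: cauchy_mult algebra_simps)
qed (auto simp: algebra_simps)

lemma null_iff: "x \<in> NI \<longleftrightarrow> (\<lambda>n. p (x n)) \<longlonglongrightarrow> 0"
  by (simp add: null_ideal_def)

lemma null_cauchy: assumes "x \<in> NI" shows "cauchy x"
  unfolding cauchy_def
proof (intro allI impI)
  fix e :: real assume "e > 0"
  then obtain N where *: "\<forall>n\<ge>N. p (x n) < e/2"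
    using LIMSEQ_D[OF assms[unfolded null_iff], of "e/2"] p_nonneg by fastforce
  then have "p (x m - x n) < e" if "m \<ge> N" "n \<ge> N" for m n
  proof -
    have "p (x m) < e/2" "p (x n) < e/2" using * that by auto
    then show ?thesis using p_triangle[of "x m" "- x n"] by simp
  qed
  then show "\<exists>N. \<forall>m\<ge>N. \<forall>n\<ge>N. p (x m - x n) < e" by blast
qed

lemma null_dominated:
  assumes "x \<in> NI" "\<And>n. p (y n) \<le> K * p (x n)"
  shows "y \<in> NI"
  unfolding null_iff
proof (rule tendsto_sandwich[where f = "\<lambda>n. 0"])
  show "(\<lambda>n. K * p (x n)) \<longlonglongrightarrow> 0"
    using tendsto_mult[OF tendsto_const assms(1)[unfolded null_iff], of K] by simp
qed (auto simp: p_nonneg assms)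

lemma null_add: assumes "x \<in> NI" "y \<in> NI" shows "(\<lambda>n. x n + y n) \<in> NI"
  unfolding null_iff
proof (rule tendsto_sandwich[where f = "\<lambda>n. 0"])
  show "(\<lambda>n. p (x n) + p (y n)) \<longlonglongrightarrow> 0"
    using tendsto_add[OF assms[unfolded null_iff]] by simp
qed (auto simp: p_nonneg p_triangle)

lemma NI_ideal: "ideal NI CR"
proof (intro idealI CR_ring)
  interpret ring CR by (rule CR_ring)
  show "subgroup NI (add_monoid CR)"
  proof (rule add.subgroupI)
    show "NI \<noteq> {}" using null_iff[of "\<lambda>n. 0"] by auto
    fix x assume x: "x \<in> NI"
    have "\<ominus>\<^bsub>CR\<^esub> x = (\<lambda>n. - x n)"
      using null_cauchy[OF x] by (intro minus_equality) (auto simp: cauchy_uminus)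
    then show "\<ominus>\<^bsub>CR\<^esub> x \<in> NI"
      using null_dominated[OF x, of "\<lambda>n. - x n" 1] by simp
  qed (use null_cauchy null_add null_iff in \<open>auto\<close>)
next
  fix a x assume a: "a \<in> NI" and x: "x \<in> carrier CR"
  then obtain K where K: "\<And>n. p (x n) \<le> K" using cauchy_bounded[of x] CR_simps(1) by metis
  have "p (x n * a n) \<le> K * p (a n)" "p (a n * x n) \<le> K * p (a n)" for n
    using p_mult[of "x n" "a n"] p_mult[of "a n" "x n"] mult_right_mono[OF K p_nonneg, of n "a n"]
    by (auto simp: mult.commute)
  then show "x \<otimes>\<^bsub>CR\<^esub> a \<in> NI" "a \<otimes>\<^bsub>CR\<^esub> x \<in> NI"
    by (auto intro: null_dominated[OF a])
qed

lemma mem_class: "y \<in> cauchy_class p x \<longleftrightarrow> (\<lambda>n. y n - x n) \<in> NI"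
proof -
  have "y \<in> cauchy_class p x \<longleftrightarrow> (\<exists>h\<in>NI. y = (\<lambda>n. h n + x n))"
    by (auto simp: a_r_coset_def r_coset_def)
  also have "\<dots> \<longleftrightarrow> (\<lambda>n. y n - x n) \<in> NI"
    by (auto intro!: bexI[of _ "\<lambda>n. y n - x n"])
  finally show ?thesis .
qed

lemma null_minus_commute: "(\<lambda>n. y n - x n) \<in> NI \<longleftrightarrow> (\<lambda>n. x n - y n) \<in> NI"
  by (simp add: null_iff p_minus_commute[of "y _"])

lemma class_eqI: 
  assumes "(\<lambda>n. y n - x n) \<in> NI"
  shows "cauchy_class p x = cauchy_class p y"
proof -
  have "(\<lambda>n. z n - y n) \<in> NI \<longleftrightarrow> (\<lambda>n. z n - x n) \<in> NI" for z
    using null_add[of "\<lambda>n. z n - y n" "\<lambda>n. y n - x n"] assms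
          null_add[of "\<lambda>n. z n - x n" "\<lambda>n. x n - y n"] null_minus_commute[of x y] by auto
  then show ?thesis by (auto simp: mem_class)
qed

lemma class_eq_iff: "cauchy_class p x = cauchy_class p y \<longleftrightarrow> (\<lambda>n. y n - x n) \<in> NI"
  using class_eqI mem_class[of y x] mem_class[of y y] by (auto simp: null_iff)

abbreviation "CC \<equiv> cstar_completion p"
abbreviation "Q \<equiv> CR Quot NI"

lemma rep_class: "(\<lambda>n. rep (cauchy_class p x) n - x n) \<in> NI"
proof -
  have "x \<in> cauchy_class p x" by (simp add: mem_class null_iff)
  then have "rep (cauchy_class p x) \<in> cauchy_class p x" unfolding rep_def by (metis someI)
  then show ?thesis by (simp add: mem_class)
qed

lemma CC_carrier: "carrier CC = cauchy_class p ` {x. cauchy x}"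
  by (auto simp: cstar_completion_def Let_def FactRing_def A_RCOSETS_def' cauchy_ring_def cauchy_def)

lemma CC_cases: assumes "X \<in> carrier CC" obtains x where "cauchy x" "X = cauchy_class p x"
  using assms by (auto simp: CC_carrier)

lemma class_closed [simp]: "cauchy x \<Longrightarrow> cauchy_class p x \<in> carrier CC"
  by (auto simp: CC_carrier)

lemma CC_add: "cauchy x \<Longrightarrow> cauchy y \<Longrightarrow>
   cauchy_class p x \<oplus>\<^bsub>CC\<^esub> cauchy_class p y = cauchy_class p (\<lambda>n. x n + y n)"
  using ring_hom_add[OF ideal.rcos_ring_hom[OF NI_ideal], of x y]
  by (simp add: cstar_completion_def Let_def)

lemma CC_mult: "cauchy x \<Longrightarrow> cauchy y \<Longrightarrow>
   cauchy_class p x \<otimes>\<^bsub>CC\<^esub> cauchy_class p y = cauchy_class p (\<lambda>n. x n * y n)"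
  using ring_hom_mult[OF ideal.rcos_ring_hom[OF NI_ideal], of x y]
  by (simp add: cstar_completion_def Let_def)

lemma CC_one: "\<one>\<^bsub>CC\<^esub> = cauchy_class p (\<lambda>n. 1)"
  by (simp add: cstar_completion_def Let_def FactRing_def)

lemma CC_zero: "\<zero>\<^bsub>CC\<^esub> = cauchy_class p (\<lambda>n. 0)"
  using mem_class[of _ "\<lambda>n. 0"] by (auto simp add: cstar_completion_def Let_def FactRing_def)

lemma CC_ring: "ring CC"
proof (rule ringI)
  note [simp] = cauchy_mult cauchy_add cauchy_uminus CC_add CC_mult CC_one CC_zero
  show "abelian_group CC"
  proof (rule abelian_groupI)
    fix X assume "X \<in> carrier CC"
    then obtain x where x: "cauchy x" "X = cauchy_class p x" by (rule CC_cases)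
    show "\<zero>\<^bsub>CC\<^esub> \<oplus>\<^bsub>CC\<^esub> X = X" using x by simp
    show "\<exists>Y\<in>carrier CC. Y \<oplus>\<^bsub>CC\<^esub> X = \<zero>\<^bsub>CC\<^esub>"
      using x by (intro bexI[of _ "cauchy_class p (\<lambda>n. - x n)"]) auto
    fix Y assume "Y \<in> carrier CC"
    then obtain y where y: "cauchy y" "Y = cauchy_class p y" by (rule CC_cases)
    show "X \<oplus>\<^bsub>CC\<^esub> Y \<in> carrier CC" "X \<oplus>\<^bsub>CC\<^esub> Y = Y \<oplus>\<^bsub>CC\<^esub> X"
      using x y by (simp_all add: add.commute)
    fix Z assume "Z \<in> carrier CC"
    then obtain z where z: "cauchy z" "Z = cauchy_class p z" by (rule CC_cases)
    show "X \<oplus>\<^bsub>CC\<^esub> Y \<oplus>\<^bsub>CC\<^esub> Z = X \<oplus>\<^bsub>CC\<^esub> (Y \<oplus>\<^bsub>CC\<^esub> Z)"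
      using x y z by (simp add: add.assoc)
  qed simp
  show "Group.monoid CC"
  proof (rule monoidI)
    fix X assume "X \<in> carrier CC"
    then obtain x where x: "cauchy x" "X = cauchy_class p x" by (rule CC_cases)
    show "\<one>\<^bsub>CC\<^esub> \<otimes>\<^bsub>CC\<^esub> X = X" "X \<otimes>\<^bsub>CC\<^esub> \<one>\<^bsub>CC\<^esub> = X" using x by simp_all
    fix Y assume "Y \<in> carrier CC"
    then obtain y where y: "cauchy y" "Y = cauchy_class p y" by (rule CC_cases)
    show "X \<otimes>\<^bsub>CC\<^esub> Y \<in> carrier CC" using x y by simp
    fix Z assume "Z \<in> carrier CC"
    then obtain z where z: "cauchy z" "Z = cauchy_class p z" by (rule CC_cases)
    show "X \<otimes>\<^bsub>CC\<^esub> Y \<otimes>\<^bsub>CC\<^esub> Z = X \<otimes>\<^bsub>CC\<^esub> (Y \<otimes>\<^bsub>CC\<^esub> Z)"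
      using x y z by (simp add: mult.assoc)
  qed simp
  fix X Y Z assume "X \<in> carrier CC" "Y \<in> carrier CC" "Z \<in> carrier CC"
  then obtain x y z where *: "cauchy x" "X = cauchy_class p x" "cauchy y" "Y = cauchy_class p y"
    "cauchy z" "Z = cauchy_class p z" by (metis CC_cases)
  then show "(X \<oplus>\<^bsub>CC\<^esub> Y) \<otimes>\<^bsub>CC\<^esub> Z = X \<otimes>\<^bsub>CC\<^esub> Z \<oplus>\<^bsub>CC\<^esub> Y \<otimes>\<^bsub>CC\<^esub> Z"
    "Z \<otimes>\<^bsub>CC\<^esub> (X \<oplus>\<^bsub>CC\<^esub> Y) = Z \<otimes>\<^bsub>CC\<^esub> X \<oplus>\<^bsub>CC\<^esub> Z \<otimes>\<^bsub>CC\<^esub> Y"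
    by (simp_all add: distrib_right distrib_left)
qed

lemma CC_smult: "c \<odot>\<^bsub>CC\<^esub> cauchy_class p x = cauchy_class p (\<lambda>n. const c * x n)"
proof -
  have "(\<lambda>n. const c * x n - const c * rep (cauchy_class p x) n) \<in> NI"
    using null_dominated[OF rep_class, of "\<lambda>n. const c * x n - const c * rep (cauchy_class p x) n" "cmod c" x]
    by (simp add: p_scale p_minus_commute[of "x _"] flip: right_diff_distrib)
  then show ?thesis
    by (simp add: cstar_completion_def Let_def class_eqI)
qed

lemma CC_star: "star\<^bsub>CC\<^esub> (cauchy_class p x) = cauchy_class p (\<lambda>n. adj (x n))"
proof -
  have "(\<lambda>n. adj (x n) - adj (rep (cauchy_class p x) n)) \<in> NI"
    using null_dominated[OF rep_class, of "\<lambda>n. adj (x n) - adj (rep (cauchy_class p x) n)" 1 x]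
    by (simp add: p_minus_commute[of "x _"] flip: adj_diff)
  then show ?thesis
    by (simp add: cstar_completion_def Let_def class_eqI)
qed

lemma p_convergent: assumes "cauchy x" shows "convergent (\<lambda>n. p (x n))"
proof -
  have "Cauchy (\<lambda>n. p (x n))"
    unfolding Cauchy_def dist_real_def
    using assms p_abs_diff unfolding cauchy_def by (meson order_le_less_trans)
  then show ?thesis by (simp add: Cauchy_convergent_iff)
qed

lemma CC_nrm_tendsto: assumes "cauchy x" shows "(\<lambda>n. p (x n)) \<longlonglongrightarrow> nrm\<^bsub>CC\<^esub> (cauchy_class p x)"
proof -
  let ?r = "rep (cauchy_class p x)"
  obtain L where L: "(\<lambda>n. p (x n)) \<longlonglongrightarrow> L" using p_convergent[OF assms] by (auto simp: convergent_def)
  have "(\<lambda>n. p (?r n) - p (x n)) \<longlonglongrightarrow> 0"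
    by (rule Lim_null_comparison[OF _ rep_class[of x, unfolded null_iff]]) (simp add: p_abs_diff)
  from tendsto_add[OF this L] have "(\<lambda>n. p (?r n)) \<longlonglongrightarrow> L" by simp
  then have "lim (\<lambda>n. p (?r n)) = L" by (rule limI)
  then have "nrm\<^bsub>CC\<^esub> (cauchy_class p x) = L"
    by (simp add: cstar_completion_def Let_def)
  with L show ?thesis by simp
qed

lemma CC_nrmI: "cauchy x \<Longrightarrow> (\<lambda>n. p (x n)) \<longlonglongrightarrow> L \<Longrightarrow> nrm\<^bsub>CC\<^esub> (cauchy_class p x) = L"
  using CC_nrm_tendsto LIMSEQ_unique by blast

lemma CC_nrm_const: "nrm\<^bsub>CC\<^esub> (cauchy_class p (\<lambda>n. x)) = p x"
  by (rule CC_nrmI) auto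

lemma CC_minus: "cauchy x \<Longrightarrow> cauchy y \<Longrightarrow>
   cauchy_class p x \<ominus>\<^bsub>CC\<^esub> cauchy_class p y = cauchy_class p (\<lambda>n. x n - y n)"
proof -
  assume x: "cauchy x" and y: "cauchy y"
  interpret ring CC by (rule CC_ring)
  have "\<ominus>\<^bsub>CC\<^esub> cauchy_class p y = cauchy_class p (\<lambda>n. - y n)"
    using y by (intro minus_equality) (auto simp: cauchy_uminus CC_add CC_zero)
  then show ?thesis using x y by (simp add: a_minus_def CC_add cauchy_uminus)
qed

lemma cauchy_diff: "cauchy x \<Longrightarrow> cauchy y \<Longrightarrow> cauchy (\<lambda>n. x n - y n)"
  using cauchy_add[OF _ cauchy_uminus, of x y] by simp

lemma class_approx:
  assumes x: "cauchy x" and e: "e > 0"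
  shows "\<exists>N. \<forall>k\<ge>N. nrm\<^bsub>CC\<^esub> (cauchy_class p x \<ominus>\<^bsub>CC\<^esub> cauchy_class p (\<lambda>n. x k)) < e"
proof -
  obtain N where N: "\<forall>m\<ge>N. \<forall>n\<ge>N. p (x m - x n) < e/2" using x e unfolding cauchy_def by (meson half_gt_zero)
  have "nrm\<^bsub>CC\<^esub> (cauchy_class p x \<ominus>\<^bsub>CC\<^esub> cauchy_class p (\<lambda>n. x k)) < e" if k: "k \<ge> N" for k
  proof -
    have "(\<lambda>n. p (x n - x k)) \<longlonglongrightarrow> nrm\<^bsub>CC\<^esub> (cauchy_class p (\<lambda>n. x n - x k))"
      by (rule CC_nrm_tendsto) (simp add: x cauchy_diff)
    then have "nrm\<^bsub>CC\<^esub> (cauchy_class p (\<lambda>n. x n - x k)) \<le> e/2"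
      by (rule LIMSEQ_le_const2) (use N k in \<open>auto intro!: exI[of _ N] less_imp_le\<close>)
    then show ?thesis using e by (simp add: CC_minus x)
  qed
  then show ?thesis by blast
qed

lemma CC_triangle:
  assumes "X \<in> carrier CC" "Y \<in> carrier CC"
  shows "nrm\<^bsub>CC\<^esub> (X \<oplus>\<^bsub>CC\<^esub> Y) \<le> nrm\<^bsub>CC\<^esub> X + nrm\<^bsub>CC\<^esub> Y"
proof -
  obtain x y where xy: "cauchy x" "X = cauchy_class p x" "cauchy y" "Y = cauchy_class p y"
    using assms by (metis CC_cases)
  show ?thesis
    unfolding xy CC_add[OF xy(1,3)]
    by (rule LIMSEQ_le[OF CC_nrm_tendsto[OF cauchy_add[OF xy(1,3)]]
          tendsto_add[OF CC_nrm_tendsto[OF xy(1)] CC_nrm_tendsto[OF xy(3)]]])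
      (simp add: p_triangle)
qed

lemma CC_complete:
  assumes X: "\<And>n. X n \<in> carrier CC"
    and C: "\<forall>e>0. \<exists>N. \<forall>m\<ge>N. \<forall>n\<ge>N. nrm\<^bsub>CC\<^esub> (X m \<ominus>\<^bsub>CC\<^esub> X n) < e"
  shows "\<exists>x\<in>carrier CC. (\<lambda>n. nrm\<^bsub>CC\<^esub> (X n \<ominus>\<^bsub>CC\<^esub> x)) \<longlonglongrightarrow> 0"
proof -
  interpret ring CC by (rule CC_ring)
  define j where "j y = cauchy_class p (\<lambda>n::nat. y)" for y
  have j [simp]: "j y \<in> carrier CC" for y by (simp add: j_def)
  have tri: "nrm\<^bsub>CC\<^esub> (U \<ominus>\<^bsub>CC\<^esub> W) \<le> nrm\<^bsub>CC\<^esub> (U \<ominus>\<^bsub>CC\<^esub> V) + nrm\<^bsub>CC\<^esub> (V \<ominus>\<^bsub>CC\<^esub> W)"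
    if "U \<in> carrier CC" "V \<in> carrier CC" "W \<in> carrier CC" for U V W
  proof -
    have "U \<ominus>\<^bsub>CC\<^esub> W = (U \<ominus>\<^bsub>CC\<^esub> V) \<oplus>\<^bsub>CC\<^esub> (V \<ominus>\<^bsub>CC\<^esub> W)"
      using that by (simp add: a_minus_def a_assoc r_neg1)
    then show ?thesis using CC_triangle that by simp
  qed
  have comm: "nrm\<^bsub>CC\<^esub> (U \<ominus>\<^bsub>CC\<^esub> V) = nrm\<^bsub>CC\<^esub> (V \<ominus>\<^bsub>CC\<^esub> U)"
    if UV: "U \<in> carrier CC" "V \<in> carrier CC" for U V
  proof -
    obtain u v where uv: "cauchy u" "U = cauchy_class p u" "cauchy v" "V = cauchy_class p v"
      using UV by (metis CC_cases)
    have "(\<lambda>n. p (u n - v n)) \<longlonglongrightarrow> nrm\<^bsub>CC\<^esub> (V \<ominus>\<^bsub>CC\<^esub> U)"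
      using CC_nrm_tendsto[OF cauchy_diff[OF uv(3,1)]] p_minus_commute[of "u _"]
      by (simp add: uv CC_minus)
    then show ?thesis unfolding uv CC_minus[OF uv(1,3)]
      by (intro CC_nrmI) (use uv cauchy_diff in auto)
  qed
  have "\<exists>y. nrm\<^bsub>CC\<^esub> (X n \<ominus>\<^bsub>CC\<^esub> j y) < inverse (real (Suc n))" for n
  proof -
    obtain x where "cauchy x" "X n = cauchy_class p x" using X by (metis CC_cases)
    then show ?thesis using class_approx[of x "inverse (real (Suc n))"] unfolding j_def by fastforce
  qed
  then obtain y where "\<forall>n. nrm\<^bsub>CC\<^esub> (X n \<ominus>\<^bsub>CC\<^esub> j (y n)) < inverse (real (Suc n))"
    using choice[of "\<lambda>n y. nrm\<^bsub>CC\<^esub> (X n \<ominus>\<^bsub>CC\<^esub> j y) < inverse (real (Suc n))"] by blast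
  then have y: "\<And>n. nrm\<^bsub>CC\<^esub> (X n \<ominus>\<^bsub>CC\<^esub> j (y n)) < inverse (real (Suc n))" by blast
  have small: "\<exists>N. \<forall>n\<ge>N. nrm\<^bsub>CC\<^esub> (X n \<ominus>\<^bsub>CC\<^esub> j (y n)) < e" if e: "e > 0" for e
  proof -
    obtain N where "inverse (real (Suc N)) < e" using reals_Archimedean[OF e] by blast
    then have "nrm\<^bsub>CC\<^esub> (X n \<ominus>\<^bsub>CC\<^esub> j (y n)) < e" if "n \<ge> N" for n
    proof -
      have "inverse (real (Suc n)) \<le> inverse (real (Suc N))"
        using that by (intro le_imp_inverse_le) auto
      with y[of n] \<open>inverse (real (Suc N)) < e\<close> show ?thesis by linarith
    qed
    then show ?thesis by blast
  qed
  have jp: "p (u - v) = nrm\<^bsub>CC\<^esub> (j u \<ominus>\<^bsub>CC\<^esub> j v)" for u v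
    by (simp add: j_def CC_minus CC_nrm_const)
  have cy: "cauchy y" unfolding cauchy_def
  proof (intro allI impI)
    fix e :: real assume "e > 0"
    then have e3: "e/3 > 0" by simp
    obtain M where M: "\<forall>n\<ge>M. nrm\<^bsub>CC\<^esub> (X n \<ominus>\<^bsub>CC\<^esub> j (y n)) < e/3" using small[OF e3] by blast
    obtain N where N: "\<forall>m\<ge>N. \<forall>n\<ge>N. nrm\<^bsub>CC\<^esub> (X m \<ominus>\<^bsub>CC\<^esub> X n) < e/3" using C e3 by blast
    have "p (y m - y n) < e" if mn: "m \<ge> max M N" "n \<ge> max M N" for m n
    proof -
      have "p (y m - y n) \<le> nrm\<^bsub>CC\<^esub> (j (y m) \<ominus>\<^bsub>CC\<^esub> X m) + nrm\<^bsub>CC\<^esub> (X m \<ominus>\<^bsub>CC\<^esub> X n) + nrm\<^bsub>CC\<^esub> (X n \<ominus>\<^bsub>CC\<^esub> j (y n))"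
        unfolding jp using tri[of "j (y m)" "X m" "j (y n)"] tri[of "X m" "X n" "j (y n)"] X by simp
      also have "nrm\<^bsub>CC\<^esub> (j (y m) \<ominus>\<^bsub>CC\<^esub> X m) = nrm\<^bsub>CC\<^esub> (X m \<ominus>\<^bsub>CC\<^esub> j (y m))" by (simp add: comm X)
      finally have *: "p (y m - y n) \<le> nrm\<^bsub>CC\<^esub> (X m \<ominus>\<^bsub>CC\<^esub> j (y m)) + nrm\<^bsub>CC\<^esub> (X m \<ominus>\<^bsub>CC\<^esub> X n) + nrm\<^bsub>CC\<^esub> (X n \<ominus>\<^bsub>CC\<^esub> j (y n))" .
      have "nrm\<^bsub>CC\<^esub> (X m \<ominus>\<^bsub>CC\<^esub> j (y m)) < e/3" "nrm\<^bsub>CC\<^esub> (X n \<ominus>\<^bsub>CC\<^esub> j (y n)) < e/3"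
        "nrm\<^bsub>CC\<^esub> (X m \<ominus>\<^bsub>CC\<^esub> X n) < e/3" using M N mn by simp_all
      with * show ?thesis by linarith
    qed
    then show "\<exists>N. \<forall>m\<ge>N. \<forall>n\<ge>N. p (y m - y n) < e" by blast
  qed
  define Y where "Y = cauchy_class p y"
  have Y: "Y \<in> carrier CC" by (simp add: Y_def cy)
  have nn: "0 \<le> nrm\<^bsub>CC\<^esub> U" if U: "U \<in> carrier CC" for U
  proof -
    obtain u where u: "cauchy u" "U = cauchy_class p u" using U by (metis CC_cases)
    show ?thesis unfolding u(2)
      by (rule LIMSEQ_le_const[OF CC_nrm_tendsto[OF u(1)]]) (simp add: p_nonneg)
  qed
  have "(\<lambda>n. nrm\<^bsub>CC\<^esub> (X n \<ominus>\<^bsub>CC\<^esub> Y)) \<longlonglongrightarrow> 0"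
  proof (rule LIMSEQ_I)
    fix e :: real assume "e > 0"
    then have e2: "e/2 > 0" by simp
    obtain M where M: "\<forall>n\<ge>M. nrm\<^bsub>CC\<^esub> (X n \<ominus>\<^bsub>CC\<^esub> j (y n)) < e/2" using small[OF e2] by blast
    obtain N where N: "\<forall>n\<ge>N. nrm\<^bsub>CC\<^esub> (Y \<ominus>\<^bsub>CC\<^esub> j (y n)) < e/2"
      using class_approx[OF cy e2] unfolding Y_def j_def by blast
    have "norm (nrm\<^bsub>CC\<^esub> (X n \<ominus>\<^bsub>CC\<^esub> Y) - 0) < e" if n: "n \<ge> max M N" for n
    proof -
      have "nrm\<^bsub>CC\<^esub> (X n \<ominus>\<^bsub>CC\<^esub> j (y n)) < e/2" "nrm\<^bsub>CC\<^esub> (Y \<ominus>\<^bsub>CC\<^esub> j (y n)) < e/2"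
        using M N n by auto
      then have "nrm\<^bsub>CC\<^esub> (X n \<ominus>\<^bsub>CC\<^esub> Y) < e"
        using tri[OF X j Y, of n "y n"] comm[OF Y j, of "y n"] by simp
      then show ?thesis using nn[of "X n \<ominus>\<^bsub>CC\<^esub> Y"] X Y by simp
    qed
    then show "\<exists>N. \<forall>n\<ge>N. norm (nrm\<^bsub>CC\<^esub> (X n \<ominus>\<^bsub>CC\<^esub> Y) - 0) < e" by blast
  qed
  with Y show ?thesis by blast
qed

lemma CC_cstar: "cstar_algebra CC"
proof (intro cstar_algebra.intro CC_ring cstar_algebra_axioms.intro)
  fix X assume "X \<in> carrier CC"
  then obtain x where x [simp]: "cauchy x" and X: "X = cauchy_class p x" by (rule CC_cases)
  note [simp] = cauchy_scale cauchy_adj cauchy_mult cauchy_add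
  fix c d :: complex
  show "c \<odot>\<^bsub>CC\<^esub> X \<in> carrier CC" by (simp add: X CC_smult)
  show "(c + d) \<odot>\<^bsub>CC\<^esub> X = c \<odot>\<^bsub>CC\<^esub> X \<oplus>\<^bsub>CC\<^esub> d \<odot>\<^bsub>CC\<^esub> X"
    by (simp add: X CC_smult CC_add const_add algebra_simps)
  show "(c * d) \<odot>\<^bsub>CC\<^esub> X = c \<odot>\<^bsub>CC\<^esub> (d \<odot>\<^bsub>CC\<^esub> X)"
    by (simp add: X CC_smult const_mult mult.assoc)
  show "1 \<odot>\<^bsub>CC\<^esub> X = X" by (simp add: X CC_smult)
  show "star\<^bsub>CC\<^esub> X \<in> carrier CC" by (simp add: X CC_star)
  show "star\<^bsub>CC\<^esub> (star\<^bsub>CC\<^esub> X) = X" by (simp add: X CC_star)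
  show "star\<^bsub>CC\<^esub> (c \<odot>\<^bsub>CC\<^esub> X) = cnj c \<odot>\<^bsub>CC\<^esub> star\<^bsub>CC\<^esub> X"
    by (simp add: X CC_star CC_smult adj_mult adj_const const_central)
  show "0 \<le> nrm\<^bsub>CC\<^esub> X"
    unfolding X by (rule LIMSEQ_le_const[OF CC_nrm_tendsto[OF x]]) (simp add: p_nonneg)
  show "nrm\<^bsub>CC\<^esub> X = 0 \<longleftrightarrow> X = \<zero>\<^bsub>CC\<^esub>"
  proof -
    have "X = \<zero>\<^bsub>CC\<^esub> \<longleftrightarrow> (\<lambda>n. p (x n)) \<longlonglongrightarrow> 0"
      using class_eq_iff[of x "\<lambda>n. 0"] by (simp add: X CC_zero null_iff)
    then show ?thesis using CC_nrm_tendsto[OF x] LIMSEQ_unique X by metis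
  qed
  show "nrm\<^bsub>CC\<^esub> (c \<odot>\<^bsub>CC\<^esub> X) = cmod c * nrm\<^bsub>CC\<^esub> X"
    unfolding X CC_smult
    by (rule CC_nrmI) (auto simp: p_scale intro!: tendsto_mult CC_nrm_tendsto)
  show "nrm\<^bsub>CC\<^esub> (star\<^bsub>CC\<^esub> X \<otimes>\<^bsub>CC\<^esub> X) = (nrm\<^bsub>CC\<^esub> X)\<^sup>2"
    unfolding X CC_star CC_mult[OF cauchy_adj[OF x] x]
    by (rule CC_nrmI) (auto simp: p_cstar intro!: tendsto_power CC_nrm_tendsto)
  fix Y assume "Y \<in> carrier CC"
  then obtain y where y [simp]: "cauchy y" and Y: "Y = cauchy_class p y" by (rule CC_cases)
  show "c \<odot>\<^bsub>CC\<^esub> (X \<oplus>\<^bsub>CC\<^esub> Y) = c \<odot>\<^bsub>CC\<^esub> X \<oplus>\<^bsub>CC\<^esub> c \<odot>\<^bsub>CC\<^esub> Y"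
    by (simp add: X Y CC_smult CC_add algebra_simps)
  show "(c \<odot>\<^bsub>CC\<^esub> X) \<otimes>\<^bsub>CC\<^esub> Y = c \<odot>\<^bsub>CC\<^esub> (X \<otimes>\<^bsub>CC\<^esub> Y)"
    by (simp add: X Y CC_smult CC_mult mult.assoc)
  show "X \<otimes>\<^bsub>CC\<^esub> (c \<odot>\<^bsub>CC\<^esub> Y) = c \<odot>\<^bsub>CC\<^esub> (X \<otimes>\<^bsub>CC\<^esub> Y)"
    by (simp add: X Y CC_smult CC_mult const_mult_left)
  show "star\<^bsub>CC\<^esub> (X \<oplus>\<^bsub>CC\<^esub> Y) = star\<^bsub>CC\<^esub> X \<oplus>\<^bsub>CC\<^esub> star\<^bsub>CC\<^esub> Y"
    by (simp add: X Y CC_star CC_add adj_add)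
  show "star\<^bsub>CC\<^esub> (X \<otimes>\<^bsub>CC\<^esub> Y) = star\<^bsub>CC\<^esub> Y \<otimes>\<^bsub>CC\<^esub> star\<^bsub>CC\<^esub> X"
    by (simp add: X Y CC_star CC_mult adj_mult)
  show "nrm\<^bsub>CC\<^esub> (X \<oplus>\<^bsub>CC\<^esub> Y) \<le> nrm\<^bsub>CC\<^esub> X + nrm\<^bsub>CC\<^esub> Y"
    by (rule CC_triangle) (simp_all add: X Y)
  show "nrm\<^bsub>CC\<^esub> (X \<otimes>\<^bsub>CC\<^esub> Y) \<le> nrm\<^bsub>CC\<^esub> X * nrm\<^bsub>CC\<^esub> Y"
    unfolding X Y CC_mult[OF x y]
    by (rule LIMSEQ_le[OF CC_nrm_tendsto[OF cauchy_mult[OF x y]]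
          tendsto_mult[OF CC_nrm_tendsto[OF x] CC_nrm_tendsto[OF y]]])
      (simp add: p_mult)
qed (rule CC_complete)

end

subsection \<open>The universal seminorm\<close>

definition admissible :: "'g star_poly set \<Rightarrow> bool" where
  "admissible R \<longleftrightarrow> (\<forall>x. bdd_above ((\<lambda>p. p x) ` rel_seminorms R))"

lemma zero_rel_seminorm: "(\<lambda>x. 0) \<in> rel_seminorms R"
  by (simp add: rel_seminorms_def cstar_seminorm_def)

lemma universal_upper:
  assumes "admissible R" "p \<in> rel_seminorms R"
  shows "p x \<le> universal_seminorm R x"
  unfolding universal_seminorm_def using assms
  by (intro cSUP_upper) (auto simp: admissible_def)

lemma universal_least:
  assumes "\<And>p. p \<in> rel_seminorms R \<Longrightarrow> p x \<le> K"
  shows "universal_seminorm R x \<le> K"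
  unfolding universal_seminorm_def using assms zero_rel_seminorm
  by (intro cSUP_least) auto

lemma rel_seminormD: "p \<in> rel_seminorms R \<Longrightarrow> cstar_seminorm p"
  by (simp add: rel_seminorms_def)

lemma universal_rel_seminorm:
  assumes adm: "admissible R"
  shows "universal_seminorm R \<in> rel_seminorms R"
proof -
  let ?U = "universal_seminorm R"
  note up = universal_upper[OF adm]
  have nn: "0 \<le> ?U x" for x using up[OF zero_rel_seminorm] .
  have sc: "?U (const c * x) \<le> cmod c * ?U x" for c x
  proof (rule universal_least)
    fix p assume p: "p \<in> rel_seminorms R"
    show "p (const c * x) \<le> cmod c * ?U x"
      using mult_left_mono[OF up[OF p, of x], of "cmod c"] cstar_seminorm.p_scale[OF rel_seminormD[OF p]] by simp
  qed
  have "cstar_seminorm ?U"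
  proof
    fix x y :: "'a star_poly" and c
    show "0 \<le> ?U x" by (rule nn)
    show "?U (x + y) \<le> ?U x + ?U y"
    proof (rule universal_least)
      fix p assume p: "p \<in> rel_seminorms R"
      show "p (x + y) \<le> ?U x + ?U y"
        using cstar_seminorm.p_triangle[OF rel_seminormD[OF p], of x y] up[OF p, of x] up[OF p, of y] by simp
    qed
    show "?U (x * y) \<le> ?U x * ?U y"
    proof (rule universal_least)
      fix p assume p: "p \<in> rel_seminorms R"
      have "p x * p y \<le> ?U x * ?U y"
        using up[OF p] nn cstar_seminorm.p_nonneg[OF rel_seminormD[OF p]] by (intro mult_mono) auto
      then show "p (x * y) \<le> ?U x * ?U y"
        using cstar_seminorm.p_mult[OF rel_seminormD[OF p], of x y] by simp
    qed
    show "?U (const c * x) = cmod c * ?U x"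
    proof (cases "c = 0")
      case True
      have "?U 0 \<le> 0" using sc[of 0 x] by simp
      then show ?thesis using True nn[of 0] by simp
    next
      case False
      have "x = const (inverse c) * (const c * x)"
        using False by (simp flip: mult.assoc const_mult)
      then have "?U x \<le> cmod (inverse c) * ?U (const c * x)" by (metis sc)
      then have "cmod c * ?U x \<le> cmod c * (cmod (inverse c) * ?U (const c * x))"
        by (intro mult_left_mono) auto
      also have "\<dots> = ?U (const c * x)" using False by (simp add: norm_inverse)
      finally have "cmod c * ?U x \<le> ?U (const c * x)" .
      then show ?thesis using sc[of c x] by simp
    qed
    show "?U (adj x * x) = (?U x)\<^sup>2"
    proof (rule antisym)
      show "?U (adj x * x) \<le> (?U x)\<^sup>2"
      proof (rule universal_least)
        fix p assume p: "p \<in> rel_seminorms R"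
        show "p (adj x * x) \<le> (?U x)\<^sup>2"
          using up[OF p] cstar_seminorm.p_nonneg[OF rel_seminormD[OF p]]
          by (simp add: cstar_seminorm.p_cstar[OF rel_seminormD[OF p]] power_mono)
      qed
      have "?U x \<le> sqrt (?U (adj x * x))"
      proof (rule universal_least)
        fix p assume p: "p \<in> rel_seminorms R"
        show "p x \<le> sqrt (?U (adj x * x))"
          using up[OF p, of "adj x * x"]
          by (simp add: cstar_seminorm.p_cstar[OF rel_seminormD[OF p]] real_le_rsqrt)
      qed
      then show "(?U x)\<^sup>2 \<le> ?U (adj x * x)" using nn
        by (metis power_mono real_sqrt_pow2)
    qed
  qed
  moreover have "?U r = 0" if "r \<in> R" for r
    using nn[of r] universal_least[of R r 0] that by (force simp: rel_seminorms_def)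
  ultimately show ?thesis by (simp add: rel_seminorms_def)
qed

lemma admissibleI:
  assumes "\<And>g. \<exists>M. \<forall>p\<in>rel_seminorms R. p (gen g) \<le> M"
  shows "admissible R"
proof -
  obtain M where M: "\<And>g p. p \<in> rel_seminorms R \<Longrightarrow> p (gen g) \<le> M g"
    using assms by metis
  have "\<exists>K. \<forall>p\<in>rel_seminorms R. p (Poly_Mapping.single (Word u) 1) \<le> K" for u :: "'a letter list"
  proof (induction u)
    case Nil
    then show ?case
      using cstar_seminorm.p_one[OF rel_seminormD]
      by (auto intro!: exI[of _ 1] simp flip: zero_word_def)
  next
    case (Cons l u)
    then obtain K where K: "\<forall>p\<in>rel_seminorms R. p (Poly_Mapping.single (Word u) 1) \<le> K" by blast
    define g where "g = (case l of Gen g \<Rightarrow> g | Adj g \<Rightarrow> g)"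
    have l: "Poly_Mapping.single (Word [l]) 1 = gen g \<or> Poly_Mapping.single (Word [l]) 1 = adj (gen g)"
      by (cases l) (simp_all add: g_def gen_def adj_single)
    have "p (Poly_Mapping.single (Word (l # u)) 1) \<le> M g * K" if p: "p \<in> rel_seminorms R" for p
    proof -
      interpret cstar_seminorm p using p by (rule rel_seminormD)
      have "p (Poly_Mapping.single (Word (l # u)) 1)
          = p (Poly_Mapping.single (Word [l]) 1 * Poly_Mapping.single (Word u) 1)"
        by (simp add: mult_single)
      also have "\<dots> \<le> p (Poly_Mapping.single (Word [l]) 1) * p (Poly_Mapping.single (Word u) 1)"
        by (rule p_mult)
      also have "p (Poly_Mapping.single (Word [l]) 1) = p (gen g)" using l p_adj by auto
      also have "p (gen g) * p (Poly_Mapping.single (Word u) 1) \<le> M g * K"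
        using M[OF p] K p p_nonneg order_trans[OF p_nonneg M[OF p]] by (intro mult_mono) auto
      finally show ?thesis .
    qed
    then show ?case by blast
  qed
  then have W: "\<exists>K. \<forall>p\<in>rel_seminorms R. p (Poly_Mapping.single w 1) \<le> K" for w :: "'a word"
    by (cases w) auto
  have "\<exists>K. \<forall>p\<in>rel_seminorms R. p x \<le> K" for x :: "'a star_poly"
  proof (induction x rule: star_poly_induct)
    case zero
    then show ?case
      using cstar_seminorm.p_zero[OF rel_seminormD] by (intro exI[of _ 0]) fastforce
  next
    case (add w c f)
    then obtain K L where K: "\<forall>p\<in>rel_seminorms R. p f \<le> K"
      and L: "\<forall>p\<in>rel_seminorms R. p (Poly_Mapping.single w 1) \<le> L" using W by blast
    have "p (Poly_Mapping.single w c + f) \<le> cmod c * L + K" if p: "p \<in> rel_seminorms R" for p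
    proof -
      interpret cstar_seminorm p using p by (rule rel_seminormD)
      have "p (Poly_Mapping.single w c) = cmod c * p (Poly_Mapping.single w 1)"
        using p_scale[of c "Poly_Mapping.single w 1"] by (simp add: const_def mult_single)
      then show ?thesis
        using p_triangle[of "Poly_Mapping.single w c" f] K L p
          mult_left_mono[of "p (Poly_Mapping.single w 1)" L "cmod c"] by fastforce
    qed
    then show ?case by blast
  qed
  then show ?thesis unfolding admissible_def bdd_above_def by (metis (no_types, lifting) image_iff)
qed

subsection \<open>Evaluation of *-polynomials in a C*-algebra\<close>

context cstar_algebra begin

lemma smult_zero [simp]: "c \<odot> \<zero> = \<zero>"
  using nrm_smult[of \<zero> c] nrm_eq_0[of "c \<odot> \<zero>"] nrm_eq_0[of \<zero>] by simp

lemma zero_smult [simp]: "x \<in> carrier A \<Longrightarrow> 0 \<odot> x = \<zero>"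
  using nrm_smult[of x 0] nrm_eq_0[of "0 \<odot> x"] by simp

lemma star_zero [simp]: "star \<zero> = \<zero>"
  using star_smult[of \<zero> 0] by simp

lemma star_one [simp]: "star \<one> = \<one>"
  by (metis l_one one_closed r_one star_closed star_mult star_star)

lemma nrm_zero [simp]: "nrm \<zero> = 0" using nrm_eq_0 by simp

lemma smult_uminus: "x \<in> carrier A \<Longrightarrow> (- c) \<odot> x = \<ominus> (c \<odot> x)"
  using smult_l_distr[of x "- c" c] by (intro minus_equality[symmetric]) (auto simp: )

lemma star_uminus: "x \<in> carrier A \<Longrightarrow> star (\<ominus> x) = \<ominus> star x"
  using star_smult[of x "-1"] smult_uminus[of x 1] smult_uminus[of "star x" 1] by simp

lemma nrm_uminus: "x \<in> carrier A \<Longrightarrow> nrm (\<ominus> x) = nrm x"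
  using nrm_smult[of x "-1"] smult_uminus[of x 1] by simp

lemma nrm_star: assumes x: "x \<in> carrier A" shows "nrm (star x) = nrm x"
proof -
  have le: "nrm y \<le> nrm (star y)" if y: "y \<in> carrier A" for y
  proof (cases "nrm y = 0")
    case False
    have "nrm y * nrm y \<le> nrm (star y) * nrm y"
      using nrm_mult[of "star y" y] cstar_identity[of y] y by (simp add: power2_eq_square)
    then show ?thesis using False nrm_nonneg[OF y] by (simp add: mult_le_cancel_right)
  qed (use nrm_nonneg y in simp)
  show ?thesis using le[of x] le[of "star x"] x by simp
qed

definition converges :: "(nat \<Rightarrow> 'a) \<Rightarrow> 'a \<Rightarrow> bool" where
  "converges s y \<longleftrightarrow> (\<forall>n. s n \<in> carrier A) \<and> y \<in> carrier A \<and> (\<lambda>n. nrm (s n \<ominus> y)) \<longlonglongrightarrow> 0"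

lemma convergesI:
  assumes "\<And>n. s n \<in> carrier A" "y \<in> carrier A" "t \<longlonglongrightarrow> 0" "\<And>n. nrm (s n \<ominus> y) \<le> t n"
  shows "converges s y"
  unfolding converges_def
proof (intro conjI)
  show "(\<lambda>n. nrm (s n \<ominus> y)) \<longlonglongrightarrow> 0"
    by (rule tendsto_sandwich[where f = "\<lambda>n. 0"]) (use assms nrm_nonneg in auto)
qed (use assms in auto)

lemma nrm_minus_commute: "x \<in> carrier A \<Longrightarrow> y \<in> carrier A \<Longrightarrow> nrm (x \<ominus> y) = nrm (y \<ominus> x)"
  using nrm_uminus[of "x \<ominus> y"] by (simp add: a_minus_def minus_add a_comm)

lemma nrm_triangle_minus:
  assumes "x \<in> carrier A" "y \<in> carrier A" "z \<in> carrier A"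
  shows "nrm (x \<ominus> z) \<le> nrm (x \<ominus> y) + nrm (y \<ominus> z)"
proof -
  have "x \<ominus> z = (x \<ominus> y) \<oplus> (y \<ominus> z)"
    using assms by (simp add: a_minus_def a_assoc r_neg1)
  then show ?thesis using nrm_triangle assms by simp
qed

lemma minus_eq_zero_iff: "x \<in> carrier A \<Longrightarrow> y \<in> carrier A \<Longrightarrow> x \<ominus> y = \<zero> \<longleftrightarrow> x = y"
  by (metis a_minus_def add.inv_solve_right l_zero minus_closed r_neg)

lemma converges_unique:
  assumes "converges s y" "converges s z" shows "y = z"
proof -
  have c: "y \<in> carrier A" "z \<in> carrier A" "\<And>n. s n \<in> carrier A" using assms by (auto simp: converges_def)
  have "(\<lambda>n. nrm (s n \<ominus> y) + nrm (s n \<ominus> z)) \<longlonglongrightarrow> 0"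
    using tendsto_add[of "\<lambda>n. nrm (s n \<ominus> y)" 0] assms by (fastforce simp: converges_def)
  moreover have "nrm (y \<ominus> z) \<le> nrm (s n \<ominus> y) + nrm (s n \<ominus> z)" for n
    using nrm_triangle_minus[of y "s n" z] nrm_minus_commute[of y "s n"] c by simp
  ultimately have "nrm (y \<ominus> z) \<le> 0" by (intro LIMSEQ_le_const) auto
  then show ?thesis using nrm_nonneg[of "y \<ominus> z"] nrm_eq_0[of "y \<ominus> z"] minus_eq_zero_iff c by simp
qed

lemma add_minus_add:
  assumes "a \<in> carrier A" "b \<in> carrier A" "c \<in> carrier A" "d \<in> carrier A"
  shows "(a \<oplus> b) \<ominus> (c \<oplus> d) = (a \<ominus> c) \<oplus> (b \<ominus> d)"
  using assms by (simp add: a_minus_def minus_add a_ac)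

lemma converges_add:
  assumes "converges s y" "converges t z"
  shows "converges (\<lambda>n. s n \<oplus> t n) (y \<oplus> z)"
proof (rule convergesI)
  have c: "y \<in> carrier A" "z \<in> carrier A" "\<And>n. s n \<in> carrier A" "\<And>n. t n \<in> carrier A"
    using assms by (auto simp: converges_def)
  show "(\<lambda>n. nrm (s n \<ominus> y) + nrm (t n \<ominus> z)) \<longlonglongrightarrow> 0"
    using tendsto_add[of "\<lambda>n. nrm (s n \<ominus> y)" 0] assms by (fastforce simp: converges_def)
  show "nrm (s n \<oplus> t n \<ominus> (y \<oplus> z)) \<le> nrm (s n \<ominus> y) + nrm (t n \<ominus> z)" for n
    using c by (simp add: add_minus_add nrm_triangle)
qed (use assms in \<open>auto simp: converges_def\<close>)

lemma converges_smult:
  assumes "converges s y"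
  shows "converges (\<lambda>n. c \<odot> s n) (c \<odot> y)"
proof (rule convergesI)
  have c: "y \<in> carrier A" "\<And>n. s n \<in> carrier A" using assms by (auto simp: converges_def)
  show "(\<lambda>n. cmod c * nrm (s n \<ominus> y)) \<longlonglongrightarrow> 0"
    using tendsto_mult[OF tendsto_const, of "\<lambda>n. nrm (s n \<ominus> y)" 0] assms by (fastforce simp: converges_def)
  have "c \<odot> s n \<ominus> c \<odot> y = c \<odot> (s n \<ominus> y)" for n
    using c smult_uminus[of "c \<odot> y" 1] smult_uminus[of y 1]
      smult_assoc[of y "-1" c] smult_assoc[of y c "-1"]
    by (simp add: a_minus_def smult_r_distr)
  then show "nrm (c \<odot> s n \<ominus> c \<odot> y) \<le> cmod c * nrm (s n \<ominus> y)" for n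
    using c nrm_smult[of "s n \<ominus> y" c] by simp
qed (use assms in \<open>auto simp: converges_def\<close>)

lemma converges_star:
  assumes "converges s y"
  shows "converges (\<lambda>n. star (s n)) (star y)"
proof (rule convergesI)
  have c: "y \<in> carrier A" "\<And>n. s n \<in> carrier A" using assms by (auto simp: converges_def)
  show "(\<lambda>n. nrm (s n \<ominus> y)) \<longlonglongrightarrow> 0" using assms by (simp add: converges_def)
  have "star (s n) \<ominus> star y = star (s n \<ominus> y)" for n
    using c by (simp add: a_minus_def star_add star_uminus)
  then show "nrm (star (s n) \<ominus> star y) \<le> nrm (s n \<ominus> y)" for n
    using c nrm_star[of "s n \<ominus> y"] by simp
qed (use assms in \<open>auto simp: converges_def\<close>)

lemma nrm_le_minus: "x \<in> carrier A \<Longrightarrow> y \<in> carrier A \<Longrightarrow> nrm x \<le> nrm (x \<ominus> y) + nrm y"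
  using nrm_triangle_minus[of x y \<zero>] by (simp add: a_minus_def)

lemma converges_nrm:
  assumes "converges s y" shows "(\<lambda>n. nrm (s n)) \<longlonglongrightarrow> nrm y"
proof -
  have c: "y \<in> carrier A" "\<And>n. s n \<in> carrier A" using assms by (auto simp: converges_def)
  have "(\<lambda>n. nrm (s n) - nrm y) \<longlonglongrightarrow> 0"
  proof (rule Lim_null_comparison)
    show "(\<lambda>n. nrm (s n \<ominus> y)) \<longlonglongrightarrow> 0" using assms by (simp add: converges_def)
    show "\<forall>\<^sub>F n in sequentially. norm (nrm (s n) - nrm y) \<le> nrm (s n \<ominus> y)"
    proof (rule always_eventually, rule allI)
      fix n show "norm (nrm (s n) - nrm y) \<le> nrm (s n \<ominus> y)"
        using nrm_le_minus[of "s n" y] nrm_le_minus[of y "s n"] nrm_minus_commute[of y "s n"] c by (simp add: abs_le_iff)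
    qed
  qed
  then show ?thesis by (simp add: LIM_zero_iff)
qed

lemma converges_mult:
  assumes "converges s y" "converges t z"
  shows "converges (\<lambda>n. s n \<otimes> t n) (y \<otimes> z)"
proof (rule convergesI)
  have c: "y \<in> carrier A" "z \<in> carrier A" "\<And>n. s n \<in> carrier A" "\<And>n. t n \<in> carrier A"
    using assms by (auto simp: converges_def)
  show "(\<lambda>n. nrm (s n) * nrm (t n \<ominus> z) + nrm (s n \<ominus> y) * nrm z) \<longlonglongrightarrow> 0"
    using assms converges_nrm[OF assms(1)]
    by (auto intro!: tendsto_add_zero tendsto_mult_left_zero tendsto_eq_intros simp: converges_def)
  fix n
  have "s n \<otimes> (t n \<ominus> z) = s n \<otimes> t n \<ominus> s n \<otimes> z" "(s n \<ominus> y) \<otimes> z = s n \<otimes> z \<ominus> y \<otimes> z"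
    using c by (simp_all add: a_minus_def l_distr r_distr l_minus r_minus)
  then have "s n \<otimes> t n \<ominus> y \<otimes> z = s n \<otimes> (t n \<ominus> z) \<oplus> (s n \<ominus> y) \<otimes> z"
    using c by (simp add: a_minus_def a_assoc r_neg1)
  then show "nrm (s n \<otimes> t n \<ominus> y \<otimes> z) \<le> nrm (s n) * nrm (t n \<ominus> z) + nrm (s n \<ominus> y) * nrm z"
    using nrm_triangle[of "s n \<otimes> (t n \<ominus> z)" "(s n \<ominus> y) \<otimes> z"]
      nrm_mult[of "s n" "t n \<ominus> z"] nrm_mult[of "s n \<ominus> y" z] c by simp
qed (use assms in \<open>auto simp: converges_def\<close>)

lemma converges_const: "y \<in> carrier A \<Longrightarrow> converges (\<lambda>n. y) y"
  by (simp add: converges_def a_minus_def r_neg)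

lemma converges_close:
  assumes "converges s y" "\<And>n. t n \<in> carrier A" "(\<lambda>n. nrm (t n \<ominus> s n)) \<longlonglongrightarrow> 0"
  shows "converges t y"
proof (rule convergesI)
  have c: "y \<in> carrier A" "\<And>n. s n \<in> carrier A" using assms by (auto simp: converges_def)
  show "(\<lambda>n. nrm (t n \<ominus> s n) + nrm (s n \<ominus> y)) \<longlonglongrightarrow> 0"
    using tendsto_add[OF assms(3), of "\<lambda>n. nrm (s n \<ominus> y)" 0] assms(1) by (simp add: converges_def)
  show "nrm (t n \<ominus> y) \<le> nrm (t n \<ominus> s n) + nrm (s n \<ominus> y)" for n
    using c assms by (intro nrm_triangle_minus) auto
qed (use assms in \<open>auto simp: converges_def\<close>)

fun eval_letter :: "('g \<Rightarrow> 'a) \<Rightarrow> 'g letter \<Rightarrow> 'a" where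
  "eval_letter f (Gen g) = f g"
| "eval_letter f (Adj g) = star (f g)"

fun eval_word :: "('g \<Rightarrow> 'a) \<Rightarrow> 'g word \<Rightarrow> 'a" where
  "eval_word f (Word u) = foldr (\<lambda>l y. eval_letter f l \<otimes> y) u \<one>"

definition eval :: "('g \<Rightarrow> 'a) \<Rightarrow> 'g star_poly \<Rightarrow> 'a" where
  "eval f x = (\<Oplus>w\<in>Poly_Mapping.keys x. Poly_Mapping.lookup x w \<odot> eval_word f w)"

context
  fixes f :: "'g \<Rightarrow> 'a"
  assumes f: "\<And>g. f g \<in> carrier A"
begin

lemma eval_letter_closed [simp]: "eval_letter f l \<in> carrier A"
  using f by (cases l) auto

lemma eval_word_closed [simp]: "eval_word f w \<in> carrier A"
proof -
  have "foldr (\<lambda>l y. eval_letter f l \<otimes> y) u \<one> \<in> carrier A" for u by (induction u) auto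
  then show ?thesis by (cases w) simp
qed

lemma eval_word_0 [simp]: "eval_word f 0 = \<one>" by (simp add: zero_word_def)

lemma eval_word_add: "eval_word f (v + w) = eval_word f v \<otimes> eval_word f w"
proof -
  have "eval_word f (Word (u @ u')) = eval_word f (Word u) \<otimes> eval_word f (Word u')" for u u'
  proof (induction u)
    case (Cons l u)
    have "eval_word f (Word ((l # u) @ u')) = eval_letter f l \<otimes> (eval_word f (Word u) \<otimes> eval_word f (Word u'))"
      using Cons by simp
    also have "\<dots> = (eval_letter f l \<otimes> eval_word f (Word u)) \<otimes> eval_word f (Word u')"
      by (rule m_assoc[symmetric]) (simp_all del: eval_word.simps)
    finally show ?case by simp
  qed (use eval_word_closed[of "Word u'"] in simp)
  then show ?thesis by (cases v; cases w) simp
qed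

lemma eval_word_adj: "eval_word f (adj_word w) = star (eval_word f w)"
proof -
  have "eval_word f (adj_word (Word u)) = star (eval_word f (Word u))" for u
  proof (induction u)
    case (Cons l u)
    have "adj_word (Word (l # u)) = adj_word (Word u) + Word [adj_letter l]" by simp
    then have "eval_word f (adj_word (Word (l # u))) = star (eval_word f (Word u)) \<otimes> eval_word f (Word [adj_letter l])"
      by (simp only: eval_word_add Cons)
    also have "eval_word f (Word [adj_letter l]) = star (eval_letter f l)"
      using f by (cases l) simp_all
    also have "star (eval_word f (Word u)) \<otimes> star (eval_letter f l) = star (eval_letter f l \<otimes> eval_word f (Word u))"
      by (rule star_mult[symmetric]) (simp_all del: eval_word.simps)
    finally show ?case by simp
  qed simp
  then show ?thesis by (cases w) simp
qed

lemma eval_superset: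
  assumes "finite S" "Poly_Mapping.keys x \<subseteq> S"
  shows "eval f x = (\<Oplus>w\<in>S. Poly_Mapping.lookup x w \<odot> eval_word f w)"
  unfolding eval_def
  using assms by (intro add.finprod_mono_neutral_cong_left) (auto simp: in_keys_iff)

lemma eval_closed [simp]: "eval f x \<in> carrier A"
  unfolding eval_def by (rule finsum_closed) auto

lemma eval_add: "eval f (x + y) = eval f x \<oplus> eval f y"
proof -
  let ?S = "Poly_Mapping.keys x \<union> Poly_Mapping.keys y"
  have "eval f (x + y) = (\<Oplus>w\<in>?S. Poly_Mapping.lookup (x + y) w \<odot> eval_word f w)"
    using Poly_Mapping.keys_add[of x y] by (intro eval_superset) auto
  also have "\<dots> = (\<Oplus>w\<in>?S. Poly_Mapping.lookup x w \<odot> eval_word f w \<oplus> Poly_Mapping.lookup y w \<odot> eval_word f w)"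
    by (rule finsum_cong) (auto simp: lookup_add smult_l_distr simp_implies_def)
  also have "\<dots> = eval f x \<oplus> eval f y"
    by (subst finsum_addf) (auto simp: eval_superset[of ?S])
  finally show ?thesis .
qed

lemma eval_zero [simp]: "eval f 0 = \<zero>" by (simp add: eval_def)

lemma eval_single: "eval f (Poly_Mapping.single w c) = c \<odot> eval_word f w"
proof -
  have "eval f (Poly_Mapping.single w c) = (\<Oplus>v\<in>{w}. Poly_Mapping.lookup (Poly_Mapping.single w c) v \<odot> eval_word f v)"
    by (rule eval_superset) auto
  then show ?thesis by simp
qed

lemma eval_one [simp]: "eval f 1 = \<one>"
  using eval_single[of 0 1] by simp

lemma eval_const_mult: "eval f (const c * x) = c \<odot> eval f x"
  by (induction x rule: star_poly_induct)
    (simp_all add: distrib_left eval_add const_def mult_single eval_single smult_assoc smult_r_distr)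

lemma eval_const: "eval f (const c) = c \<odot> \<one>"
  by (simp add: const_def eval_single)

lemma eval_uminus: "eval f (- x) = \<ominus> eval f x"
  using eval_const_mult[of "-1" x] smult_uminus[of "eval f x" 1] by (simp add: const_uminus)

lemma eval_diff: "eval f (x - y) = eval f x \<ominus> eval f y"
  using eval_add[of x "- y"] by (simp add: eval_uminus a_minus_def)

lemma eval_mult: "eval f (x * y) = eval f x \<otimes> eval f y"
proof (induction x rule: star_poly_induct)
  case (add v c x)
  have "eval f (Poly_Mapping.single v c * y) = eval f (Poly_Mapping.single v c) \<otimes> eval f y"
  proof (induction y rule: star_poly_induct)
    case (add w d y)
    then show ?case
      by (simp add: distrib_left eval_add mult_single eval_single r_distr eval_word_add
          smult_mult_left smult_mult_right flip: smult_assoc) (simp add: mult.commute)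
  qed simp
  with add show ?case by (simp add: distrib_right eval_add l_distr)
qed simp

lemma eval_adj: "eval f (adj x) = star (eval f x)"
  by (induction x rule: star_poly_induct)
    (simp_all add: adj_add eval_add adj_single eval_single eval_word_adj star_add star_smult)

lemma eval_gen [simp]: "eval f (gen g) = f g"
  using f by (simp add: gen_def eval_single)

lemma eval_seminorm: "cstar_seminorm (\<lambda>x. nrm (eval f x))"
proof
  show "nrm (eval f (const c * x)) = cmod c * nrm (eval f x)" for c x
    by (simp add: eval_const_mult nrm_smult)
qed (simp_all add: nrm_nonneg eval_add nrm_triangle eval_mult nrm_mult eval_adj cstar_identity)

end

end

subsection \<open>The universal property\<close>

context
  fixes R :: "'g star_poly set"
  assumes adm: "admissible R"
begin

interpretation U: cstar_seminorm "universal_seminorm R"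
  using universal_rel_seminorm[OF adm] by (rule rel_seminormD)

lemma universal_cstar_algebra: "cstar_algebra (universal_cstar R)"
  unfolding universal_cstar_def by (rule U.CC_cstar)

lemma universal_elem_hom:
  "universal_elem R x \<in> carrier (universal_cstar R)"
  "universal_elem R (x + y) = universal_elem R x \<oplus>\<^bsub>universal_cstar R\<^esub> universal_elem R y"
  "universal_elem R (x * y) = universal_elem R x \<otimes>\<^bsub>universal_cstar R\<^esub> universal_elem R y"
  "universal_elem R (const c * x) = c \<odot>\<^bsub>universal_cstar R\<^esub> universal_elem R x"
  "universal_elem R (adj x) = star\<^bsub>universal_cstar R\<^esub> (universal_elem R x)"
  "universal_elem R 1 = \<one>\<^bsub>universal_cstar R\<^esub>"
  "universal_elem R (x - y) = universal_elem R x \<ominus>\<^bsub>universal_cstar R\<^esub> universal_elem R y"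
  "nrm\<^bsub>universal_cstar R\<^esub> (universal_elem R x) = universal_seminorm R x"
  by (simp_all add: universal_elem_def universal_cstar_def U.CC_add U.CC_mult U.CC_smult U.CC_star
      U.CC_one U.CC_minus U.CC_nrm_const)

lemma universal_elem_relation:
  assumes "r \<in> R" shows "universal_elem R r = \<zero>\<^bsub>universal_cstar R\<^esub>"
proof -
  have "universal_seminorm R r = 0"
    using universal_rel_seminorm[OF adm] assms by (simp add: rel_seminorms_def)
  then show ?thesis
    using universal_elem_hom(8)[of r] universal_elem_hom(1)[of r]
      cstar_algebra.nrm_eq_0[OF universal_cstar_algebra] by metis
qed

lemma universal_dense:
  assumes "X \<in> carrier (universal_cstar R)" "e > 0"
  shows "\<exists>x. nrm\<^bsub>universal_cstar R\<^esub> (X \<ominus>\<^bsub>universal_cstar R\<^esub> universal_elem R x) < e"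
proof -
  obtain x where "U.cauchy x" "X = cauchy_class (universal_seminorm R) x"
    using assms(1) unfolding universal_cstar_def by (rule U.CC_cases)
  then show ?thesis
    using U.class_approx[of x e] assms(2) unfolding universal_cstar_def universal_elem_def by blast
qed

theorem universal_property:
  fixes B :: "('b, 'm) star_alg_scheme"
  assumes B: "cstar_algebra B" and f: "\<And>g. f g \<in> carrier B"
    and rel: "\<And>r. r \<in> R \<Longrightarrow> cstar_algebra.eval B f r = \<zero>\<^bsub>B\<^esub>"
  shows "\<exists>\<phi>\<in>star_hom (universal_cstar R) B.
    (\<forall>X\<in>carrier (universal_cstar R). nrm\<^bsub>B\<^esub> (\<phi> X) \<le> nrm\<^bsub>universal_cstar R\<^esub> X) \<and>
    (\<forall>g. \<phi> (universal_elem R (gen g)) = f g)"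
proof -
  interpret B: cstar_algebra B by (rule B)
  let ?e = "B.eval f" and ?U = "universal_seminorm R" and ?A = "universal_cstar R"
  note [simp] = B.eval_closed[OF f]
  have le: "nrm\<^bsub>B\<^esub> (?e x) \<le> ?U x" for x
    using rel by (intro universal_upper[OF adm]) (simp add: rel_seminorms_def B.eval_seminorm[OF f])
  have "\<exists>y. B.converges (\<lambda>n. ?e (x n)) y" if x: "U.cauchy x" for x
  proof -
    have "\<forall>e>0. \<exists>N. \<forall>m\<ge>N. \<forall>n\<ge>N. nrm\<^bsub>B\<^esub> (?e (x m) \<ominus>\<^bsub>B\<^esub> ?e (x n)) < e"
      using x le unfolding U.cauchy_def B.eval_diff[OF f, symmetric] by (meson order_le_less_trans)
    then show ?thesis using B.nrm_complete[of "\<lambda>n. ?e (x n)"] by (auto simp: B.converges_def)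
  qed
  then obtain L where L: "\<And>x. U.cauchy x \<Longrightarrow> B.converges (\<lambda>n. ?e (x n)) (L x)" by metis
  define \<phi> where "\<phi> X = L (rep X)" for X
  have conv: "B.converges (\<lambda>n. ?e (x n)) (\<phi> (cauchy_class ?U x))" if x: "U.cauchy x" for x
  proof -
    let ?r = "rep (cauchy_class ?U x)"
    have n: "(\<lambda>n. ?U (?r n - x n)) \<longlonglongrightarrow> 0" using U.rep_class[of x] by (simp add: U.null_iff)
    have "U.cauchy ?r"
      using U.cauchy_add[OF U.null_cauchy[OF U.rep_class[of x]] x] by simp
    then have "B.converges (\<lambda>n. ?e (?r n)) (\<phi> (cauchy_class ?U x))" unfolding \<phi>_def by (rule L)
    then show ?thesis
    proof (rule B.converges_close)
      show "(\<lambda>n. nrm\<^bsub>B\<^esub> (?e (x n) \<ominus>\<^bsub>B\<^esub> ?e (?r n))) \<longlonglongrightarrow> 0"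
      proof (rule tendsto_sandwich[where f = "\<lambda>n. 0", OF _ _ tendsto_const n])
        show "\<forall>\<^sub>F n in sequentially. nrm\<^bsub>B\<^esub> (?e (x n) \<ominus>\<^bsub>B\<^esub> ?e (?r n)) \<le> ?U (?r n - x n)"
          using le U.p_minus_commute by (auto simp flip: B.eval_diff[OF f] intro!: always_eventually)
      qed (simp add: B.nrm_nonneg)
    qed simp
  qed
  have eq: "\<phi> (cauchy_class ?U x) = y" if "U.cauchy x" "B.converges (\<lambda>n. ?e (x n)) y" for x y
    using conv that B.converges_unique by blast
  have closed: "\<phi> X \<in> carrier B" if "X \<in> carrier ?A" for X
    using that conv unfolding universal_cstar_def by (metis U.CC_cases B.converges_def)
  have "\<phi> \<in> star_hom ?A B"
    unfolding star_hom_def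
  proof (intro CollectI conjI ring_hom_memI ballI allI)
    fix X assume "X \<in> carrier ?A"
    then obtain x where x: "U.cauchy x" "X = cauchy_class ?U x"
      unfolding universal_cstar_def by (rule U.CC_cases)
    show "\<phi> X \<in> carrier B" using \<open>X \<in> carrier ?A\<close> by (rule closed)
    show "\<phi> (c \<odot>\<^bsub>?A\<^esub> X) = c \<odot>\<^bsub>B\<^esub> \<phi> X" for c
      unfolding universal_cstar_def x U.CC_smult
      using B.converges_smult[OF conv[OF x(1)]]
      by (intro eq) (simp_all add: U.cauchy_scale x B.eval_const_mult[OF f])
    show "\<phi> (star\<^bsub>?A\<^esub> X) = star\<^bsub>B\<^esub> (\<phi> X)"
      unfolding universal_cstar_def x U.CC_star
      using B.converges_star[OF conv[OF x(1)]]
      by (intro eq) (simp_all add: U.cauchy_adj x B.eval_adj[OF f])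
    fix Y assume "Y \<in> carrier ?A"
    then obtain y where y: "U.cauchy y" "Y = cauchy_class ?U y"
      unfolding universal_cstar_def by (rule U.CC_cases)
    show "\<phi> (X \<oplus>\<^bsub>?A\<^esub> Y) = \<phi> X \<oplus>\<^bsub>B\<^esub> \<phi> Y"
      unfolding universal_cstar_def x y U.CC_add[OF x(1) y(1)]
      using B.converges_add[OF conv[OF x(1)] conv[OF y(1)]]
      by (intro eq) (simp_all add: U.cauchy_add x y B.eval_add[OF f])
    show "\<phi> (X \<otimes>\<^bsub>?A\<^esub> Y) = \<phi> X \<otimes>\<^bsub>B\<^esub> \<phi> Y"
      unfolding universal_cstar_def x y U.CC_mult[OF x(1) y(1)]
      using B.converges_mult[OF conv[OF x(1)] conv[OF y(1)]]
      by (intro eq) (simp_all add: U.cauchy_mult x y B.eval_mult[OF f])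
  next
    show "\<phi> \<one>\<^bsub>?A\<^esub> = \<one>\<^bsub>B\<^esub>"
      unfolding universal_cstar_def U.CC_one
      by (intro eq) (simp_all add: B.eval_one[OF f] B.converges_const)
  qed
  moreover have "nrm\<^bsub>B\<^esub> (\<phi> X) \<le> nrm\<^bsub>?A\<^esub> X" if X: "X \<in> carrier ?A" for X
  proof -
    obtain x where x: "U.cauchy x" "X = cauchy_class ?U x"
      using X unfolding universal_cstar_def by (rule U.CC_cases)
    show ?thesis unfolding universal_cstar_def x(2)
      by (rule LIMSEQ_le[OF B.converges_nrm[OF conv[OF x(1)]] U.CC_nrm_tendsto[OF x(1)]]) (simp add: le)
  qed
  moreover have "\<phi> (universal_elem R (gen g)) = f g" for g
    unfolding universal_elem_def
    by (intro eq) (simp_all add: B.eval_gen[OF f] B.converges_const f)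
  ultimately show ?thesis by blast
qed

end

subsection \<open>The case of \<open>C(U\<^sub>q(2))\<close>\<close>

lemma (in cstar_seminorm) p_eq_of_diff: "p (x - y) = 0 \<Longrightarrow> p x = p y"
  using p_abs_diff[of x y] by simp

lemma Uq2_admissible:
  assumes q: "cmod q \<noteq> 1"
  shows "admissible (Uq2_relations q)"
proof (rule admissibleI)
  fix g
  define c where "c = (cmod q)\<^sup>2"
  have c: "c \<noteq> 1" "c \<ge> 0" using q norm_ge_zero[of q] by (auto simp: c_def power2_eq_1_iff simp del: norm_ge_zero)
  define t where "t = 2 / \<bar>1 - c\<bar>"
  have "p (gen g) \<le> 1 + t" if p: "p \<in> rel_seminorms (Uq2_relations q)" for p
  proof -
    interpret cstar_seminorm p using p by (rule rel_seminormD)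
    define a b D :: "Uq2_gen star_poly" where "a = gen Gen_a" and "b = gen Gen_b" and "D = gen Gen_D"
    have r: "p (b * adj b - adj b * b) = 0" "p (a * adj a + b * adj b - 1) = 0"
      "p (adj D * D - 1) = 0" "p (adj a * a + const (of_real c) * (adj b * b) - 1) = 0"
      using p by (auto simp: rel_seminorms_def Uq2_relations_def Let_def a_def b_def D_def c_def)
    have bb: "p (adj b * b) = (p b)\<^sup>2" "p (b * adj b) = (p b)\<^sup>2"
      using p_cstar[of b] p_cstar[of "adj b"] by simp_all
    have aa: "p (adj a * a) = (p a)\<^sup>2" "p (a * adj a) = (p a)\<^sup>2"
      using p_cstar[of a] p_cstar[of "adj a"] by simp_all
    have 1: "(p a)\<^sup>2 = p (1 - b * adj b)"
      using p_eq_of_diff[of "a * adj a" "1 - b * adj b"] r(2) aa by (simp add: algebra_simps)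
    have 2: "(p a)\<^sup>2 = p (1 - const (of_real c) * (adj b * b))"
      using p_eq_of_diff[of "adj a * a" "1 - const (of_real c) * (adj b * b)"] r(4) aa
      by (simp add: algebra_simps)
    have s: "p (const (of_real c) * (adj b * b)) = c * (p b)\<^sup>2"
      using p_scale[of "of_real c" "adj b * b"] bb c by simp
    have d1: "\<bar>p (1 - x) - p x\<bar> \<le> 1" for x
      using p_abs_diff[of "1 - x" "- x"] p_one by simp
    have "\<bar>(1 - c) * (p b)\<^sup>2\<bar> \<le> 2"
      using d1[of "b * adj b"] d1[of "const (of_real c) * (adj b * b)"]
      unfolding 1[symmetric] 2[symmetric] s bb by (simp add: left_diff_distrib)
    then have "\<bar>1 - c\<bar> * (p b)\<^sup>2 \<le> 2" by (simp add: abs_mult del: left_diff_distrib')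
    then have t: "(p b)\<^sup>2 \<le> t" using c by (simp add: t_def pos_le_divide_eq mult.commute)
    have a: "(p a)\<^sup>2 \<le> 1 + t"
      using d1[of "b * adj b"] t unfolding 1[symmetric] bb by simp
    have "p (adj D * D) \<le> 1" using p_eq_of_diff[OF r(3)] p_one by simp
    then have D: "(p D)\<^sup>2 \<le> 1" by (simp add: p_cstar)
    have t0: "t \<ge> 0" by (simp add: t_def)
    have sq: "y \<le> 1 + t" if "y\<^sup>2 \<le> 1 + t" for y :: real
    proof -
      have "y \<le> (1 + y\<^sup>2) / 2" using sum_squares_bound[of y 1] by simp
      then show ?thesis using that t0 by simp
    qed
    show ?thesis
      using sq[of "p a"] sq[of "p b"] sq[of "p D"] a t D t0 by (cases g) (auto simp: a_def b_def D_def)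
  qed
  then show "\<exists>M. \<forall>p\<in>rel_seminorms (Uq2_relations q). p (gen g) \<le> M" by blast
qed

definition satisfies_Uq2 :: "complex \<Rightarrow> ('a, 'm) star_alg_scheme \<Rightarrow> 'a \<Rightarrow> 'a \<Rightarrow> 'a \<Rightarrow> bool" where
  "satisfies_Uq2 q A a b D \<longleftrightarrow> {a, b, D} \<subseteq> carrier A \<and>
     b \<otimes>\<^bsub>A\<^esub> a = q \<odot>\<^bsub>A\<^esub> (a \<otimes>\<^bsub>A\<^esub> b) \<and>
     star\<^bsub>A\<^esub> a \<otimes>\<^bsub>A\<^esub> b = q \<odot>\<^bsub>A\<^esub> (b \<otimes>\<^bsub>A\<^esub> star\<^bsub>A\<^esub> a) \<and>
     b \<otimes>\<^bsub>A\<^esub> star\<^bsub>A\<^esub> b = star\<^bsub>A\<^esub> b \<otimes>\<^bsub>A\<^esub> b \<and>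
     a \<otimes>\<^bsub>A\<^esub> star\<^bsub>A\<^esub> a \<oplus>\<^bsub>A\<^esub> b \<otimes>\<^bsub>A\<^esub> star\<^bsub>A\<^esub> b = \<one>\<^bsub>A\<^esub> \<and>
     a \<otimes>\<^bsub>A\<^esub> D = D \<otimes>\<^bsub>A\<^esub> a \<and>
     b \<otimes>\<^bsub>A\<^esub> D = (q\<^sup>2 / (complex_of_real (cmod q))\<^sup>2) \<odot>\<^bsub>A\<^esub> (D \<otimes>\<^bsub>A\<^esub> b) \<and>
     D \<otimes>\<^bsub>A\<^esub> star\<^bsub>A\<^esub> D = \<one>\<^bsub>A\<^esub> \<and> star\<^bsub>A\<^esub> D \<otimes>\<^bsub>A\<^esub> D = \<one>\<^bsub>A\<^esub> \<and>
     star\<^bsub>A\<^esub> a \<otimes>\<^bsub>A\<^esub> a \<oplus>\<^bsub>A\<^esub> (complex_of_real (cmod q))\<^sup>2 \<odot>\<^bsub>A\<^esub> (star\<^bsub>A\<^esub> b \<otimes>\<^bsub>A\<^esub> b) = \<one>\<^bsub>A\<^esub>"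

definition Uq2_elem :: "complex \<Rightarrow> Uq2_gen \<Rightarrow> (nat \<Rightarrow> Uq2_gen star_poly) set" where
  "Uq2_elem q g = universal_elem (Uq2_relations q) (gen g)"

theorem C_Uq2_cstar_algebra: "cmod q \<noteq> 1 \<Longrightarrow> cstar_algebra (C_Uq2 q)"
  unfolding C_Uq2_def by (rule universal_cstar_algebra[OF Uq2_admissible])

theorem C_Uq2_relations:
  assumes "cmod q \<noteq> 1"
  shows "satisfies_Uq2 q (C_Uq2 q) (Uq2_elem q Gen_a) (Uq2_elem q Gen_b) (Uq2_elem q Gen_D)"
proof -
  note adm = Uq2_admissible[OF assms]
  interpret A: cstar_algebra "C_Uq2 q" by (rule C_Uq2_cstar_algebra[OF assms])
  note hom = universal_elem_hom[OF adm, folded C_Uq2_def]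
  have rel: "universal_elem (Uq2_relations q) x = universal_elem (Uq2_relations q) y"
    if "x - y \<in> Uq2_relations q" for x y
    using universal_elem_relation[OF adm that] hom(7)[of x y] hom(1) A.minus_eq_zero_iff
    by (simp add: C_Uq2_def)
  show ?thesis
    unfolding satisfies_Uq2_def Uq2_elem_def hom(2-6)[symmetric]
    by (auto intro!: rel simp: hom(1)) (simp_all add: Uq2_relations_def Let_def)
qed

theorem C_Uq2_universal:
  fixes B :: "('b, 'm) star_alg_scheme"
  assumes "cmod q \<noteq> 1" and B: "cstar_algebra B" and s: "satisfies_Uq2 q B a b D"
  shows "\<exists>\<phi>\<in>star_hom (C_Uq2 q) B.
    (\<forall>X\<in>carrier (C_Uq2 q). nrm\<^bsub>B\<^esub> (\<phi> X) \<le> nrm\<^bsub>C_Uq2 q\<^esub> X) \<and>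
    \<phi> (Uq2_elem q Gen_a) = a \<and> \<phi> (Uq2_elem q Gen_b) = b \<and> \<phi> (Uq2_elem q Gen_D) = D"
proof -
  interpret B: cstar_algebra B by (rule B)
  define f where "f g = (case g of Gen_a \<Rightarrow> a | Gen_b \<Rightarrow> b | Gen_D \<Rightarrow> D)" for g
  have [simp]: "a \<in> carrier B" "b \<in> carrier B" "D \<in> carrier B" using s by (auto simp: satisfies_Uq2_def)
  have f: "f g \<in> carrier B" for g by (cases g) (auto simp: f_def)
  have fs: "f Gen_a = a" "f Gen_b = b" "f Gen_D = D" by (simp_all add: f_def)
  note ev = B.eval_diff[OF f] B.eval_add[OF f] B.eval_mult[OF f] B.eval_const_mult[OF f]
    B.eval_adj[OF f] B.eval_gen[OF f] B.eval_one[OF f]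
  have "B.eval f r = \<zero>\<^bsub>B\<^esub>" if "r \<in> Uq2_relations q" for r
    using that s unfolding Uq2_relations_def Let_def satisfies_Uq2_def
    by (auto simp: ev fs B.minus_eq_zero_iff B.eval_const[OF f] B.smult_mult_left)
  then obtain \<phi> where "\<phi> \<in> star_hom (C_Uq2 q) B"
    "\<forall>X\<in>carrier (C_Uq2 q). nrm\<^bsub>B\<^esub> (\<phi> X) \<le> nrm\<^bsub>C_Uq2 q\<^esub> X"
    "\<forall>g. \<phi> (Uq2_elem q g) = f g"
    using universal_property[OF Uq2_admissible[OF assms(1)] B, of f] f unfolding C_Uq2_def Uq2_elem_def by blast
  then show ?thesis by (auto simp: f_def)
qed

theorem C_Uq2_dense:
  assumes "cmod q \<noteq> 1" "X \<in> carrier (C_Uq2 q)" "e > 0"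
  shows "\<exists>x. nrm\<^bsub>C_Uq2 q\<^esub> (X \<ominus>\<^bsub>C_Uq2 q\<^esub> universal_elem (Uq2_relations q) x) < e"
  using universal_dense[OF Uq2_admissible] assms unfolding C_Uq2_def by blast

end

theory Submission
  imports Defs
begin

text \<open>
  All computations take place in the free *-algebra modulo the universal seminorm. For
  \<open>cmod q < 1\<close> the element \<open>h = b b\<^sup>*\<close> is a contraction, \<open>b\<close>
  commutes with \<open>a\<close> up to the factor \<open>q\<close>, and the powers \<open>a\<^sup>n\<close> are bounded
  and uniformly bounded below. Hence \<open>x a\<^sup>n\<close> is asymptotically unchanged if \<open>b\<close>
  is set to \<open>0\<close> in \<open>x\<close>, and comparing \<open>x a\<^sup>n\<close> with \<open>a\<^sup>n x\<close> shows that a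
  central element of degree \<open>0\<close> in \<open>a\<close> lies in the closed algebra generated by the unitary
  \<open>D\<close>. A central element \<open>x\<close> of degree \<open>i\<close> in \<open>a\<close> and \<open>l\<close> in \<open>D\<close> satisfies
  \<open>b x = q\<^sup>i w\<^sup>l x b\<close> with \<open>w = q\<^sup>2 / (cmod q)\<^sup>2\<close>; if \<open>q\<^sup>i w\<^sup>l \<noteq> 1\<close>, then
  \<open>x b = 0\<close>, so the scalar \<open>x\<^sup>* x\<close> annihilates \<open>b \<noteq> 0\<close> and \<open>x = 0\<close>. A general central
  element is recovered from its homogeneous components by Fejer summation. If \<open>w\<close> is not a
  root of unity, only the component of degree \<open>(0, 0)\<close> survives; if \<open>q\<close> is real, then
  \<open>w = 1\<close> and the center is the closed algebra generated by \<open>D\<close>, whose spectrum is the circle.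
\<close>

section \<open>Graded *-polynomials\<close>

text \<open>The universal seminorm is a supremum over all C*-seminorms that kill the relations;
  neither a faithful representation nor a functional calculus is at hand. Upper estimates therefore
  come from the relations and the C*-identity alone: exact norms of self-adjoint powers with
  exponents \<open>2 ^ k\<close> take the place of the spectral radius, both in the proof of
  \<open>p h \<le> 1\<close> and in the norm bound for polynomials in \<open>D\<close>. Integrals
  over the circle become finite averages over roots of unity, which are exact on a polynomial once
  their order exceeds the degrees involved. Lower estimates need seminorms from outside: the
  characters \<open>a \<mapsto> 1\<close>, \<open>b \<mapsto> 0\<close>,
  \<open>D \<mapsto> t\<close>, and one representation by weighted shifts, used only to see that
  \<open>b\<close> has nonzero norm. The uniform lower bound for \<open>a ^ n\<close> comes from the
  factorization of \<open>adj (a ^ n) * a ^ n\<close> into the factors \<open>1 - s ^ k * h\<close>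
  for \<open>k\<close> from 1 to \<open>n\<close>, together with the positivity of the infinite
  product of the numbers \<open>1 - s ^ k\<close>.\<close>

abbreviation mon :: "'g word \<Rightarrow> 'g star_poly" where "mon w \<equiv> Poly_Mapping.single w 1"

lemma single_eq_const_mon: "Poly_Mapping.single w c = const c * mon w"
  by (simp add: const_def mult_single)

lemma lookup_const_mult [simp]: "Poly_Mapping.lookup (const c * x) w = c * Poly_Mapping.lookup x w"
  by (induction x rule: star_poly_induct)
    (simp_all add: const_def distrib_left mult_single lookup_add lookup_single when_def)

lemma star_poly_mon_induct [case_names zero mon add scale]:
  assumes "P 0" "\<And>w. P (mon w)" "\<And>x y. P x \<Longrightarrow> P y \<Longrightarrow> P (x + y)" "\<And>c x. P x \<Longrightarrow> P (const c * x)"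
  shows "P x"
proof (induction x rule: star_poly_induct)
  case (add w c x)
  have "P (const c * mon w)" using assms(2,4) by blast
  then show ?case using add assms(3) single_eq_const_mon by metis
qed (rule assms)

text \<open>A diagonal operator in the basis of words. Gauge automorphisms, projections to
  homogeneous components and Fejer means all have this form, so identities between them reduce to
  identities between scalar multipliers.\<close>

definition weight :: "('g word \<Rightarrow> complex) \<Rightarrow> 'g star_poly \<Rightarrow> 'g star_poly" where
  "weight f x = Poly_Mapping.mapp (\<lambda>w c. f w * c) x"

lemma lookup_weight [simp]: "Poly_Mapping.lookup (weight f x) w = f w * Poly_Mapping.lookup x w"
  by (auto simp: weight_def lookup_mapp when_def in_keys_iff)

lemma weight_zero [simp]: "weight f 0 = 0"
  by (rule poly_mapping_eqI) simp

lemma weight_add: "weight f (x + y) = weight f x + weight f y"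
  by (rule poly_mapping_eqI) (simp add: lookup_add algebra_simps)

lemma weight_diff: "weight f (x - y) = weight f x - weight f y"
  by (rule poly_mapping_eqI) (simp add: lookup_minus algebra_simps)

lemma weight_single: "weight f (Poly_Mapping.single w c) = Poly_Mapping.single w (f w * c)"
  by (rule poly_mapping_eqI) (simp add: lookup_single when_def)

lemma weight_const_mult: "weight f (const c * x) = const c * weight f x"
  by (rule poly_mapping_eqI) simp

lemma weight_mult:
  assumes "\<And>u v. f (u + v) = f u * f v"
  shows "weight f (x * y) = weight f x * weight f y"
proof (induction x rule: star_poly_induct)
  case (add v c x)
  have "weight f (Poly_Mapping.single v c * y) = weight f (Poly_Mapping.single v c) * weight f y"
    by (induction y rule: star_poly_induct)
      (simp_all add: distrib_left mult_single weight_add weight_single assms mult_ac)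
  with add show ?case by (simp add: distrib_right weight_add)
qed simp

lemma weight_adj:
  assumes "\<And>w. cnj (f (adj_word w)) = f w"
  shows "weight f (adj x) = adj (weight f x)"
  by (rule poly_mapping_eqI) (simp add: lookup_adj assms)

section \<open>Linear functionals given by their values on words\<close>

definition linear_ext :: "('g word \<Rightarrow> complex) \<Rightarrow> 'g star_poly \<Rightarrow> complex" where
  "linear_ext f x = (\<Sum>w\<in>Poly_Mapping.keys x. Poly_Mapping.lookup x w * f w)"

lemma linear_ext_superset:
  "finite S \<Longrightarrow> Poly_Mapping.keys x \<subseteq> S \<Longrightarrow> linear_ext f x = (\<Sum>w\<in>S. Poly_Mapping.lookup x w * f w)"
  unfolding linear_ext_def by (rule sum.mono_neutral_left) (auto simp: in_keys_iff)

lemma linear_ext_zero [simp]: "linear_ext f 0 = 0"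
  by (simp add: linear_ext_def)

lemma linear_ext_add: "linear_ext f (x + y) = linear_ext f x + linear_ext f y"
proof -
  let ?S = "Poly_Mapping.keys x \<union> Poly_Mapping.keys y"
  have "linear_ext f z = (\<Sum>w\<in>?S. Poly_Mapping.lookup z w * f w)" if "z \<in> {x, y, x + y}" for z
    using that Poly_Mapping.keys_add[of x y] by (intro linear_ext_superset) auto
  then show ?thesis by (simp add: lookup_add distrib_right sum.distrib)
qed

lemma linear_ext_single: "linear_ext f (Poly_Mapping.single w c) = c * f w"
  by (subst linear_ext_superset[of "{w}"]) auto

lemma linear_ext_const_mult: "linear_ext f (const c * x) = c * linear_ext f x"
  by (induction x rule: star_poly_induct)
    (simp_all add: const_def distrib_left linear_ext_add mult_single linear_ext_single mult_ac)

lemma linear_ext_diff: "linear_ext f (x - y) = linear_ext f x - linear_ext f y"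
  using linear_ext_add[of f "x - y" y] by simp

lemma linear_ext_const: "f 0 = 1 \<Longrightarrow> linear_ext f (const c) = c"
  by (simp add: const_def linear_ext_single)

lemma linear_ext_mult:
  assumes "\<And>u v. f (u + v) = f u * f v"
  shows "linear_ext f (x * y) = linear_ext f x * linear_ext f y"
proof (induction x rule: star_poly_induct)
  case (add v c x)
  have "linear_ext f (Poly_Mapping.single v c * y) = linear_ext f (Poly_Mapping.single v c) * linear_ext f y"
    by (induction y rule: star_poly_induct)
      (simp_all add: distrib_left mult_single linear_ext_add linear_ext_single assms mult_ac)
  with add show ?case by (simp add: distrib_right linear_ext_add)
qed simp

lemma linear_ext_adj:
  assumes "\<And>w. f (adj_word w) = cnj (f w)"
  shows "linear_ext f (adj x) = cnj (linear_ext f x)"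
  by (induction x rule: star_poly_induct)
    (simp_all add: adj_add adj_single linear_ext_add linear_ext_single assms)

lemma linear_ext_weight: "linear_ext f (weight g x) = linear_ext (\<lambda>w. f w * g w) x"
  by (induction x rule: star_poly_induct)
    (simp_all add: weight_add weight_single linear_ext_add linear_ext_single mult_ac)

section \<open>Gradings, the gauge action and homogeneous components\<close>

fun letter_degree :: "('g \<Rightarrow> int) \<Rightarrow> 'g letter \<Rightarrow> int" where
  "letter_degree e (Gen g) = e g"
| "letter_degree e (Adj g) = - e g"

fun degree :: "('g \<Rightarrow> int) \<Rightarrow> 'g word \<Rightarrow> int" where
  "degree e (Word u) = sum_list (map (letter_degree e) u)"

lemma degree_zero [simp]: "degree e 0 = 0"
  by (simp add: zero_word_def)

lemma degree_add [simp]: "degree e (v + w) = degree e v + degree e w"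
  by (cases v; cases w) simp

lemma degree_adj [simp]: "degree e (adj_word w) = - degree e w"
proof -
  have "letter_degree e (adj_letter l) = - letter_degree e l" for l by (cases l) auto
  then have "sum_list (map (letter_degree e) (rev (map adj_letter u))) = - sum_list (map (letter_degree e) u)" for u
    by (induction u) auto
  then show ?thesis by (cases w) simp
qed

text \<open>The map that multiplies each generator \<open>g\<close> by \<open>z powi e g\<close>.
  For \<open>z\<close> on the unit circle it is compatible with \<open>adj\<close>, because there
  \<open>cnj z = inverse z\<close>.\<close>

definition gauge :: "('g \<Rightarrow> int) \<Rightarrow> complex \<Rightarrow> 'g star_poly \<Rightarrow> 'g star_poly" where
  "gauge e z = weight (\<lambda>w. z powi degree e w)"

definition component :: "('g \<Rightarrow> int) \<Rightarrow> int \<Rightarrow> 'g star_poly \<Rightarrow> 'g star_poly" where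
  "component e i = weight (\<lambda>w. if degree e w = i then 1 else 0)"

definition homogeneous :: "('g \<Rightarrow> int) \<Rightarrow> int \<Rightarrow> 'g star_poly \<Rightarrow> bool" where
  "homogeneous e i x \<longleftrightarrow> (\<forall>w\<in>Poly_Mapping.keys x. degree e w = i)"

lemma gauge_simps:
  assumes "cmod z = 1"
  shows "gauge e z (x + y) = gauge e z x + gauge e z y"
    "gauge e z (x - y) = gauge e z x - gauge e z y"
    "gauge e z (x * y) = gauge e z x * gauge e z y"
    "gauge e z (const c) = const c"
    "gauge e z 1 = 1"
    "gauge e z (gen g) = const (z powi e g) * gen g"
    "gauge e z (adj x) = adj (gauge e z x)"
proof -
  have z: "z \<noteq> 0" using assms by auto
  have "cnj z = inverse z" using assms by (simp add: divide_conv_cnj inverse_eq_divide)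
  then show "gauge e z (adj x) = adj (gauge e z x)"
    unfolding gauge_def using z by (intro weight_adj) (simp add: power_int_minus power_int_inverse)
  show "gauge e z (x * y) = gauge e z x * gauge e z y"
    unfolding gauge_def using z by (intro weight_mult) (simp add: power_int_add)
  show "gauge e z 1 = 1" 
    using weight_single[of "\<lambda>w. z powi degree e w" 0 1] by (simp add: gauge_def)
qed (simp_all add: gauge_def weight_add weight_diff weight_single const_def gen_def mult_single)

lemma component_add: "component e i (x + y) = component e i x + component e i y"
  and component_diff: "component e i (x - y) = component e i x - component e i y"
  by (simp_all add: component_def weight_add weight_diff)

lemma keys_component: "Poly_Mapping.keys (component e i x) = {w \<in> Poly_Mapping.keys x. degree e w = i}"
  by (auto simp: component_def in_keys_iff split: if_splits)

lemma homogeneous_component [simp]: "homogeneous e i (component e i x)"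
  by (simp add: homogeneous_def keys_component)

lemma homogeneous_component_other [simp]:
  "homogeneous e i x \<Longrightarrow> homogeneous e i (component e' j x)"
  by (simp add: homogeneous_def keys_component)

text \<open>Multiplication by a word only shifts the grading. Thus the commutator of a component
  with a word can be read off as a component of the whole commutator.\<close>

lemma component_mon_left: "component e (i + degree e w) (mon w * x) = mon w * component e i x"
proof (induction x rule: star_poly_induct)
  case (add v c x)
  then show ?case by (simp add: distrib_left component_add mult_single) (simp add: component_def weight_single mult_single)
qed (simp add: component_def)

lemma component_mon_right: "component e (i + degree e w) (x * mon w) = component e i x * mon w"
proof (induction x rule: star_poly_induct)
  case (add v c x)
  then show ?case by (simp add: distrib_right component_add mult_single) (simp add: component_def weight_single mult_single)
qed (simp add: component_def)

lemma homogeneous_adj: "homogeneous e i x \<Longrightarrow> homogeneous e (- i) (adj x)"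
  unfolding homogeneous_def
proof
  fix w assume x: "\<forall>w\<in>Poly_Mapping.keys x. degree e w = i" and "w \<in> Poly_Mapping.keys (adj x)"
  then have "adj_word w \<in> Poly_Mapping.keys x" by (simp add: in_keys_iff lookup_adj)
  then show "degree e w = - i" using x by fastforce
qed

lemma homogeneous_mult: "homogeneous e i x \<Longrightarrow> homogeneous e j y \<Longrightarrow> homogeneous e (i + j) (x * y)"
  unfolding homogeneous_def using keys_mult[of x y] by fastforce

text \<open>A plain induction on \<open>x\<close> could leave the words satisfying \<open>Q\<close>.
  Instead \<open>P (f x)\<close> is proved for every \<open>x\<close>, where \<open>f\<close> drops
  all words outside \<open>Q\<close>; the hypothesis says that \<open>f\<close> fixes the given
  \<open>x\<close>.\<close>

lemma star_poly_keys_induct [consumes 1, case_names zero mon add scale]: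
  assumes "\<forall>w\<in>Poly_Mapping.keys x. Q w"
    "P 0" "\<And>w. Q w \<Longrightarrow> P (mon w)"
    "\<And>x y. P x \<Longrightarrow> P y \<Longrightarrow> P (x + y)" "\<And>c x. P x \<Longrightarrow> P (const c * x)"
  shows "P x"
proof -
  define f where "f = weight (\<lambda>w. if Q w then 1 else 0)"
  have "P (f x)" for x
  proof (induction x rule: star_poly_induct)
    case zero
    then show ?case using assms(2) by (simp add: f_def)
  next
    case (add w c x)
    have "f (Poly_Mapping.single w c) = (if Q w then const c * mon w else 0)"
      by (simp add: f_def weight_single const_def mult_single)
    then have "P (f (Poly_Mapping.single w c))" using assms(2,3,5) by auto
    then show ?case using add assms(4) by (simp add: f_def weight_add)
  qed
  moreover have "f x = x"
    using assms(1) by (intro poly_mapping_eqI) (auto simp: f_def in_keys_iff)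
  ultimately show ?thesis by metis
qed

lemma homogeneous_induct [consumes 2, case_names zero mon add scale]:
  assumes "homogeneous e i x" "homogeneous e' j x"
    "P 0" "\<And>w. degree e w = i \<Longrightarrow> degree e' w = j \<Longrightarrow> P (mon w)"
    "\<And>x y. P x \<Longrightarrow> P y \<Longrightarrow> P (x + y)" "\<And>c x. P x \<Longrightarrow> P (const c * x)"
  shows "P x"
  by (rule star_poly_keys_induct[of x "\<lambda>w. degree e w = i \<and> degree e' w = j" P])
    (use assms in \<open>auto simp: homogeneous_def\<close>)

section \<open>Averaging over the gauge action\<close>

text \<open>Orthogonality of the characters of the cyclic group of order \<open>M\<close>. The bound
  on \<open>d\<close> excludes the nonzero multiples of \<open>M\<close>, for which the sum would be
  \<open>M\<close> as well.\<close>

lemma sum_root_of_unity_powers: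
  fixes d :: int
  assumes "0 < M" "\<bar>d\<bar> < int M"
  shows "(\<Sum>j<M. cis (2 * pi * real j / real M) powi d) = (if d = 0 then of_nat M else 0)"
proof (cases "d = 0")
  case False
  define z where "z = cis (2 * pi * real_of_int d / real M)"
  have pw: "cis (2 * pi * real j / real M) powi d = z ^ j" for j
    by (simp add: z_def cis_power_int Complex.DeMoivre mult_ac)
  have "z ^ M = 1" using assms(1) by (simp add: z_def Complex.DeMoivre cis_multiple_2pi)
  moreover have "z \<noteq> 1"
  proof
    assume "z = 1"
    then have "cos (2 * pi * real_of_int d / real M) = 1" by (simp add: z_def complex_eq_iff)
    then obtain k :: int where "2 * pi * real_of_int d / real M = real_of_int k * 2 * pi"
      by (auto simp: cos_one_2pi_int)
    then have "real_of_int d = real_of_int (k * int M)" using assms(1) by (simp add: field_simps)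
    then have "d = k * int M" by linarith
    then show False using False assms(2) dvd_imp_le_int[of d "int M"] by simp
  qed
  ultimately show ?thesis using False geometric_sum[of z M] by (simp add: pw)
qed simp

lemma finite_degree_bound: "\<exists>L. \<forall>w\<in>Poly_Mapping.keys x. \<bar>degree e w\<bar> \<le> int L"
proof -
  define L where "L = nat (Max (insert 0 ((\<lambda>w. \<bar>degree e w\<bar>) ` Poly_Mapping.keys x)))"
  have "\<bar>degree e w\<bar> \<le> int L" if "w \<in> Poly_Mapping.keys x" for w
  proof -
    have "\<bar>degree e w\<bar> \<le> Max (insert 0 ((\<lambda>w. \<bar>degree e w\<bar>) ` Poly_Mapping.keys x))"
      using that by (intro Max_ge) auto
    then show ?thesis by (simp add: L_def)
  qed
  then show ?thesis by blast
qed

text \<open>Only the gauge orbit of a single \<open>x\<close> has to be bounded, and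
  \<open>N\<close> is merely a seminorm of the vector space. This covers an invariant C*-seminorm as
  well as the modulus of a character, whose values along the orbit are those of the other
  characters.\<close>

locale gauge_bounded =
  fixes N :: "'g star_poly \<Rightarrow> real" and e :: "'g \<Rightarrow> int" and x :: "'g star_poly" and K :: real
  assumes N_triangle: "N (y + z) \<le> N y + N z"
    and N_scale: "N (const c * y) = cmod c * N y"
    and N_gauge: "cmod t = 1 \<Longrightarrow> N (gauge e t x) \<le> K"
begin

lemma N_sum: "finite S \<Longrightarrow> N (\<Sum>j\<in>S. f j) \<le> (\<Sum>j\<in>S. N (f j))"
proof (induction S rule: finite_induct)
  case empty
  then show ?case using N_scale[of 0 0] by simp
next
  case (insert a S)
  then show ?case using N_triangle[of "f a" "sum f S"] by simp
qed

text \<open>A finite substitute for integrating the gauge action against a kernel on the circle. The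
  multiplier has to agree with the exponential sum only at the degrees that occur in
  \<open>x\<close>.\<close>

lemma average:
  fixes M :: nat
  assumes "\<And>j. j < M \<Longrightarrow> cmod (t j) = 1"
    "\<And>w. w \<in> Poly_Mapping.keys x \<Longrightarrow> f w = (\<Sum>j<M. k j * t j powi degree e w)"
  shows "N (weight f x) \<le> (\<Sum>j<M. cmod (k j)) * K"
proof -
  have "weight f x = (\<Sum>j<M. const (k j) * gauge e (t j) x)"
  proof (rule poly_mapping_eqI)
    fix w
    show "Poly_Mapping.lookup (weight f x) w = Poly_Mapping.lookup (\<Sum>j<M. const (k j) * gauge e (t j) x) w"
      using assms(2)[of w]
      by (cases "w \<in> Poly_Mapping.keys x")
        (simp_all add: gauge_def lookup_sum sum_distrib_right mult.assoc in_keys_iff)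
  qed
  then have "N (weight f x) \<le> (\<Sum>j<M. N (const (k j) * gauge e (t j) x))" by (simp add: N_sum)
  also have "\<dots> \<le> (\<Sum>j<M. cmod (k j) * K)"
    using assms(1) N_gauge by (intro sum_mono) (auto simp: N_scale intro!: mult_left_mono)
  finally show ?thesis by (simp add: sum_distrib_right)
qed

lemma component_bound: "N (component e i x) \<le> K"
proof -
  obtain L where L: "\<forall>w\<in>Poly_Mapping.keys x. \<bar>degree e w\<bar> \<le> int L" using finite_degree_bound by blast
  \<comment> \<open>With this many roots of unity, every difference \<open>degree e w - i\<close>
    stays below \<open>M\<close> in absolute value, so the discrete average isolates degree
    \<open>i\<close> exactly.\<close>
  obtain M where M: "M > 0" "int M > int L + \<bar>i\<bar>"
    using that[of "L + nat \<bar>i\<bar> + 1"] by simp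
  let ?t = "\<lambda>j. cis (2 * pi * real j / real M)"
  have "(\<Sum>j<M. ?t j powi (- i) / of_nat M * ?t j powi degree e w) = (if degree e w = i then 1 else 0)"
    if "w \<in> Poly_Mapping.keys x" for w
  proof -
    have "\<bar>degree e w - i\<bar> < int M" using L M that by fastforce
    moreover have "?t j powi (- i) / of_nat M * ?t j powi degree e w = ?t j powi (degree e w - i) / of_nat M" for j
      by (simp add: power_int_diff power_int_minus field_simps)
    ultimately show ?thesis
      using sum_root_of_unity_powers[of M "degree e w - i"] M
      by (simp flip: sum_divide_distrib)
  qed
  then have "N (component e i x) \<le> (\<Sum>j<M. cmod (?t j powi (- i) / of_nat M)) * K"
    unfolding component_def by (intro average[where t = ?t]) auto
  also have "\<dots> = K" using M by (simp add: norm_divide norm_power_int)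
  finally show ?thesis .
qed

end

section \<open>Fejer means\<close>

lemma fejer_sum:
  fixes d :: int
  shows "(\<Sum>m<n. \<Sum>m'<n. if int m - int m' + d = 0 then 1 else 0 :: complex)
    = of_int (max 0 (int n - \<bar>d\<bar>))"
proof -
  have "(\<Sum>m'<n. if int m - int m' + d = 0 then 1 else 0 :: complex)
      = (if 0 \<le> int m + d \<and> int m + d < int n then 1 else 0)" for m
  proof -
    have "(\<Sum>m'<n. if int m - int m' + d = 0 then 1 else 0 :: complex)
        = (\<Sum>m'<n. if m' = nat (int m + d) then (if 0 \<le> int m + d then 1 else 0) else 0)"
      by (intro sum.cong) auto
    then show ?thesis by (auto simp: sum.delta)
  qed
  then have "(\<Sum>m<n. \<Sum>m'<n. if int m - int m' + d = 0 then 1 else 0 :: complex)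
      = of_nat (card {m \<in> {..<n}. 0 \<le> int m + d \<and> int m + d < int n})"
    by (simp add: sum.If_cases Int_def)
  \<comment> \<open>Each \<open>m\<close> admits at most one partner \<open>m' = m + d\<close>, so
    the double sum counts the \<open>m\<close> for which both \<open>m\<close> and
    \<open>m + d\<close> lie in the range.\<close>
  also have "{m \<in> {..<n}. 0 \<le> int m + d \<and> int m + d < int n} = {nat (max 0 (- d)) ..< nat (min (int n) (int n - d))}"
    by auto
  also have "of_nat (card \<dots>) = (of_int (max 0 (int n - \<bar>d\<bar>)) :: complex)"
    by (simp add: max_def min_def abs_if) arith
  finally show ?thesis .
qed

text \<open>The Cesaro weight \<open>1 - \<bar>d\<bar> / n\<close>, cut off at 0. At
  \<open>n = 0\<close> division by zero gives the value 0.\<close>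

definition fejer_coeff :: "nat \<Rightarrow> int \<Rightarrow> complex" where
  "fejer_coeff n d = of_int (max 0 (int n - \<bar>d\<bar>)) / of_nat n"

definition fejer :: "('g \<Rightarrow> int) \<Rightarrow> nat \<Rightarrow> 'g star_poly \<Rightarrow> 'g star_poly" where
  "fejer e n = weight (\<lambda>w. fejer_coeff n (degree e w))"

lemma fejer_diff: "fejer e n (x - y) = fejer e n x - fejer e n y"
  by (simp add: fejer_def weight_diff)

lemma fejer_coeff_tendsto: "(\<lambda>n. fejer_coeff n d) \<longlonglongrightarrow> 1"
proof -
  have "(\<lambda>n. 1 - complex_of_int \<bar>d\<bar> / of_nat n) \<longlonglongrightarrow> 1 - 0"
    by (intro tendsto_intros lim_const_over_n)
  moreover have "\<forall>\<^sub>F n in sequentially. 1 - complex_of_int \<bar>d\<bar> / of_nat n = fejer_coeff n d"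
    using eventually_gt_at_top[of "nat \<bar>d\<bar>"]
    by eventually_elim (auto simp: fejer_coeff_def field_simps max_def)
  ultimately show ?thesis by (simp add: tendsto_cong)
qed

lemma fejer_eq_sum: "fejer e n x = (\<Sum>i\<in>{- int n<..<int n}. const (fejer_coeff n i) * component e i x)"
proof (rule poly_mapping_eqI)
  fix w
  let ?c = "Poly_Mapping.lookup x w"
  have "Poly_Mapping.lookup (\<Sum>i\<in>{- int n<..<int n}. const (fejer_coeff n i) * component e i x) w
      = (\<Sum>i\<in>{- int n<..<int n}. if i = degree e w then fejer_coeff n i * ?c else 0)"
    unfolding lookup_sum by (rule sum.cong) (auto simp: component_def)
  also have "\<dots> = fejer_coeff n (degree e w) * ?c" by (auto simp: sum.delta fejer_coeff_def)
  finally show "Poly_Mapping.lookup (fejer e n x) w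
      = Poly_Mapping.lookup (\<Sum>i\<in>{- int n<..<int n}. const (fejer_coeff n i) * component e i x) w"
    by (simp add: fejer_def)
qed

context gauge_bounded begin

text \<open>The Fejer means are averages against a nonnegative kernel of total mass 1, so they do
  not increase the bound \<open>K\<close>. Plain partial sums of components would only give a bound
  growing with their number.\<close>

lemma fejer_bound:
  assumes n: "n > 0"
  shows "N (fejer e n x) \<le> K"
proof -
  obtain L where L: "\<forall>w\<in>Poly_Mapping.keys x. \<bar>degree e w\<bar> \<le> int L" using finite_degree_bound by blast
  \<comment> \<open>Large enough for \<open>m - m' + d\<close> to stay below \<open>M\<close> in
    absolute value when \<open>m\<close> and \<open>m'\<close> are less than \<open>n\<close> and
    \<open>d\<close> is bounded by \<open>L\<close>.\<close>
  define M where "M = L + n"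
  let ?t = "\<lambda>j. cis (2 * pi * real j / real M)"
  \<comment> \<open>The Fejer kernel sampled at the roots of unity. Written as a squared modulus it
    is visibly nonnegative, so its absolute values sum to its multiplier at degree 0, which is
    1.\<close>
  define k where "k j = complex_of_real ((cmod (\<Sum>m<n. ?t j ^ m))\<^sup>2 / (real M * real n))" for j
  have M: "M > 0" using n by (simp add: M_def)
  have kj: "k j = (\<Sum>m<n. \<Sum>m'<n. ?t j powi (int m - int m')) / (of_nat M * of_nat n)" for j
  proof -
    have "?t j ^ m * cnj (?t j ^ m') = ?t j powi (int m - int m')" for m m'
    proof -
      have "cnj (?t j) = inverse (?t j)" by (simp add: cis_cnj)
      then show ?thesis by (simp add: power_int_diff power_inverse divide_inverse del: cis_inverse cis_cnj)
    qed
    then have "(\<Sum>m<n. ?t j ^ m) * cnj (\<Sum>m<n. ?t j ^ m) = (\<Sum>m<n. \<Sum>m'<n. ?t j powi (int m - int m'))"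
      unfolding cnj_sum sum_product by simp
    moreover have "k j = (\<Sum>m<n. ?t j ^ m) * cnj (\<Sum>m<n. ?t j ^ m) / (of_nat M * of_nat n)"
      unfolding k_def of_real_divide complex_norm_square by simp
    ultimately show ?thesis by simp
  qed
  have sum: "(\<Sum>j<M. k j * ?t j powi d) = fejer_coeff n d" if d: "\<bar>d\<bar> \<le> int L" for d
  proof -
    have "(\<Sum>j<M. k j * ?t j powi d)
        = (\<Sum>j<M. \<Sum>m<n. \<Sum>m'<n. ?t j powi (int m - int m' + d)) / (of_nat M * of_nat n)"
      unfolding kj sum_divide_distrib[symmetric] times_divide_eq_left
      by (simp only: sum_distrib_right power_int_add[OF disjI1[OF cis_neq_zero]])
    also have "(\<Sum>j<M. \<Sum>m<n. \<Sum>m'<n. ?t j powi (int m - int m' + d))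
        = (\<Sum>m<n. \<Sum>m'<n. \<Sum>j<M. ?t j powi (int m - int m' + d))"
      by (subst sum.swap, rule sum.cong[OF refl], subst sum.swap, rule refl)
    also have "\<dots> = (\<Sum>m<n. \<Sum>m'<n. of_nat M * (if int m - int m' + d = 0 then 1 else 0))"
    proof (intro sum.cong refl)
      fix m m' assume "m \<in> {..<n}" "m' \<in> {..<n}"
      then have "\<bar>int m - int m' + d\<bar> < int M" using d by (auto simp: M_def)
      then show "(\<Sum>j<M. ?t j powi (int m - int m' + d)) = of_nat M * (if int m - int m' + d = 0 then 1 else 0)"
        using sum_root_of_unity_powers[OF M] by simp
    qed
    also have "\<dots> = of_nat M * of_int (max 0 (int n - \<bar>d\<bar>))"
      by (simp only: sum_distrib_left[symmetric] fejer_sum)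
    finally show ?thesis using M by (simp add: fejer_coeff_def)
  qed
  have "N (fejer e n x) \<le> (\<Sum>j<M. cmod (k j)) * K"
    unfolding fejer_def using L sum by (intro average[where t = ?t]) auto
  also have "(\<Sum>j<M. cmod (k j)) = 1"
  proof -
    have "cmod (k j) = Re (k j)" for j by (simp add: k_def norm_divide norm_mult norm_power)
    then have 1: "(\<Sum>j<M. cmod (k j)) = Re (\<Sum>j<M. k j)" by simp
    have 2: "(\<Sum>j<M. k j) = 1" using sum[of 0] n by (simp add: fejer_coeff_def)
    show ?thesis unfolding 1 2 by simp
  qed
  finally show ?thesis by simp
qed

end

context cstar_seminorm begin

lemma p_sum: "p (\<Sum>j\<in>S. f j) \<le> (\<Sum>j\<in>S. p (f j))"
proof (induction S rule: infinite_finite_induct)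
  case (insert a S)
  then show ?case using p_triangle[of "f a" "sum f S"] by simp
qed simp_all

lemma tendsto_zero_dominated:
  assumes "f \<longlonglongrightarrow> 0" "\<And>n. p (x n) \<le> f n"
  shows "(\<lambda>n. p (x n)) \<longlonglongrightarrow> 0"
  by (rule tendsto_sandwich[OF _ _ tendsto_const assms(1)]) (simp_all add: p_nonneg assms(2))

lemma fejer_tendsto: "(\<lambda>n. p (fejer e n x - x)) \<longlonglongrightarrow> 0"
proof (induction x rule: star_poly_mon_induct)
  case (mon w)
  have "fejer e n (mon w) - mon w = const (fejer_coeff n (degree e w) - 1) * mon w" for n
    by (rule poly_mapping_eqI) (simp add: fejer_def lookup_minus lookup_single when_def algebra_simps)
  moreover have "(\<lambda>n. cmod (fejer_coeff n (degree e w) - 1) * p (mon w)) \<longlonglongrightarrow> cmod (1 - 1) * p (mon w)"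
    by (intro tendsto_intros fejer_coeff_tendsto)
  ultimately show ?case by (simp add: p_scale)
next
  case (add x y)
  have "p (fejer e n (x + y) - (x + y)) \<le> p (fejer e n x - x) + p (fejer e n y - y)" for n
    using p_triangle[of "fejer e n x - x" "fejer e n y - y"] by (simp add: fejer_def weight_add add_diff_add)
  with tendsto_add_zero[OF add] show ?case by (rule tendsto_zero_dominated)
next
  case (scale c x)
  have "fejer e n (const c * x) - const c * x = const c * (fejer e n x - x)" for n
    by (simp add: fejer_def weight_const_mult right_diff_distrib)
  then show ?case using tendsto_mult_right_zero[OF scale, of "cmod c"] by (simp add: p_scale)
qed (simp add: fejer_def)

end

locale gauge_invariant_seminorm = cstar_seminorm p for p :: "'g star_poly \<Rightarrow> real" +
  assumes p_gauge: "cmod z = 1 \<Longrightarrow> p (gauge e z x) \<le> p x"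
begin

lemma gauge_bounded: "gauge_bounded p e x (p x)"
  by unfold_locales (auto simp: p_triangle p_scale p_gauge)

lemma p_component: "p (component e i x) \<le> p x"
  by (rule gauge_bounded.component_bound[OF gauge_bounded])

lemma cauchy_component: "cauchy x \<Longrightarrow> cauchy (\<lambda>n. component e i (x n))"
proof (erule cauchy_dominated)
  show "p (component e i (x m) - component e i (x n)) \<le> 1 * p (x m - x n)" for m n
    using p_component[of e i "x m - x n"] by (simp only: component_diff mult_1)
qed

text \<open>The Fejer means approximate each polynomial in norm, are contractions and are finite
  combinations of homogeneous components.\<close>

lemma null_if_components_null:
  assumes x: "cauchy x" and comp: "\<And>i. (\<lambda>n. p (component e i (x n))) \<longlonglongrightarrow> 0"
  shows "(\<lambda>n. p (x n)) \<longlonglongrightarrow> 0"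
proof (rule LIMSEQ_I)
  fix \<epsilon> :: real assume "\<epsilon> > 0"
  then have e: "\<epsilon> / 4 > 0" by simp
  obtain k where k: "\<And>m n. m \<ge> k \<Longrightarrow> n \<ge> k \<Longrightarrow> p (x m - x n) < \<epsilon> / 4"
    using x e unfolding cauchy_def by blast
  have "\<forall>\<^sub>F n in sequentially. p (fejer e n (x k) - x k) < \<epsilon> / 4"
    using fejer_tendsto[of e "x k"] e by (rule order_tendstoD(2))
  then have "\<forall>\<^sub>F n in sequentially. p (fejer e n (x k) - x k) < \<epsilon> / 4 \<and> n > 0"
    using eventually_gt_at_top[of 0] by (rule eventually_conj)
  then obtain n where n: "p (fejer e n (x k) - x k) < \<epsilon> / 4" "n > 0"
    using eventually_happens'[OF sequentially_bot] by blast
  have "(\<lambda>m. \<Sum>i\<in>{- int n<..<int n}. cmod (fejer_coeff n i) * p (component e i (x m))) \<longlonglongrightarrow> 0"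
    by (intro tendsto_null_sum tendsto_mult_right_zero comp)
  moreover have "p (fejer e n (x m)) \<le> (\<Sum>i\<in>{- int n<..<int n}. cmod (fejer_coeff n i) * p (component e i (x m)))" for m
    using p_sum[of "\<lambda>i. const (fejer_coeff n i) * component e i (x m)" "{- int n<..<int n}"]
    by (simp add: fejer_eq_sum p_scale)
  ultimately have "(\<lambda>m. p (fejer e n (x m))) \<longlonglongrightarrow> 0" by (rule tendsto_zero_dominated)
  then have "\<forall>\<^sub>F m in sequentially. p (fejer e n (x m)) < \<epsilon> / 4" using e by (rule order_tendstoD(2))
  then obtain M where M: "\<And>m. m \<ge> M \<Longrightarrow> p (fejer e n (x m)) < \<epsilon> / 4"
    unfolding eventually_sequentially by blast
  have "norm (p (x m) - 0) < \<epsilon>" if m: "m \<ge> max k M" for m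
  proof -
    have "p (fejer e n (x m) - fejer e n (x k)) \<le> p (x m - x k)"
      unfolding fejer_diff[symmetric] by (rule gauge_bounded.fejer_bound[OF gauge_bounded n(2)])
    moreover have "p (x m - x k) < \<epsilon> / 4" "p (fejer e n (x m)) < \<epsilon> / 4" using k M m by auto
    moreover have "p (x m) \<le> p (x m - x k) + p (x k)"
      using p_triangle[of "x m - x k" "x k"] by simp
    moreover have "p (x k) \<le> p (fejer e n (x k) - x k) + p (fejer e n (x k))"
      using p_triangle[of "x k - fejer e n (x k)" "fejer e n (x k)"] p_minus_commute by simp
    moreover have "p (fejer e n (x k)) \<le> p (fejer e n (x m) - fejer e n (x k)) + p (fejer e n (x m))"
      using p_triangle[of "fejer e n (x k) - fejer e n (x m)" "fejer e n (x m)"] p_minus_commute by simp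
    ultimately show ?thesis using n(1) p_nonneg[of "x m"] by simp
  qed
  then show "\<exists>N. \<forall>m\<ge>N. norm (p (x m) - 0) < \<epsilon>" by blast
qed

end

section \<open>Seminorms from weighted shifts\<close>

definition fin_supp :: "('i \<Rightarrow> complex) \<Rightarrow> bool" where
  "fin_supp f \<longleftrightarrow> finite {i. f i \<noteq> 0}"

text \<open>Conjugate linear in the first argument. The sum runs over the support of
  \<open>f\<close> alone, so linearity in \<open>g\<close> holds without any support
  condition.\<close>

definition inner_fs :: "('i \<Rightarrow> complex) \<Rightarrow> ('i \<Rightarrow> complex) \<Rightarrow> complex" where
  "inner_fs f g = (\<Sum>i | f i \<noteq> 0. cnj (f i) * g i)"

definition norm_fs :: "('i \<Rightarrow> complex) \<Rightarrow> real" where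
  "norm_fs f = L2_set (\<lambda>i. cmod (f i)) {i. f i \<noteq> 0}"

lemma fin_supp_add: "fin_supp f \<Longrightarrow> fin_supp g \<Longrightarrow> fin_supp (\<lambda>i. f i + g i)"
  unfolding fin_supp_def by (rule finite_subset[of _ "{i. f i \<noteq> 0} \<union> {i. g i \<noteq> 0}"]) auto

lemma fin_supp_scale: "fin_supp f \<Longrightarrow> fin_supp (\<lambda>i. c * f i)"
  unfolding fin_supp_def by (rule finite_subset[of _ "{i. f i \<noteq> 0}"]) auto

lemma inner_fs_superset:
  "finite S \<Longrightarrow> {i. f i \<noteq> 0} \<subseteq> S \<Longrightarrow> inner_fs f g = (\<Sum>i\<in>S. cnj (f i) * g i)"
  unfolding inner_fs_def by (rule sum.mono_neutral_left) auto

lemma norm_fs_superset: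
  "finite S \<Longrightarrow> {i. f i \<noteq> 0} \<subseteq> S \<Longrightarrow> norm_fs f = L2_set (\<lambda>i. cmod (f i)) S"
  unfolding norm_fs_def L2_set_def by (intro arg_cong[where f = sqrt] sum.mono_neutral_left) auto

lemma inner_fs_add_left:
  assumes "fin_supp f" "fin_supp g"
  shows "inner_fs (\<lambda>i. f i + g i) h = inner_fs f h + inner_fs g h"
proof -
  let ?S = "{i. f i \<noteq> 0} \<union> {i. g i \<noteq> 0}"
  have S: "finite ?S" using assms by (simp add: fin_supp_def)
  have "inner_fs k h = (\<Sum>i\<in>?S. cnj (k i) * h i)" if "k \<in> {f, g, \<lambda>i. f i + g i}" for k
    using that by (intro inner_fs_superset S) auto
  then show ?thesis by (simp add: algebra_simps sum.distrib)
qed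

lemma inner_fs_scale_left: "inner_fs (\<lambda>i. c * f i) h = cnj c * inner_fs f h"
  by (cases "c = 0") (simp_all add: inner_fs_def sum_distrib_left mult.assoc)

lemma inner_fs_add_right: "inner_fs f (\<lambda>i. g i + h i) = inner_fs f g + inner_fs f h"
  by (simp add: inner_fs_def algebra_simps sum.distrib)

lemma inner_fs_scale_right: "inner_fs f (\<lambda>i. c * h i) = c * inner_fs f h"
  by (simp add: inner_fs_def sum_distrib_left mult_ac)

lemma inner_fs_self: "inner_fs f f = of_real ((norm_fs f)\<^sup>2)"
proof -
  have "(norm_fs f)\<^sup>2 = (\<Sum>i | f i \<noteq> 0. (cmod (f i))\<^sup>2)"
    by (simp add: norm_fs_def L2_set_def sum_nonneg)
  then show ?thesis
    by (simp add: inner_fs_def complex_norm_square mult.commute del: of_real_power)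
qed

lemma norm_fs_nonneg: "0 \<le> norm_fs f"
  by (simp add: norm_fs_def)

lemma norm_fs_scale: "norm_fs (\<lambda>i. c * f i) = cmod c * norm_fs f"
  by (cases "c = 0") (simp_all add: norm_fs_def norm_mult L2_set_right_distrib)

lemma norm_fs_triangle:
  assumes "fin_supp f" "fin_supp g"
  shows "norm_fs (\<lambda>i. f i + g i) \<le> norm_fs f + norm_fs g"
proof -
  let ?S = "{i. f i \<noteq> 0} \<union> {i. g i \<noteq> 0}"
  have S: "finite ?S" using assms by (simp add: fin_supp_def)
  have n: "norm_fs k = L2_set (\<lambda>i. cmod (k i)) ?S" if "k \<in> {f, g, \<lambda>i. f i + g i}" for k
    using that by (intro norm_fs_superset S) auto
  have "L2_set (\<lambda>i. cmod (f i + g i)) ?S \<le> L2_set (\<lambda>i. cmod (f i) + cmod (g i)) ?S"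
    by (intro L2_set_mono norm_triangle_ineq) auto
  also have "\<dots> \<le> L2_set (\<lambda>i. cmod (f i)) ?S + L2_set (\<lambda>i. cmod (g i)) ?S" by (rule L2_set_triangle_ineq)
  finally show ?thesis by (simp add: n)
qed

lemma Cauchy_Schwarz_fs:
  assumes "fin_supp f" "fin_supp g"
  shows "cmod (inner_fs f g) \<le> norm_fs f * norm_fs g"
proof -
  let ?S = "{i. f i \<noteq> 0} \<union> {i. g i \<noteq> 0}"
  have S: "finite ?S" using assms by (simp add: fin_supp_def)
  have "cmod (inner_fs f g) \<le> (\<Sum>i\<in>?S. cmod (f i) * cmod (g i))"
    using S inner_fs_superset[OF S, of f g] by (auto simp: norm_mult intro!: order_trans[OF norm_sum])
  also have "\<dots> \<le> L2_set (\<lambda>i. cmod (f i)) ?S * L2_set (\<lambda>i. cmod (g i)) ?S"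
    using L2_set_mult_ineq[of "\<lambda>i. cmod (f i)" "\<lambda>i. cmod (g i)" ?S] by simp
  also have "\<dots> = norm_fs f * norm_fs g"
    using S by (simp add: norm_fs_superset[of ?S])
  finally show ?thesis .
qed

text \<open>The letter \<open>l\<close> sends \<open>f\<close> to
  \<open>\<lambda>i. c l i * f (\<sigma> l i)\<close>, that is, it pulls coordinates back along
  \<open>\<sigma> l\<close>. The first assumption makes the letter \<open>adj_letter l\<close> act
  as the formal adjoint. Nothing is required where the weight vanishes, so \<open>\<sigma>\<close>
  may take arbitrary values there.\<close>

locale weighted_shifts =
  fixes c :: "'g letter \<Rightarrow> 'i \<Rightarrow> complex" and \<sigma> :: "'g letter \<Rightarrow> 'i \<Rightarrow> 'i" and K :: real
  assumes adjoint: "c l i \<noteq> 0 \<Longrightarrow> \<sigma> (adj_letter l) (\<sigma> l i) = i \<and> c (adj_letter l) (\<sigma> l i) = cnj (c l i)"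
    and bounded: "cmod (c l i) \<le> K"
begin

definition shift :: "'g letter \<Rightarrow> ('i \<Rightarrow> complex) \<Rightarrow> 'i \<Rightarrow> complex" where
  "shift l f = (\<lambda>i. c l i * f (\<sigma> l i))"

fun shift_word :: "'g word \<Rightarrow> ('i \<Rightarrow> complex) \<Rightarrow> 'i \<Rightarrow> complex" where
  "shift_word (Word u) f = foldr shift u f"

definition act :: "'g star_poly \<Rightarrow> ('i \<Rightarrow> complex) \<Rightarrow> 'i \<Rightarrow> complex" where
  "act x f = (\<lambda>i. linear_ext (\<lambda>w. shift_word w f i) x)"

lemma shift_word_plus: "shift_word (v + w) f = shift_word v (shift_word w f)"
  by (cases v; cases w) simp

lemma shift_word_add: "shift_word w (\<lambda>i. f i + g i) = (\<lambda>i. shift_word w f i + shift_word w g i)"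
proof -
  have "foldr shift u (\<lambda>i. f i + g i) = (\<lambda>i. foldr shift u f i + foldr shift u g i)" for u
    by (induction u) (simp_all add: shift_def algebra_simps)
  then show ?thesis by (cases w) simp
qed

lemma shift_word_scale: "shift_word w (\<lambda>i. k * f i) = (\<lambda>i. k * shift_word w f i)"
proof -
  have "foldr shift u (\<lambda>i. k * f i) = (\<lambda>i. k * foldr shift u f i)" for u
    by (induction u) (simp_all add: shift_def algebra_simps)
  then show ?thesis by (cases w) simp
qed

lemma act_add: "act (x + y) f = (\<lambda>i. act x f i + act y f i)"
  and act_diff: "act (x - y) f = (\<lambda>i. act x f i - act y f i)"
  and act_scale: "act (const k * x) f = (\<lambda>i. k * act x f i)"
  and act_zero: "act 0 f = (\<lambda>i. 0)"
  by (simp_all add: act_def linear_ext_add linear_ext_diff linear_ext_const_mult)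

lemma act_mon: "act (mon w) f = shift_word w f"
  by (simp add: act_def linear_ext_single)

lemma act_one: "act 1 f = f"
proof -
  have "act 1 f = shift_word 0 f" by (metis act_mon single_one)
  then show ?thesis by (simp add: zero_word_def)
qed

lemma act_const: "act (const k) f = (\<lambda>i. k * f i)"
  using act_scale[of k 1 f] by (simp add: act_one)

lemma act_gen: "act (gen g) f = shift (Gen g) f" "act (adj (gen g)) f = shift (Adj g) f"
  by (simp_all add: gen_def adj_single act_mon)

lemma act_mult: "act (x * y) f = act x (act y f)"
proof (induction x rule: star_poly_mon_induct)
  case (mon v)
  show ?case
  proof (induction y rule: star_poly_mon_induct)
    case zero
    show ?case using shift_word_scale[of v 0] by (simp add: act_mon act_zero)
  qed (simp_all add: distrib_left const_mult_left mult_single act_mon shift_word_plus act_add act_scale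
      shift_word_add shift_word_scale)
qed (simp_all add: distrib_right mult.assoc act_add act_scale act_zero)

lemma inj_on_shift: "inj_on (\<sigma> l) {i. c l i \<noteq> 0}"
proof (rule inj_onI)
  fix i j assume "i \<in> {i. c l i \<noteq> 0}" "j \<in> {i. c l i \<noteq> 0}" "\<sigma> l i = \<sigma> l j"
  moreover from this have "\<sigma> (adj_letter l) (\<sigma> l i) = i" "\<sigma> (adj_letter l) (\<sigma> l j) = j"
    using adjoint by blast+
  ultimately show "i = j" by metis
qed

text \<open>Reindexing along \<open>\<sigma> l\<close> turns sums over the support of
  \<open>shift l f\<close> into sums over a part of the support of \<open>f\<close>. Finiteness of
  the support, the adjoint relation and the norm bound all follow from this.\<close>

lemma shift_bij: "bij_betw (\<sigma> l) {i. shift l f i \<noteq> 0} {j. f j \<noteq> 0 \<and> c (adj_letter l) j \<noteq> 0}"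
  unfolding bij_betw_def
proof
  show "inj_on (\<sigma> l) {i. shift l f i \<noteq> 0}"
    by (rule inj_on_subset[OF inj_on_shift]) (auto simp: shift_def)
  show "\<sigma> l ` {i. shift l f i \<noteq> 0} = {j. f j \<noteq> 0 \<and> c (adj_letter l) j \<noteq> 0}"
  proof (intro equalityI subsetI)
    fix j assume j: "j \<in> {j. f j \<noteq> 0 \<and> c (adj_letter l) j \<noteq> 0}"
    then have "\<sigma> l (\<sigma> (adj_letter l) j) = j" "c l (\<sigma> (adj_letter l) j) \<noteq> 0"
      using adjoint[of "adj_letter l" j] by auto
    then show "j \<in> \<sigma> l ` {i. shift l f i \<noteq> 0}"
      using j by (intro image_eqI[of _ _ "\<sigma> (adj_letter l) j"]) (auto simp: shift_def)
  qed (use adjoint in \<open>auto simp: shift_def\<close>)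
qed

lemma fin_supp_shift: "fin_supp f \<Longrightarrow> fin_supp (shift l f)"
  unfolding fin_supp_def bij_betw_finite[OF shift_bij] by (erule rev_finite_subset) auto

lemma inner_shift:
  assumes "fin_supp f"
  shows "inner_fs (shift l f) g = inner_fs f (shift (adj_letter l) g)"
proof -
  have "inner_fs (shift l f) g = (\<Sum>i | shift l f i \<noteq> 0. cnj (f (\<sigma> l i)) * shift (adj_letter l) g (\<sigma> l i))"
    unfolding inner_fs_def
  proof (intro sum.cong refl)
    fix i assume "i \<in> {i. shift l f i \<noteq> 0}"
    then have "\<sigma> (adj_letter l) (\<sigma> l i) = i" "c (adj_letter l) (\<sigma> l i) = cnj (c l i)"
      using adjoint[of l i] by (auto simp: shift_def)
    then show "cnj (shift l f i) * g i = cnj (f (\<sigma> l i)) * shift (adj_letter l) g (\<sigma> l i)"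
      by (simp add: shift_def)
  qed
  also have "\<dots> = (\<Sum>j | f j \<noteq> 0 \<and> c (adj_letter l) j \<noteq> 0. cnj (f j) * shift (adj_letter l) g j)"
    by (rule sum.reindex_bij_betw[OF shift_bij])
  also have "\<dots> = inner_fs f (shift (adj_letter l) g)"
    unfolding inner_fs_def using assms by (intro sum.mono_neutral_left) (auto simp: fin_supp_def shift_def)
  finally show ?thesis .
qed

lemma norm_shift:
  assumes "fin_supp f"
  shows "norm_fs (shift l f) \<le> \<bar>K\<bar> * norm_fs f"
proof -
  have "norm_fs (shift l f) \<le> L2_set (\<lambda>i. \<bar>K\<bar> * cmod (f (\<sigma> l i))) {i. shift l f i \<noteq> 0}"
    unfolding norm_fs_def
    by (rule L2_set_mono) (auto simp: shift_def norm_mult intro!: mult_right_mono order_trans[OF bounded])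
  also have "\<dots> = \<bar>K\<bar> * L2_set (\<lambda>j. cmod (f j)) {j. f j \<noteq> 0 \<and> c (adj_letter l) j \<noteq> 0}"
    unfolding L2_set_right_distrib[OF abs_ge_zero, symmetric]
    by (simp add: L2_set_def sum.reindex_bij_betw[OF shift_bij[of l f], of "\<lambda>j. (cmod (f j))\<^sup>2"])
  also have "\<dots> \<le> \<bar>K\<bar> * norm_fs f"
    unfolding norm_fs_def L2_set_def using assms
    by (intro mult_left_mono real_sqrt_le_mono sum_mono2) (auto simp: fin_supp_def)
  finally show ?thesis .
qed

lemma fin_supp_act: "fin_supp f \<Longrightarrow> fin_supp (act x f)"
proof (induction x rule: star_poly_mon_induct)
  case (mon w)
  then have "fin_supp (foldr shift u f)" for u by (induction u) (auto intro: fin_supp_shift)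
  then show ?case by (cases w) (simp add: act_mon)
next
  case zero
  show ?case by (simp add: fin_supp_def act_zero)
qed (auto simp: act_add act_scale intro: fin_supp_add fin_supp_scale)

lemma inner_act:
  assumes "fin_supp f" "fin_supp g"
  shows "inner_fs (act x f) g = inner_fs f (act (adj x) g)"
proof (induction x rule: star_poly_mon_induct)
  case (mon w)
  have "inner_fs (foldr shift u f) g = inner_fs f (foldr shift (rev (map adj_letter u)) g)" for u
  proof (induction u arbitrary: g)
    case (Cons l u)
    have "fin_supp (foldr shift u f)" for u using assms(1) by (induction u) (auto intro: fin_supp_shift)
    then show ?case using Cons by (simp add: inner_shift)
  qed simp
  then show ?case by (cases w) (simp add: adj_single act_mon)
next
  case (add x y)
  then show ?case using assms
    by (simp add: adj_add act_add inner_fs_add_left inner_fs_add_right fin_supp_act)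
next
  case (scale k x)
  then show ?case
    by (simp add: adj_mult adj_const act_scale inner_fs_scale_left inner_fs_scale_right flip: const_central)
qed (simp add: act_zero inner_fs_def)

section \<open>The operator norm and the C*-identity\<close>

definition operator_bounds :: "'g star_poly \<Rightarrow> real set" where
  "operator_bounds x = {L. 0 \<le> L \<and> (\<forall>f. fin_supp f \<longrightarrow> norm_fs (act x f) \<le> L * norm_fs f)}"

lemma operator_bounds_nonempty: "operator_bounds x \<noteq> {}"
proof (induction x rule: star_poly_mon_induct)
  case zero
  have "0 \<in> operator_bounds 0" by (simp add: operator_bounds_def act_zero norm_fs_def)
  then show ?case by blast
next
  case (mon w)
  have fin: "fin_supp (foldr shift u f)" if "fin_supp f" for u f
    using that by (induction u) (auto intro: fin_supp_shift)
  have "norm_fs (foldr shift u f) \<le> \<bar>K\<bar> ^ length u * norm_fs f" if f: "fin_supp f" for u f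
  proof (induction u)
    case (Cons l u)
    then show ?case
      using norm_shift[OF fin[OF f], of l u] mult_left_mono[OF Cons, of "\<bar>K\<bar>"] by (simp add: mult.assoc)
  qed simp
  then have "\<bar>K\<bar> ^ length u \<in> operator_bounds (mon (Word u))" for u
    by (simp add: operator_bounds_def act_mon)
  then show ?case by (cases w) blast
next
  case (add x y)
  then obtain L M where LM: "L \<in> operator_bounds x" "M \<in> operator_bounds y" by blast
  have "norm_fs (act (x + y) f) \<le> (L + M) * norm_fs f" if f: "fin_supp f" for f
  proof -
    have "norm_fs (act (x + y) f) \<le> norm_fs (act x f) + norm_fs (act y f)"
      unfolding act_add using f by (intro norm_fs_triangle fin_supp_act)
    moreover have "norm_fs (act x f) \<le> L * norm_fs f" "norm_fs (act y f) \<le> M * norm_fs f"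
      using LM f by (auto simp: operator_bounds_def)
    ultimately show ?thesis by (simp add: distrib_right)
  qed
  then have "L + M \<in> operator_bounds (x + y)" using LM by (simp add: operator_bounds_def)
  then show ?case by blast
next
  case (scale k x)
  then obtain L where L: "L \<in> operator_bounds x" by blast
  then have "cmod k * L \<in> operator_bounds (const k * x)"
    by (auto simp: operator_bounds_def act_scale norm_fs_scale mult.assoc intro!: mult_left_mono)
  then show ?case by blast
qed

definition operator_norm :: "'g star_poly \<Rightarrow> real" where
  "operator_norm x = Inf (operator_bounds x)"

lemma operator_norm_nonneg: "0 \<le> operator_norm x"
  unfolding operator_norm_def using operator_bounds_nonempty
  by (rule cInf_greatest) (simp add: operator_bounds_def)

lemma operator_norm_least:
  assumes "0 \<le> L" "\<And>f. fin_supp f \<Longrightarrow> norm_fs (act x f) \<le> L * norm_fs f"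
  shows "operator_norm x \<le> L"
  unfolding operator_norm_def
proof (rule cInf_lower)
  show "L \<in> operator_bounds x" using assms by (simp add: operator_bounds_def)
  show "bdd_below (operator_bounds x)" by (rule bdd_belowI[of _ 0]) (simp add: operator_bounds_def)
qed

lemma operator_norm_upper:
  assumes f: "fin_supp f"
  shows "norm_fs (act x f) \<le> operator_norm x * norm_fs f"
proof (cases "norm_fs f = 0")
  case True
  obtain L where "L \<in> operator_bounds x" using operator_bounds_nonempty by blast
  then show ?thesis using f True by (auto simp: operator_bounds_def)
next
  case False
  then have pos: "norm_fs f > 0" using norm_fs_nonneg[of f] by simp
  have "norm_fs (act x f) / norm_fs f \<le> operator_norm x"
    unfolding operator_norm_def using operator_bounds_nonempty
    by (rule cInf_greatest) (simp add: f operator_bounds_def pos_divide_le_eq[OF pos])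
  then show ?thesis using pos by (simp add: pos_divide_le_eq)
qed

lemma operator_norm_scale_le: "operator_norm (const k * x) \<le> cmod k * operator_norm x"
  by (rule operator_norm_least)
    (simp_all add: operator_norm_nonneg act_scale norm_fs_scale mult.assoc mult_left_mono operator_norm_upper)

lemma operator_norm_mult_le: "operator_norm (x * y) \<le> operator_norm x * operator_norm y"
proof (rule operator_norm_least)
  fix f :: "'i \<Rightarrow> complex" assume f: "fin_supp f"
  have "norm_fs (act (x * y) f) \<le> operator_norm x * norm_fs (act y f)"
    unfolding act_mult by (intro operator_norm_upper fin_supp_act f)
  also have "\<dots> \<le> operator_norm x * (operator_norm y * norm_fs f)"
    by (intro mult_left_mono operator_norm_upper f operator_norm_nonneg)
  finally show "norm_fs (act (x * y) f) \<le> operator_norm x * operator_norm y * norm_fs f" by (simp add: mult.assoc)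
qed (simp add: operator_norm_nonneg)

text \<open>The left side is the inner product of \<open>f\<close> with
  \<open>act (adj x * x) f\<close>. Cauchy-Schwarz then supplies the nontrivial half of the
  C*-identity.\<close>

lemma norm_act_square:
  assumes f: "fin_supp f"
  shows "(norm_fs (act x f))\<^sup>2 \<le> norm_fs f * norm_fs (act (adj x * x) f)"
proof -
  have "(norm_fs (act x f))\<^sup>2 = cmod (inner_fs (act x f) (act x f))"
    by (simp add: inner_fs_self norm_power del: of_real_power)
  also have "\<dots> = cmod (inner_fs f (act (adj x * x) f))"
    using f by (simp add: inner_act act_mult fin_supp_act)
  also have "\<dots> \<le> norm_fs f * norm_fs (act (adj x * x) f)"
    using f by (intro Cauchy_Schwarz_fs fin_supp_act)
  finally show ?thesis .
qed

lemma operator_norm_adj_le: "operator_norm (adj x) \<le> operator_norm x"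
proof (rule operator_norm_least)
  fix f :: "'i \<Rightarrow> complex" assume f: "fin_supp f"
  let ?g = "act (adj x) f"
  \<comment> \<open>After \<open>act x ?g\<close> is bounded by the operator norm of
    \<open>x\<close>, one factor \<open>norm_fs ?g\<close> cancels.\<close>
  have "(norm_fs ?g)\<^sup>2 \<le> norm_fs f * norm_fs (act x ?g)"
    using norm_act_square[OF f, of "adj x"] by (simp add: act_mult)
  also have "\<dots> \<le> norm_fs f * (operator_norm x * norm_fs ?g)"
    using f by (intro mult_left_mono operator_norm_upper norm_fs_nonneg fin_supp_act)
  finally have "norm_fs ?g * norm_fs ?g \<le> (operator_norm x * norm_fs f) * norm_fs ?g"
    by (simp add: power2_eq_square mult_ac)
  then show "norm_fs ?g \<le> operator_norm x * norm_fs f"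
    using norm_fs_nonneg[of ?g] mult_nonneg_nonneg[OF operator_norm_nonneg norm_fs_nonneg, of x f]
    by (cases "norm_fs ?g = 0") (auto simp: mult_le_cancel_right)
qed (rule operator_norm_nonneg)

lemma operator_norm_add_le: "operator_norm (x + y) \<le> operator_norm x + operator_norm y"
proof (rule operator_norm_least)
  fix f :: "'i \<Rightarrow> complex" assume f: "fin_supp f"
  have "norm_fs (act (x + y) f) \<le> norm_fs (act x f) + norm_fs (act y f)"
    unfolding act_add using f by (intro norm_fs_triangle fin_supp_act)
  also have "\<dots> \<le> operator_norm x * norm_fs f + operator_norm y * norm_fs f"
    by (intro add_mono operator_norm_upper f)
  finally show "norm_fs (act (x + y) f) \<le> (operator_norm x + operator_norm y) * norm_fs f"
    by (simp only: distrib_right)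
qed (simp add: operator_norm_nonneg)

lemma operator_norm_scale: "operator_norm (const k * x) = cmod k * operator_norm x"
proof (cases "k = 0")
  case True
  then show ?thesis using operator_norm_scale_le[of 0 x] operator_norm_nonneg[of 0] by simp
next
  case False
  then have x: "const (inverse k) * (const k * x) = x" by (simp flip: mult.assoc const_mult)
  have "operator_norm x \<le> cmod (inverse k) * operator_norm (const k * x)"
    using operator_norm_scale_le[of "inverse k" "const k * x"] unfolding x .
  then have "cmod k * operator_norm x \<le> cmod k * (cmod (inverse k) * operator_norm (const k * x))"
    by (intro mult_left_mono) auto
  also have "\<dots> = operator_norm (const k * x)" using False by (simp add: norm_inverse)
  finally have "cmod k * operator_norm x \<le> operator_norm (const k * x)" .
  then show ?thesis using operator_norm_scale_le[of k x] by linarith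
qed

lemma operator_norm_cstar_ge: "(operator_norm x)\<^sup>2 \<le> operator_norm (adj x * x)"
proof -
  have "operator_norm x \<le> sqrt (operator_norm (adj x * x))"
  proof (rule operator_norm_least)
    fix f :: "'i \<Rightarrow> complex" assume f: "fin_supp f"
    have "(norm_fs (act x f))\<^sup>2 \<le> norm_fs f * (operator_norm (adj x * x) * norm_fs f)"
      by (rule order_trans[OF norm_act_square[OF f]])
        (intro mult_left_mono operator_norm_upper f norm_fs_nonneg)
    also have "\<dots> = (sqrt (operator_norm (adj x * x)) * norm_fs f)\<^sup>2"
      unfolding power_mult_distrib real_sqrt_pow2[OF operator_norm_nonneg] by (simp add: power2_eq_square)
    finally show "norm_fs (act x f) \<le> sqrt (operator_norm (adj x * x)) * norm_fs f"
      by (rule power2_le_imp_le) (simp add: operator_norm_nonneg norm_fs_nonneg)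
  qed (simp add: operator_norm_nonneg)
  from power_mono[OF this operator_norm_nonneg, of 2] show ?thesis
    by (simp only: real_sqrt_pow2[OF operator_norm_nonneg])
qed

lemma cstar_seminorm_operator_norm: "cstar_seminorm operator_norm"
proof
  show "operator_norm (adj x * x) = (operator_norm x)\<^sup>2" for x
  proof (rule antisym)
    show "operator_norm (adj x * x) \<le> (operator_norm x)\<^sup>2"
      unfolding power2_eq_square
      by (rule order_trans[OF operator_norm_mult_le mult_right_mono[OF operator_norm_adj_le operator_norm_nonneg]])
  qed (rule operator_norm_cstar_ge)
qed (fact operator_norm_nonneg operator_norm_add_le operator_norm_scale operator_norm_mult_le)+

lemma operator_norm_zero:
  assumes "\<And>f. act x f = (\<lambda>i. 0)"
  shows "operator_norm x = 0"
  using operator_norm_least[of 0 x] operator_norm_nonneg[of x] assms by (force simp: norm_fs_def)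

end

section \<open>A representation in which the generator b is not zero\<close>

text \<open>For \<open>cmod q < 1\<close> the basis vectors are transformed by \<open>a e(n, k) = sqrt (1 - s ^ (n + 1)) e(n + 1, k)\<close>,
  \<open>b e(n, k) = q ^ n w ^ k e(n, k)\<close> and \<open>D e(n, k) = e(n, k + 1)\<close>; for \<open>cmod q > 1\<close>
  the roles of \<open>a\<close> and its adjoint are exchanged. Since \<open>up (0, k) = 0\<close>, the truncated
  subtraction in \<open>pred\<close> is harmless.\<close>

lemma universal_norm_b_pos:
  assumes q: "q \<noteq> 0" "cmod q \<noteq> 1"
  shows "universal_seminorm (Uq2_relations q) (gen Gen_b) > 0"
proof -
  define small where "small \<longleftrightarrow> cmod q < 1"
  define r where "r = (if small then q else inverse q)"
  \<comment> \<open>\<open>\<kappa>\<close> is the value of \<open>b\<close> on the basis vector at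
    \<open>(0, 0)\<close>. If \<open>small\<close>, that vector is killed by the adjoint of
    \<open>a\<close>, and the relation for \<open>a * adj a\<close> forces modulus 1. Otherwise it
    is killed by \<open>a\<close>, and the relation for \<open>adj a * a\<close> forces modulus
    \<open>1 / cmod q\<close>.\<close>
  define \<kappa> where "\<kappa> = (if small then 1 else inverse (complex_of_real (cmod q)))"
  define s where "s = (cmod r)\<^sup>2"
  define w where "w = q\<^sup>2 / (complex_of_real (cmod q))\<^sup>2"
  have r: "cmod r < 1" "r \<noteq> 0" using q by (auto simp: r_def small_def norm_inverse inverse_less_1_iff)
  have s: "0 \<le> s" "s < 1" using r by (simp_all add: s_def power_less_one_iff)
  have w: "cmod w = 1" "w \<noteq> 0" using q by (simp_all add: w_def norm_divide norm_power)
  have \<kappa>: "cmod \<kappa> \<le> 1" "\<kappa> \<noteq> 0"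
    using q by (auto simp: \<kappa>_def small_def norm_inverse inverse_le_1_iff)
  have le1: "s ^ n \<le> 1" for n using s by (simp add: power_le_one)
  \<comment> \<open>Weights are read at the target of an operator: \<open>up\<close> belongs to the
    raising operator and \<open>down\<close> to the lowering one, which explains
    \<open>down (n, k) = up (Suc n, k)\<close>.\<close>
  define up :: "nat \<times> int \<Rightarrow> complex" where "up = (\<lambda>(n, k). of_real (sqrt (1 - s ^ n)))"
  define down :: "nat \<times> int \<Rightarrow> complex" where "down = (\<lambda>(n, k). of_real (sqrt (1 - s ^ Suc n)))"
  define \<beta> :: "nat \<times> int \<Rightarrow> complex" where "\<beta> = (\<lambda>(n, k). \<kappa> * r ^ n * w powi k)"
  define c :: "Uq2_gen letter \<Rightarrow> nat \<times> int \<Rightarrow> complex" where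
    "c l = (case l of Gen Gen_a \<Rightarrow> if small then up else down | Adj Gen_a \<Rightarrow> if small then down else up
      | Gen Gen_b \<Rightarrow> \<beta> | Adj Gen_b \<Rightarrow> (\<lambda>i. cnj (\<beta> i)) | _ \<Rightarrow> (\<lambda>i. 1))" for l
  define pred :: "nat \<times> int \<Rightarrow> nat \<times> int" where "pred = (\<lambda>(n, k). (n - 1, k))"
  define succ :: "nat \<times> int \<Rightarrow> nat \<times> int" where "succ = (\<lambda>(n, k). (Suc n, k))"
  define \<sigma> :: "Uq2_gen letter \<Rightarrow> nat \<times> int \<Rightarrow> nat \<times> int" where
    "\<sigma> l = (case l of Gen Gen_a \<Rightarrow> if small then pred else succ | Adj Gen_a \<Rightarrow> if small then succ else pred
      | Gen Gen_D \<Rightarrow> (\<lambda>(n, k). (n, k - 1)) | Adj Gen_D \<Rightarrow> (\<lambda>(n, k). (n, k + 1)) | _ \<Rightarrow> id)" for l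
  interpret weighted_shifts c \<sigma> 1
  proof
    fix l :: "Uq2_gen letter" and i :: "nat \<times> int"
    obtain n k where i: "i = (n, k)" by (cases i)
    show "\<sigma> (adj_letter l) (\<sigma> l i) = i \<and> c (adj_letter l) (\<sigma> l i) = cnj (c l i)" if "c l i \<noteq> 0"
    proof (cases l)
      case (Gen g)
      then show ?thesis using that i
        by (cases n; cases g) (auto simp: c_def \<sigma>_def pred_def succ_def up_def down_def split: if_splits)
    next
      case (Adj g)
      then show ?thesis using that i
        by (cases n; cases g) (auto simp: c_def \<sigma>_def pred_def succ_def up_def down_def split: if_splits)
    qed
    have "cmod (\<beta> (n, k)) \<le> 1"
      using r \<kappa> w by (auto simp: \<beta>_def norm_mult norm_power norm_power_int intro!: mult_le_one power_le_one)
    moreover have "cmod (up (n, k)) \<le> 1" "cmod (down (n, k)) \<le> 1"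
      using le1[of n] le1[of "Suc n"] s by (simp_all add: up_def down_def del: power_Suc)
    ultimately have "cmod (\<beta> i) \<le> 1" "cmod (up i) \<le> 1" "cmod (down i) \<le> 1" using i by auto
    then show "cmod (c l i) \<le> 1"
      by (auto simp: c_def split: letter.split Uq2_gen.split)
  qed
  have \<beta>2: "\<beta> (n, k) * cnj (\<beta> (n, k)) = of_real ((cmod \<kappa>)\<^sup>2 * s ^ n)" for n k
  proof -
    have "cmod (\<beta> (n, k)) = cmod \<kappa> * cmod r ^ n" using w by (simp add: \<beta>_def norm_mult norm_power norm_power_int)
    then have "(cmod (\<beta> (n, k)))\<^sup>2 = (cmod \<kappa>)\<^sup>2 * s ^ n"
      by (simp add: power_mult_distrib s_def mult.commute flip: power_mult)
    then show ?thesis by (simp only: complex_norm_square[symmetric])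
  qed
  have up2: "up (n, k) * up (n, k) = of_real (1 - s ^ n)" for n k
    using le1[of n] by (simp add: up_def flip: of_real_mult)
  have \<kappa>2: "small \<Longrightarrow> (cmod q)\<^sup>2 = s" "small \<Longrightarrow> \<kappa> = 1" "\<not> small \<Longrightarrow> (cmod \<kappa>)\<^sup>2 = s"
     "\<not> small \<Longrightarrow> (cmod q)\<^sup>2 * s = 1"
    using q by (auto simp: s_def r_def \<kappa>_def norm_inverse power_inverse norm_power)
  have up0: "up (0, k) = 0" for k by (simp add: up_def)
  have upS: "up (Suc n, k) = down (n, k)" for n k by (simp add: up_def down_def)
  have down2: "down (n, k) * (down (n, k) * y) = (1 - of_real s * of_real s ^ n) * y" for n k y
    using up2[of "Suc n" k] by (simp add: upS mult.assoc[symmetric])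
  define C where "C = (if small then 1 else complex_of_real s)"
  have C: "C = of_real ((cmod \<kappa>)\<^sup>2)" using \<kappa>2(2,3) by (auto simp: C_def simp del: of_real_power)
  have \<beta>2': "\<beta> (n, k) * (cnj (\<beta> (n, k)) * y) = C * of_real s ^ n * y"
    "cnj (\<beta> (n, k)) * (\<beta> (n, k) * y) = C * of_real s ^ n * y" for n k y
    using \<beta>2[of n k] unfolding C by (simp_all add: mult.assoc[symmetric]) (simp_all add: mult.commute)
  have \<beta>S: "\<beta> (Suc n, k) = (if small then q else inverse q) * \<beta> (n, k)" for n k
    by (simp add: \<beta>_def r_def)
  have w\<beta>: "w * (\<beta> (n, k - 1) * y) = \<beta> (n, k) * y" for n k y
    using w by (simp add: \<beta>_def power_int_diff)
  have weights: "up (n, k - 1) = up (n, k)" "down (n, k - 1) = down (n, k)" for n k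
    by (simp_all add: up_def down_def)
  have q2: "(complex_of_real (cmod q))\<^sup>2 * C = (if small then of_real s else 1)"
  proof (cases small)
    case True
    then show ?thesis using \<kappa>2(1) by (simp add: C_def flip: of_real_power)
  next
    case False
    have "(complex_of_real (cmod q))\<^sup>2 * complex_of_real s = of_real ((cmod q)\<^sup>2 * s)" by simp
    then show ?thesis using False \<kappa>2(4) by (simp add: C_def)
  qed
  have q2': "(complex_of_real (cmod q))\<^sup>2 * (C * y) = (if small then of_real s else 1) * y" for y
    using q2 by (simp add: mult.assoc[symmetric])
  have shifts: "shift (Gen Gen_a) f (n, k) = (if small then up (n, k) * f (n - 1, k) else down (n, k) * f (Suc n, k))"
    "shift (Adj Gen_a) f (n, k) = (if small then down (n, k) * f (Suc n, k) else up (n, k) * f (n - 1, k))"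
    "shift (Gen Gen_b) f (n, k) = \<beta> (n, k) * f (n, k)" "shift (Adj Gen_b) f (n, k) = cnj (\<beta> (n, k)) * f (n, k)"
    "shift (Gen Gen_D) f (n, k) = f (n, k - 1)" "shift (Adj Gen_D) f (n, k) = f (n, k + 1)" for f n k
    by (simp_all add: shift_def c_def \<sigma>_def pred_def succ_def)
  have "act x f (n, k) = 0" if "x \<in> Uq2_relations q" for x f n k
    using that unfolding Uq2_relations_def Let_def w_def[symmetric]
    by (cases n; cases small; auto simp del: of_real_power simp: act_diff act_add act_mult act_one
          act_const act_gen shifts up0 upS w\<beta> \<beta>2' down2 q2' mult.assoc)
      (use q in \<open>simp_all add: algebra_simps weights \<beta>S C_def\<close>)
  then have "act x f = (\<lambda>i. 0)" if "x \<in> Uq2_relations q" for x f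
    using that by (intro ext) (metis surj_pair)
  then have "operator_norm \<in> rel_seminorms (Uq2_relations q)"
    by (auto simp: rel_seminorms_def cstar_seminorm_operator_norm intro!: operator_norm_zero)
  then have "operator_norm (gen Gen_b) \<le> universal_seminorm (Uq2_relations q) (gen Gen_b)"
    by (rule universal_upper[OF Uq2_admissible[OF q(2)]])
  moreover have "operator_norm (gen Gen_b) > 0"
  proof -
    \<comment> \<open>The basis vector at \<open>(0, 0)\<close> is an eigenvector of
      \<open>b\<close> with the nonzero eigenvalue \<open>\<kappa>\<close>.\<close>
    let ?f = "\<lambda>i::nat \<times> int. if i = (0, 0) then 1 else 0 :: complex"
    have supp: "{i. ?f i \<noteq> 0} = {(0, 0)}" by auto
    have f: "fin_supp ?f" "norm_fs ?f = 1" unfolding fin_supp_def norm_fs_def supp by (simp_all add: L2_set_def)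
    have "act (gen Gen_b) ?f = (\<lambda>i. \<kappa> * ?f i)"
      by (rule ext) (auto simp: act_gen shift_def c_def \<sigma>_def \<beta>_def)
    then have "cmod \<kappa> \<le> operator_norm (gen Gen_b)"
      using operator_norm_upper[OF f(1), of "gen Gen_b"] f(2) by (simp only: norm_fs_scale mult_1_right)
    then show ?thesis using \<kappa> by (meson less_le_trans zero_less_norm_iff)
  qed
  ultimately show ?thesis by simp
qed

section \<open>Characters\<close>

text \<open>One-dimensional representations with \<open>b\<close> sent to 0. Sending
  \<open>a\<close> to 1 loses no information on central elements, which turn out to have degree 0 in
  \<open>a\<close> up to null sequences; the value \<open>t\<close> at \<open>D\<close> is the
  circle variable.\<close>

fun char_letter :: "complex \<Rightarrow> Uq2_gen letter \<Rightarrow> complex" where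
  "char_letter t (Gen g) = (case g of Gen_a \<Rightarrow> 1 | Gen_b \<Rightarrow> 0 | Gen_D \<Rightarrow> t)"
| "char_letter t (Adj g) = (case g of Gen_a \<Rightarrow> 1 | Gen_b \<Rightarrow> 0 | Gen_D \<Rightarrow> cnj t)"

fun char_word :: "complex \<Rightarrow> Uq2_gen word \<Rightarrow> complex" where
  "char_word t (Word u) = prod_list (map (char_letter t) u)"

definition character :: "complex \<Rightarrow> Uq2_gen star_poly \<Rightarrow> complex" where
  "character t = linear_ext (char_word t)"

abbreviation D_grading :: "Uq2_gen \<Rightarrow> int" where
  "D_grading \<equiv> (\<lambda>g. if g = Gen_D then 1 else 0)"

lemma char_word_plus: "char_word t (v + w) = char_word t v * char_word t w"
  by (cases v; cases w) simp

lemma char_word_adj: "char_word t (adj_word w) = cnj (char_word t w)"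
proof -
  have "char_letter t (adj_letter l) = cnj (char_letter t l)" for l
    by (cases l; rename_tac g; case_tac g) auto
  then have "prod_list (map (char_letter t) (rev (map adj_letter u))) = cnj (prod_list (map (char_letter t) u))" for u
    by (induction u) auto
  then show ?thesis by (cases w) simp
qed

lemma character_simps:
  "character t (x + y) = character t x + character t y"
  "character t (x - y) = character t x - character t y"
  "character t (x * y) = character t x * character t y"
  "character t (const c) = c"
  "character t 0 = 0"
  "character t 1 = 1"
  "character t (adj x) = cnj (character t x)"
  "character t (gen Gen_a) = 1" "character t (gen Gen_b) = 0" "character t (gen Gen_D) = t"
proof -
  have [simp]: "char_word t 0 = 1" by (simp add: zero_word_def)
  show "character t (const c) = c" for c by (simp add: character_def linear_ext_const)
  then show "character t 1 = 1" by (metis const_1)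
qed (simp_all add: character_def linear_ext_add linear_ext_diff linear_ext_mult char_word_plus
    linear_ext_adj char_word_adj linear_ext_single gen_def)

lemma continuous_on_character: "continuous_on T (\<lambda>t. character t x)"
proof (induction x rule: star_poly_mon_induct)
  case (mon w)
  have letter: "continuous_on T (\<lambda>t. char_letter t l)" for l
    by (cases l; rename_tac g; case_tac g) (auto intro!: continuous_intros)
  have "continuous_on T (\<lambda>t. prod_list (map (char_letter t) u))" for u
    by (induction u) (auto intro!: continuous_intros letter)
  then show ?case by (cases w) (simp add: character_def linear_ext_single)
qed (simp_all add: character_simps continuous_on_add continuous_on_mult)

text \<open>The whole family arises from the character at 1 by the gauge action on \<open>D\<close>.
  Bounds over the circle thus become bounds on a gauge orbit, and the values of
  \<open>character 1\<close> on components are Fourier coefficients.\<close>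

lemma character_gauge:
  assumes t: "cmod t = 1"
  shows "character t x = character 1 (gauge D_grading t x)"
proof -
  have [simp]: "t \<noteq> 0" "cnj t = inverse t"
    using t by (auto simp: divide_conv_cnj inverse_eq_divide)
  have l: "char_letter t l = char_letter 1 l * t powi letter_degree D_grading l" for l
    by (cases l; rename_tac g; case_tac g) (auto simp: power_int_minus)
  have "prod_list (map (char_letter t) u) = prod_list (map (char_letter 1) u) * t powi sum_list (map (letter_degree D_grading) u)" for u
    by (induction u) (simp_all add: l power_int_add)
  then have "char_word t = (\<lambda>w. char_word 1 w * t powi degree D_grading w)"
    by (intro ext) (rename_tac w, case_tac w, simp)
  then show ?thesis unfolding character_def gauge_def linear_ext_weight by simp
qed

lemma character_seminorm: "cstar_seminorm (\<lambda>x. cmod (character t x))"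
  by unfold_locales
    (simp_all add: character_simps norm_triangle_ineq norm_mult power2_eq_square)

text \<open>This makes the characters lower bounds for the universal seminorm; \<open>t\<close> has
  to be unimodular for \<open>D\<close> to be sent to a unitary.\<close>

lemma character_rel_seminorm:
  assumes "cmod t = 1"
  shows "(\<lambda>x. cmod (character t x)) \<in> rel_seminorms (Uq2_relations q)"
proof -
  have "t * cnj t = 1" using assms by (simp add: complex_norm_square[symmetric])
  then show ?thesis
    unfolding rel_seminorms_def Uq2_relations_def Let_def
    by (simp add: character_seminorm character_simps mult.commute)
qed

section \<open>Calculating modulo a seminorm\<close>

lemma const_diff: "const (c - d) = const c - const d"
  by (simp add: const_def single_diff)

text \<open>Unlike \<open>const_central\<close> and \<open>const_mult_left\<close>, the rules for the following
  constant are terminating rewrite rules.\<close>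

definition scaled :: "complex \<Rightarrow> 'g star_poly \<Rightarrow> 'g star_poly" where
  "scaled c x = const c * x"

lemma scaled_simps:
  "const c * x = scaled c x"
  "scaled c x * y = scaled c (x * y)"
  "x * scaled c y = scaled c (x * y)"
  "scaled c (scaled d x) = scaled (c * d) x"
  "adj (scaled c x) = scaled (cnj c) (adj x)"
proof -
  show "const c * x = scaled c x" by (simp only: scaled_def)
  show "scaled c x * y = scaled c (x * y)" by (simp only: scaled_def mult.assoc)
  show "x * scaled c y = scaled c (x * y)" by (simp only: scaled_def const_mult_left)
  show "scaled c (scaled d x) = scaled (c * d) x" by (simp only: scaled_def mult.assoc const_mult)
  show "adj (scaled c x) = scaled (cnj c) (adj x)"
    unfolding scaled_def adj_mult adj_const by (rule const_central[symmetric])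
qed

context cstar_seminorm begin

text \<open>Equality in the completion, expressed on polynomials, so that calculations with the
  relations involve neither cosets nor carrier conditions.\<close>

definition eqv :: "'g star_poly \<Rightarrow> 'g star_poly \<Rightarrow> bool" (infix \<open>\<doteq>\<close> 50) where
  "x \<doteq> y \<longleftrightarrow> p (x - y) = 0"

lemma eqv_refl [simp]: "x \<doteq> x"
  by (simp add: eqv_def)

lemma eqv_sym: "x \<doteq> y \<Longrightarrow> y \<doteq> x"
  by (simp add: eqv_def p_minus_commute)

lemma p_eq_zeroI: "p x \<le> 0 \<Longrightarrow> p x = 0"
  using p_nonneg[of x] by simp

lemma eqv_trans [trans]: "x \<doteq> y \<Longrightarrow> y \<doteq> z \<Longrightarrow> x \<doteq> z"
  unfolding eqv_def using p_triangle_diff[of x z y] by (intro p_eq_zeroI) simp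

lemma eqv_add: "x \<doteq> y \<Longrightarrow> x' \<doteq> y' \<Longrightarrow> x + x' \<doteq> y + y'"
  unfolding eqv_def using p_triangle[of "x - y" "x' - y'"] by (intro p_eq_zeroI) (simp add: add_diff_add)

lemma eqv_mult_left: "x \<doteq> y \<Longrightarrow> z * x \<doteq> z * y"
  unfolding eqv_def using p_mult[of z "x - y"] by (intro p_eq_zeroI) (simp add: right_diff_distrib)

lemma eqv_mult_right: "x \<doteq> y \<Longrightarrow> x * z \<doteq> y * z"
  unfolding eqv_def using p_mult[of "x - y" z] by (intro p_eq_zeroI) (simp add: left_diff_distrib)

lemma eqv_uminus: "x \<doteq> y \<Longrightarrow> - x \<doteq> - y"
  unfolding eqv_def using p_minus_commute[of x y] by simp

lemma eqv_diff: "x \<doteq> y \<Longrightarrow> x' \<doteq> y' \<Longrightarrow> x - x' \<doteq> y - y'"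
  using eqv_add[OF _ eqv_uminus, of x y x' y'] by simp

lemma eqv_adj: "x \<doteq> y \<Longrightarrow> adj x \<doteq> adj y"
  unfolding eqv_def by (simp flip: adj_diff)

lemma eqv_p: "x \<doteq> y \<Longrightarrow> p x = p y"
  unfolding eqv_def by (rule p_eq_of_diff)

text \<open>Multiply \<open>x * u = u * x\<close> by \<open>adj u\<close> from both sides and cancel
  by unitarity.\<close>

lemma commute_adj_unitary:
  assumes "u * adj u \<doteq> 1" "adj u * u \<doteq> 1" "x * u \<doteq> u * x"
  shows "adj u * x \<doteq> x * adj u"
proof -
  have "adj u * x = adj u * (x * 1)" by simp
  also have "\<dots> \<doteq> adj u * (x * (u * adj u))" by (intro eqv_mult_left eqv_sym[OF assms(1)])
  also have "\<dots> = adj u * (x * u) * adj u" by (simp add: mult.assoc)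
  also have "\<dots> \<doteq> adj u * (u * x) * adj u" by (intro eqv_mult_left eqv_mult_right assms(3))
  also have "\<dots> = adj u * u * (x * adj u)" by (simp add: mult.assoc)
  also have "\<dots> \<doteq> 1 * (x * adj u)" by (intro eqv_mult_right assms(2))
  finally show ?thesis by simp
qed

lemma p_power: "p (x ^ Suc n) \<le> p x ^ Suc n"
proof (induction n)
  case (Suc n)
  have "p (x ^ Suc (Suc n)) \<le> p x * p (x ^ Suc n)" using p_mult[of x "x ^ Suc n"] by simp
  also have "\<dots> \<le> p x * p x ^ Suc n" by (intro mult_left_mono Suc p_nonneg)
  finally show ?case by simp
qed simp

text \<open>Repeated squaring by the C*-identity. These exponents already determine growth rates,
  which is how the spectral radius enters the later arguments.\<close>

lemma p_power_selfadjoint: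
  assumes "adj x = x"
  shows "p (x ^ (2 ^ k)) = p x ^ (2 ^ k)"
proof (induction k)
  case (Suc k)
  have adj_power: "adj (x ^ n) = x ^ n" for n
    by (induction n) (simp_all add: adj_mult assms power_commutes)
  have "p (x ^ (2 ^ Suc k)) = p (adj (x ^ (2 ^ k)) * x ^ (2 ^ k))"
    by (simp add: adj_power mult_2 flip: power_add)
  also have "\<dots> = (p (x ^ (2 ^ k)))\<^sup>2" by (rule p_cstar)
  finally show ?case by (simp add: Suc power_mult[symmetric] mult.commute)
qed simp

lemma tendsto_zero_le: "(\<lambda>n. p (x n)) \<longlonglongrightarrow> 0 \<Longrightarrow> (\<And>n. p (y n) \<le> C * p (x n)) \<Longrightarrow> (\<lambda>n. p (y n)) \<longlonglongrightarrow> 0"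
  by (rule tendsto_zero_dominated[OF tendsto_mult_right_zero])

text \<open>There is no uniformity in \<open>y\<close>: only commutators with fixed polynomials are
  controlled. For Cauchy sequences this nevertheless describes the center of the completion.\<close>

definition central :: "(nat \<Rightarrow> 'g star_poly) \<Rightarrow> bool" where
  "central x \<longleftrightarrow> (\<forall>y. (\<lambda>n. p (x n * y - y * x n)) \<longlonglongrightarrow> 0)"

lemma central_adj:
  assumes "central x" shows "central (\<lambda>n. adj (x n))"
  unfolding central_def
proof
  fix y
  have "p (adj (x n) * y - y * adj (x n)) = p (x n * adj y - adj y * x n)" for n
  proof -
    have "adj (adj (x n) * y - y * adj (x n)) = - (x n * adj y - adj y * x n)"
      by (simp add: adj_diff adj_mult)
    then show ?thesis by (metis p_adj p_uminus)
  qed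
  then show "(\<lambda>n. p (adj (x n) * y - y * adj (x n))) \<longlonglongrightarrow> 0" using assms by (simp add: central_def)
qed

lemma central_diff:
  assumes "central x" "central x'" shows "central (\<lambda>n. x n - x' n)"
  unfolding central_def
proof
  fix y
  have "(\<lambda>n. p (x n * y - y * x n) + p (x' n * y - y * x' n)) \<longlonglongrightarrow> 0"
    using assms by (intro tendsto_add_zero) (auto simp: central_def)
  then show "(\<lambda>n. p ((x n - x' n) * y - y * (x n - x' n))) \<longlonglongrightarrow> 0"
  proof (rule tendsto_zero_dominated)
    fix n
    have "(x n - x' n) * y - y * (x n - x' n) = (x n * y - y * x n) + - (x' n * y - y * x' n)"
      by (simp add: algebra_simps)
    then show "p ((x n - x' n) * y - y * (x n - x' n)) \<le> p (x n * y - y * x n) + p (x' n * y - y * x' n)"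
      using p_triangle p_uminus by metis
  qed
qed

text \<open>The Leibniz rule for the commutator with \<open>y\<close>; the Cauchy hypotheses bound
  the remaining factors.\<close>

lemma central_mult:
  assumes "central x" "central x'" "cauchy x" "cauchy x'"
  shows "central (\<lambda>n. x n * x' n)"
  unfolding central_def
proof
  fix y
  obtain K where K: "\<And>n. p (x n) \<le> K" "K > 0" using cauchy_bounded assms(3) by blast
  obtain K' where K': "\<And>n. p (x' n) \<le> K'" "K' > 0" using cauchy_bounded assms(4) by blast
  have "(\<lambda>n. K * p (x' n * y - y * x' n) + K' * p (x n * y - y * x n)) \<longlonglongrightarrow> 0"
    using assms(1,2) by (intro tendsto_add_zero tendsto_mult_right_zero) (auto simp: central_def)
  then show "(\<lambda>n. p (x n * x' n * y - y * (x n * x' n))) \<longlonglongrightarrow> 0"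
  proof (rule tendsto_zero_dominated)
    fix n
    have "x n * x' n * y - y * (x n * x' n) = x n * (x' n * y - y * x' n) + (x n * y - y * x n) * x' n"
      by (simp add: algebra_simps)
    then have "p (x n * x' n * y - y * (x n * x' n))
        \<le> p (x n * (x' n * y - y * x' n)) + p ((x n * y - y * x n) * x' n)"
      by (simp only: p_triangle)
    also have "\<dots> \<le> p (x n) * p (x' n * y - y * x' n) + p (x n * y - y * x n) * p (x' n)"
      by (intro add_mono p_mult)
    also have "\<dots> \<le> K * p (x' n * y - y * x' n) + p (x n * y - y * x n) * K'"
      using K K' by (intro add_mono mult_right_mono mult_left_mono p_nonneg)
    finally show "p (x n * x' n * y - y * (x n * x' n))
        \<le> K * p (x' n * y - y * x' n) + K' * p (x n * y - y * x n)" by (simp add: mult.commute)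
  qed
qed

end

text \<open>For a word \<open>w\<close>, the commutator with the component of degree
  \<open>i\<close> is the component of degree \<open>i + degree e w\<close> of the full commutator,
  and taking components is contractive.\<close>

lemma (in gauge_invariant_seminorm) central_component:
  assumes "central x" shows "central (\<lambda>n. component e i (x n))"
  unfolding central_def
proof
  fix y
  show "(\<lambda>n. p (component e i (x n) * y - y * component e i (x n))) \<longlonglongrightarrow> 0"
  proof (induction y rule: star_poly_mon_induct)
    case (mon w)
    have "p (component e i (x n) * mon w - mon w * component e i (x n)) \<le> p (x n * mon w - mon w * x n)" for n
      using p_component[of e "i + degree e w" "x n * mon w - mon w * x n"]
      by (simp only: component_diff component_mon_left component_mon_right)
    moreover have "(\<lambda>n. p (x n * mon w - mon w * x n)) \<longlonglongrightarrow> 0" using assms by (simp add: central_def)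
    ultimately show ?case by (rule tendsto_zero_dominated[rotated])
  next
    case (add y z)
    show ?case
    proof (rule tendsto_zero_dominated[OF tendsto_add_zero[OF add]])
      show "p (component e i (x n) * (y + z) - (y + z) * component e i (x n))
        \<le> p (component e i (x n) * y - y * component e i (x n)) + p (component e i (x n) * z - z * component e i (x n))" for n
        using p_triangle[of "component e i (x n) * y - y * component e i (x n)" "component e i (x n) * z - z * component e i (x n)"]
        by (simp add: algebra_simps)
    qed
  next
    case (scale c y)
    have "component e i (x n) * (const c * y) - (const c * y) * component e i (x n)
      = const c * (component e i (x n) * y - y * component e i (x n))" for n
      by (simp add: const_mult_left mult.assoc right_diff_distrib)
    then show ?case using tendsto_mult_right_zero[OF scale, of "cmod c"] by (simp add: p_scale)
  qed simp
qed

section \<open>Central elements\<close>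

text \<open>The case \<open>cmod q > 1\<close> is reduced to the case \<open>cmod q < 1\<close> by exchanging
  the generator \<open>a\<close> with its adjoint: then \<open>r = 1 / q\<close> and \<open>\<kappa> = (cmod q)\<^sup>2\<close>.\<close>

locale quantum_U2 = gauge_invariant_seminorm p for p :: "Uq2_gen star_poly \<Rightarrow> real" +
  fixes a b D :: "Uq2_gen star_poly" and r w :: complex and s \<kappa> :: real
  assumes a: "a = gen Gen_a \<or> a = adj (gen Gen_a)"
    and b: "b = gen Gen_b" and D: "D = gen Gen_D"
    and s_eq: "s = (cmod r)\<^sup>2" and s: "0 < s" "s < 1" and w: "cmod w = 1"
    and rel_ba: "b * a \<doteq> const r * (a * b)"
    and rel_a'b: "adj a * b \<doteq> const r * (b * adj a)"
    and rel_bb': "b * adj b \<doteq> adj b * b"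
    and rel_aa': "a * adj a \<doteq> 1 - const (of_real \<kappa>) * (b * adj b)"
    and rel_a'a: "adj a * a \<doteq> 1 - const (of_real s) * (const (of_real \<kappa>) * (b * adj b))"
    and rel_aD: "a * D \<doteq> D * a"
    and rel_bD: "b * D \<doteq> const w * (D * b)"
    and rel_DD': "D * adj D \<doteq> 1" and rel_D'D: "adj D * D \<doteq> 1"
    and b_pos: "p b > 0"
    and character_bound: "cmod t = 1 \<Longrightarrow> cmod (character t x) \<le> p x"
begin

section \<open>Norm estimates for \<open>h\<close> and for the powers of \<open>a\<close>\<close>

definition h :: "Uq2_gen star_poly" where "h = const (of_real \<kappa>) * (b * adj b)"

lemma p_1: "p 1 = 1"
  using character_bound[of 1 1] p_one by (simp add: character_simps)

lemma p_const: "p (const c) = cmod c"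
  using p_scale[of c 1] by (simp add: p_1)

lemma adj_h: "adj h = h"
  by (simp add: h_def scaled_simps adj_mult)

text \<open>The factor \<open>\<kappa>\<close> in \<open>h\<close> is what gives the two relations
  the shapes \<open>1 - h\<close> and \<open>1 - s * h\<close> with \<open>s < 1\<close>, whether
  \<open>a\<close> is the generator or its adjoint.\<close>

lemma aa': "a * adj a \<doteq> 1 - h" and a'a: "adj a * a \<doteq> 1 - const (of_real s) * h"
  using rel_aa' rel_a'a by (simp_all add: h_def)

lemma b'a: "adj b * a \<doteq> const (cnj r) * (a * adj b)"
  using eqv_adj[OF rel_a'b] by (simp add: scaled_simps adj_mult)

lemma ha: "h * a \<doteq> const (of_real s) * (a * h)"
proof -
  have rr: "complex_of_real s = r * cnj r" by (simp only: s_eq complex_norm_square)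
  have "h * a = const (of_real \<kappa>) * (b * (adj b * a))" by (simp add: h_def mult.assoc)
  also have "\<dots> \<doteq> const (of_real \<kappa>) * (b * (const (cnj r) * (a * adj b)))"
    by (intro eqv_mult_left b'a)
  also have "\<dots> = const (of_real \<kappa>) * (const (cnj r) * (b * a * adj b))"
    by (simp add: scaled_simps mult_ac)
  also have "\<dots> \<doteq> const (of_real \<kappa>) * (const (cnj r) * (const r * (a * b) * adj b))"
    by (intro eqv_mult_left eqv_mult_right rel_ba)
  also have "\<dots> = const (of_real s) * (a * h)"
    by (simp add: h_def rr scaled_simps mult.assoc) (simp add: mult_ac)
  finally show ?thesis .
qed

lemma ha_power: "h * a ^ n \<doteq> const (of_real (s ^ n)) * (a ^ n * h)"
proof (induction n)
  case (Suc n)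
  have "h * a ^ Suc n = h * a * a ^ n" by (simp add: mult.assoc)
  also have "\<dots> \<doteq> const (of_real s) * (a * h) * a ^ n" by (intro eqv_mult_right ha)
  also have "\<dots> = const (of_real s) * (a * (h * a ^ n))" by (simp add: mult.assoc)
  also have "\<dots> \<doteq> const (of_real s) * (a * (const (of_real (s ^ n)) * (a ^ n * h)))"
    by (intro eqv_mult_left Suc)
  also have "\<dots> = const (of_real (s ^ Suc n)) * (a ^ Suc n * h)"
    by (simp add: scaled_simps mult_ac)
  finally show ?case .
qed simp

lemma h_power_a: "h ^ n * a \<doteq> const (of_real (s ^ n)) * (a * h ^ n)"
proof (induction n)
  case (Suc n)
  have "h ^ Suc n * a = h * (h ^ n * a)" by (simp add: mult.assoc)
  also have "\<dots> \<doteq> h * (const (of_real (s ^ n)) * (a * h ^ n))" by (intro eqv_mult_left Suc)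
  also have "\<dots> = const (of_real (s ^ n)) * (h * a * h ^ n)" by (simp add: scaled_simps mult_ac)
  also have "\<dots> \<doteq> const (of_real (s ^ n)) * (const (of_real s) * (a * h) * h ^ n)"
    by (intro eqv_mult_left eqv_mult_right ha)
  also have "\<dots> = const (of_real (s ^ Suc n)) * (a * h ^ Suc n)"
    by (simp add: scaled_simps mult_ac)
  finally show ?case .
qed simp

text \<open>The difference \<open>h ^ n - h ^ Suc n\<close> equals \<open>h ^ n * a * adj a\<close>
  modulo \<open>p\<close>, and moving \<open>h ^ n\<close> past \<open>a\<close> costs a factor
  \<open>s ^ n\<close>. So the powers of \<open>h\<close> grow by factors tending to 1, although
  \<open>p h\<close> is not yet known to be at most 1.\<close>

lemma h_power_Suc_le: "p (h ^ Suc n) \<le> (1 + s ^ n * (p a)\<^sup>2) * p (h ^ n)"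
proof -
  have "h ^ n - h ^ Suc n = h ^ n * (1 - h)" by (simp add: right_diff_distrib power_commutes)
  also have "\<dots> \<doteq> h ^ n * (a * adj a)" by (intro eqv_mult_left eqv_sym[OF aa'])
  also have "\<dots> = h ^ n * a * adj a" by (simp add: mult.assoc)
  also have "\<dots> \<doteq> const (of_real (s ^ n)) * (a * h ^ n) * adj a" by (intro eqv_mult_right h_power_a)
  finally have "p (h ^ n - h ^ Suc n) = p (const (of_real (s ^ n)) * (a * h ^ n * adj a))"
    by (simp add: eqv_p mult.assoc)
  also have "\<dots> = s ^ n * p (a * h ^ n * adj a)" using s by (simp add: p_scale norm_power)
  also have "\<dots> \<le> s ^ n * (p a * p (h ^ n) * p a)"
    using s p_mult[of "a * h ^ n" "adj a"] p_mult[of a "h ^ n"]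
    by (intro mult_left_mono) (auto intro: order_trans mult_right_mono p_nonneg)
  finally have "p (h ^ n - h ^ Suc n) \<le> s ^ n * (p a)\<^sup>2 * p (h ^ n)" by (simp add: power2_eq_square mult_ac)
  moreover have "p (h ^ Suc n) \<le> p (h ^ Suc n - h ^ n) + p (h ^ n)"
    using p_triangle[of "h ^ Suc n - h ^ n" "h ^ n"] by simp
  ultimately show ?thesis
    using p_minus_commute[of "h ^ Suc n" "h ^ n"] by (simp only: distrib_right mult_1_left)
qed

lemma h_power_add_le: "p (h ^ (n + k)) \<le> (1 + s ^ n * (p a)\<^sup>2) ^ k * p (h ^ n)"
proof (induction k)
  case (Suc k)
  have "s ^ (n + k) \<le> s ^ n" using s by (intro power_decreasing) auto
  then have "(1 + s ^ (n + k) * (p a)\<^sup>2) * p (h ^ (n + k)) \<le> (1 + s ^ n * (p a)\<^sup>2) * p (h ^ (n + k))"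
    by (intro mult_right_mono add_left_mono p_nonneg) auto
  also have "\<dots> \<le> (1 + s ^ n * (p a)\<^sup>2) * ((1 + s ^ n * (p a)\<^sup>2) ^ k * p (h ^ n))"
    using s by (intro mult_left_mono Suc) auto
  finally show ?case using h_power_Suc_le[of "n + k"] by (simp add: mult.assoc)
qed simp

text \<open>With \<open>n = 2 ^ k\<close>, the growth bound for the powers of \<open>h\<close> gives
  \<open>(p h) ^ n \<le> (1 + s ^ n * (p a)\<^sup>2) ^ n\<close>.\<close>

lemma p_h_le_1: "p h \<le> 1"
proof (cases "p h = 0")
  case False
  then have pos: "p h > 0" using p_nonneg[of h] by simp
  have "p h \<le> 1 + s ^ (2 ^ k) * (p a)\<^sup>2" for k :: nat
  proof -
    let ?n = "2 ^ k :: nat"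
    have "p h ^ ?n * p h ^ ?n = p (h ^ (?n + ?n))"
      using p_power_selfadjoint[OF adj_h, of "Suc k"] by (simp add: mult_2 flip: power_add)
    also have "\<dots> \<le> (1 + s ^ ?n * (p a)\<^sup>2) ^ ?n * p h ^ ?n"
      using h_power_add_le[of ?n ?n] by (simp add: p_power_selfadjoint[OF adj_h])
    finally have "p h ^ ?n \<le> (1 + s ^ ?n * (p a)\<^sup>2) ^ ?n" using pos by simp
    then show ?thesis by (subst (asm) power_mono_iff) (use s pos in auto)
  qed
  moreover have "(\<lambda>k. 1 + s ^ (2 ^ k) * (p a)\<^sup>2) \<longlonglongrightarrow> 1 + 0 * (p a)\<^sup>2"
  proof -
    have "(\<lambda>n. s ^ n) \<longlonglongrightarrow> 0" using s by (intro LIMSEQ_power_zero) auto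
    then have "((\<lambda>n. s ^ n) \<circ> (\<lambda>k. 2 ^ k)) \<longlonglongrightarrow> 0"
      by (rule LIMSEQ_subseq_LIMSEQ) (simp add: strict_mono_def)
    then have "(\<lambda>k. s ^ (2 ^ k)) \<longlonglongrightarrow> 0" by (simp add: o_def)
    then show ?thesis by (intro tendsto_add tendsto_mult tendsto_const)
  qed
  ultimately have "p h \<le> 1 + 0 * (p a)\<^sup>2" using LIMSEQ_le_const by blast
  then show ?thesis by simp
qed simp

lemma p_scaled_h_le: "p (const (of_real (s ^ n)) * h * y) \<le> s ^ n * p y"
proof -
  have "p (const (of_real (s ^ n)) * h * y) = s ^ n * p (h * y)"
    using s by (simp add: mult.assoc p_scale norm_power)
  also have "\<dots> \<le> s ^ n * (1 * p y)"
    using s p_mult[of h y] mult_right_mono[OF p_h_le_1 p_nonneg, of y] by (intro mult_left_mono) auto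
  finally show ?thesis by simp
qed

abbreviation "T n \<equiv> adj (a ^ n) * a ^ n"

text \<open>The relation for \<open>adj a * a\<close> creates the new factor in the middle, and
  \<open>ha_power\<close> moves its \<open>h\<close> to the right of \<open>a ^ n\<close>. Iterating
  displays \<open>T n\<close> as the product of the factors \<open>1 - s ^ k * h\<close> for
  \<open>k\<close> from 1 to \<open>n\<close>.\<close>

lemma T_Suc: "T (Suc n) \<doteq> T n * (1 - const (of_real (s ^ Suc n)) * h)"
proof -
  have "T (Suc n) = adj (a ^ n) * (adj a * a) * a ^ n" by (simp add: adj_mult mult.assoc)
  also have "\<dots> \<doteq> adj (a ^ n) * (1 - const (of_real s) * h) * a ^ n"
    by (intro eqv_mult_left eqv_mult_right a'a)
  also have "\<dots> = adj (a ^ n) * (a ^ n - const (of_real s) * (h * a ^ n))" by (simp add: algebra_simps)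
  also have "\<dots> \<doteq> adj (a ^ n) * (a ^ n - const (of_real s) * (const (of_real (s ^ n)) * (a ^ n * h)))"
    by (intro eqv_mult_left eqv_diff eqv_refl ha_power)
  also have "\<dots> = T n * (1 - const (of_real (s ^ Suc n)) * h)"
    by (simp add: scaled_simps right_diff_distrib mult_ac)
  finally show ?thesis .
qed

text \<open>Since \<open>p h \<le> 1\<close>, the factor \<open>1 - s ^ k * h\<close> shrinks the
  seminorm at most by \<open>1 - s ^ k\<close>. The rightmost factor is absorbed into
  \<open>y\<close>, which therefore varies in the induction.\<close>

lemma T_lower: "(\<Prod>k<n. 1 - s ^ Suc k) * p y \<le> p (T n * y)"
proof (induction n arbitrary: y)
  case (Suc n)
  let ?z = "const (of_real (s ^ Suc n)) * h"
  have pos: "0 \<le> (\<Prod>k<n. 1 - s ^ Suc k)"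
    using s by (intro prod_nonneg) (auto intro: power_le_one simp del: power_Suc)
  have "p y \<le> p ((1 - ?z) * y) + p (?z * y)"
    using p_triangle[of "(1 - ?z) * y" "?z * y"] by (simp add: left_diff_distrib)
  then have "(1 - s ^ Suc n) * p y \<le> p ((1 - ?z) * y)"
    using p_scaled_h_le[of "Suc n" y] by (simp add: left_diff_distrib)
  then have "(\<Prod>k<n. 1 - s ^ Suc k) * ((1 - s ^ Suc n) * p y) \<le> (\<Prod>k<n. 1 - s ^ Suc k) * p ((1 - ?z) * y)"
    using pos by (rule mult_left_mono)
  also have "\<dots> \<le> p (T n * ((1 - ?z) * y))" by (rule Suc)
  also have "\<dots> = p (T (Suc n) * y)"
    using eqv_p[OF eqv_mult_right[OF T_Suc[of n], of y]] by (simp add: mult.assoc)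
  finally show ?case by (simp add: mult.assoc)
qed simp

lemma T_upper: "p (T n) \<le> (\<Prod>k<n. 1 + s ^ Suc k)"
proof (induction n)
  case 0
  show ?case by (simp add: p_1)
next
  case (Suc n)
  let ?z = "const (of_real (s ^ Suc n)) * h"
  have "p (1 - ?z) \<le> 1 + s ^ Suc n"
    using p_triangle[of 1 "- ?z"] p_scaled_h_le[of "Suc n" 1] p_1 by simp
  then have "p (T n) * p (1 - ?z) \<le> (\<Prod>k<n. 1 + s ^ Suc k) * (1 + s ^ Suc n)"
    using Suc s by (intro mult_mono) (auto intro!: prod_nonneg p_nonneg)
  then show ?case using eqv_p[OF T_Suc[of n]] p_mult[of "T n" "1 - ?z"] by simp
qed

lemma sum_powers_le: "(\<Sum>k<n. s ^ Suc k) \<le> 1 / (1 - s)"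
proof -
  have "(\<Sum>k<n. s ^ Suc k) \<le> (\<Sum>k<n. s ^ k)"
    using s by (intro sum_mono power_decreasing) auto
  also have "\<dots> \<le> suminf (\<lambda>k. s ^ k)" using s by (intro sum_le_suminf) auto
  also have "\<dots> = 1 / (1 - s)" using s by (simp add: suminf_geometric)
  finally show ?thesis .
qed

lemma prod_upper: "(\<Prod>k<n. 1 + s ^ Suc k) \<le> exp (1 / (1 - s))"
proof -
  have "(\<Prod>k<n. 1 + s ^ Suc k) \<le> (\<Prod>k<n. exp (s ^ Suc k))"
    using s by (intro prod_mono) (auto simp del: power_Suc)
  also have "\<dots> = exp (\<Sum>k<n. s ^ Suc k)" by (simp add: exp_sum)
  also have "\<dots> \<le> exp (1 / (1 - s))" using sum_powers_le by simp
  finally show ?thesis .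
qed

text \<open>The partial products stay away from 0 because the sum of the \<open>s ^ k\<close>
  converges. That sum is at most \<open>1 / (1 - s)\<close>; the second division by
  \<open>1 - s\<close> comes from comparing \<open>1 / (1 - x)\<close> with
  \<open>exp (x / (1 - s))\<close> for \<open>x \<le> s\<close>.\<close>

lemma prod_lower: "exp (- (1 / (1 - s) / (1 - s))) \<le> (\<Prod>k<n. 1 - s ^ Suc k)"
proof -
  have "exp (- (1 / (1 - s) / (1 - s))) \<le> exp (\<Sum>k<n. - (s ^ Suc k / (1 - s)))"
    using divide_right_mono[OF sum_powers_le[of n], of "1 - s"] s
    by (simp add: sum_negf sum_divide_distrib)
  also have "\<dots> = (\<Prod>k<n. exp (- (s ^ Suc k / (1 - s))))" by (simp add: exp_sum)
  also have "\<dots> \<le> (\<Prod>k<n. 1 - s ^ Suc k)"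
  proof (intro prod_mono conjI)
    fix k
    define x where "x = s ^ Suc k"
    have x: "0 \<le> x" "x \<le> s" using s power_decreasing[of 1 "Suc k" s] by (auto simp: x_def)
    have "1 / (1 - x) = 1 + x / (1 - x)" using x s by (simp add: field_simps)
    also have "\<dots> \<le> 1 + x / (1 - s)" using x s by (intro add_left_mono divide_left_mono) auto
    also have "\<dots> \<le> exp (x / (1 - s))" by (rule exp_ge_add_one_self)
    finally show "exp (- (s ^ Suc k / (1 - s))) \<le> 1 - s ^ Suc k"
      unfolding x_def[symmetric] exp_minus using x s by (simp add: field_simps)
  qed simp
  finally show ?thesis .
qed

lemma a_power_upper: "p (a ^ n) \<le> exp (1 / (1 - s))"
proof -
  have E: "exp (1 / (1 - s)) \<ge> 1" using s by simp
  have "(p (a ^ n))\<^sup>2 \<le> exp (1 / (1 - s))"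
    using order_trans[OF T_upper prod_upper] by (simp only: p_cstar)
  also have "\<dots> \<le> (exp (1 / (1 - s)))\<^sup>2"
    using E by (intro self_le_power) auto
  finally show ?thesis by (rule power2_le_imp_le) simp
qed

lemma a_power_lower: "exp (- (1 / (1 - s) / (1 - s))) * p y \<le> exp (1 / (1 - s)) * p (a ^ n * y)"
proof -
  have "exp (- (1 / (1 - s) / (1 - s))) * p y \<le> (\<Prod>k<n. 1 - s ^ Suc k) * p y"
    by (intro mult_right_mono prod_lower p_nonneg)
  also have "\<dots> \<le> p (T n * y)" by (rule T_lower)
  also have "\<dots> \<le> p (adj (a ^ n)) * p (a ^ n * y)" unfolding mult.assoc by (rule p_mult)
  also have "\<dots> \<le> exp (1 / (1 - s)) * p (a ^ n * y)"
    unfolding p_adj by (intro mult_right_mono a_power_upper p_nonneg)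
  finally show ?thesis .
qed

text \<open>One constant serves for both directions, so that later estimates involve only
  \<open>M\<close>.\<close>

lemma a_power_bounds:
  obtains M where "M > 0" "\<And>n. p (a ^ n) \<le> M" "\<And>n y. p y \<le> M * p (a ^ n * y)"
proof -
  define E where "E = exp (1 / (1 - s))"
  define \<delta> where "\<delta> = exp (- (1 / (1 - s) / (1 - s)))"
  have pos: "E > 0" "\<delta> > 0" by (simp_all add: E_def \<delta>_def)
  have "p (a ^ n) \<le> E + E / \<delta>" for n
    using a_power_upper[of n, folded E_def] divide_pos_pos[OF pos] by linarith
  moreover have "p y \<le> (E + E / \<delta>) * p (a ^ n * y)" for n y
  proof -
    have "p y \<le> E / \<delta> * p (a ^ n * y)"
      using a_power_lower[of y n, folded E_def \<delta>_def] pos by (simp add: field_simps)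
    also have "\<dots> \<le> (E + E / \<delta>) * p (a ^ n * y)"
      using pos by (intro mult_right_mono p_nonneg) auto
    finally show ?thesis .
  qed
  moreover have "E + E / \<delta> > 0" using pos by (simp add: add_pos_pos)
  ultimately show thesis by (intro that)
qed

section \<open>Asymptotics of \<open>x * a ^ n\<close> for large \<open>n\<close>\<close>

definition a_grading :: "Uq2_gen \<Rightarrow> int" where
  "a_grading g = (if g = Gen_a then (if a = gen Gen_a then 1 else - 1) else 0)"

definition D_power :: "int \<Rightarrow> Uq2_gen star_poly" where
  "D_power l = (if 0 \<le> l then D ^ nat l else adj D ^ nat (- l))"

lemma gen_ne_adj_gen: "gen g \<noteq> adj (gen g')"
proof
  assume "gen g = adj (gen g')"
  then have "Poly_Mapping.lookup (gen g) (Word [Gen g]) = Poly_Mapping.lookup (adj (gen g')) (Word [Gen g])" by simp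
  then show False by (simp add: gen_def adj_single lookup_single)
qed

text \<open>The cases are phrased with the elements \<open>a\<close>, \<open>b\<close>,
  \<open>D\<close> of the locale. The sign in \<open>a_grading\<close> gives \<open>a\<close> degree
  1 even if it is the adjoint of the generator, so arguments by these cases treat both ranges of
  \<open>cmod q\<close> at once.\<close>

lemma letter_cases:
  obtains (gen_a) "mon (Word [l]) = a" "letter_degree a_grading l = 1" "letter_degree D_grading l = 0" "char_letter 1 l = 1"
  | (adj_a) "mon (Word [l]) = adj a" "letter_degree a_grading l = - 1" "letter_degree D_grading l = 0" "char_letter 1 l = 1"
  | (gen_b) "mon (Word [l]) = b" "letter_degree a_grading l = 0" "letter_degree D_grading l = 0" "char_letter 1 l = 0"
  | (adj_b) "mon (Word [l]) = adj b" "letter_degree a_grading l = 0" "letter_degree D_grading l = 0" "char_letter 1 l = 0"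
  | (gen_D) "mon (Word [l]) = D" "letter_degree a_grading l = 0" "letter_degree D_grading l = 1" "char_letter 1 l = 1"
  | (adj_D) "mon (Word [l]) = adj D" "letter_degree a_grading l = 0" "letter_degree D_grading l = - 1" "char_letter 1 l = 1"
proof (cases l)
  case (Gen g)
  have "mon (Word [l]) = gen g" by (simp add: Gen gen_def)
  then show thesis
    using that(1,2,3,5) a b D gen_ne_adj_gen[of Gen_a Gen_a] by (cases g) (auto simp: Gen a_grading_def)
next
  case (Adj g)
  have "mon (Word [l]) = adj (gen g)" by (simp add: Adj gen_def adj_single)
  then show thesis
    using that(1,2,4,6) a b D gen_ne_adj_gen[of Gen_a Gen_a] by (cases g) (auto simp: Adj a_grading_def)
qed

lemma D'a: "adj D * a \<doteq> a * adj D"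
  by (rule commute_adj_unitary[OF rel_DD' rel_D'D rel_aD])

lemma commute_power: "x * a \<doteq> scaled c (a * x) \<Longrightarrow> x * a ^ n \<doteq> scaled (c ^ n) (a ^ n * x)"
proof (induction n)
  case 0
  show ?case by (simp add: scaled_def)
next
  case (Suc n)
  have "x * a ^ Suc n = x * a * a ^ n" by (simp add: mult.assoc)
  also have "\<dots> \<doteq> scaled c (a * x) * a ^ n" by (intro eqv_mult_right Suc.prems)
  also have "\<dots> = scaled c a * (x * a ^ n)" by (simp add: scaled_simps mult.assoc)
  also have "\<dots> \<doteq> scaled c a * scaled (c ^ n) (a ^ n * x)" by (intro eqv_mult_left Suc)
  also have "\<dots> = scaled (c ^ Suc n) (a ^ Suc n * x)" by (simp add: scaled_simps mult_ac)
  finally show ?case .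
qed

text \<open>\<open>D_power l\<close> picks a representative of the integer power of the unitary
  \<open>D\<close>. Exponents add only modulo \<open>p\<close>, since \<open>D * adj D\<close> does
  not reduce in the free algebra.\<close>

lemma D_D_power: "D * D_power l \<doteq> D_power (l + 1)"
proof (cases "0 \<le> l")
  case True
  then show ?thesis by (simp add: D_power_def nat_add_distrib)
next
  case False
  define n where "n = nat (- l - 1)"
  have "nat (- l) = Suc n" using False by (simp add: n_def)
  then have "D * D_power l = D * adj D * adj D ^ n" using False by (simp add: D_power_def mult.assoc)
  also have "\<dots> \<doteq> 1 * adj D ^ n" by (intro eqv_mult_right rel_DD')
  also have "1 * adj D ^ n = D_power (l + 1)"
    using False by (cases "l = - 1") (auto simp: D_power_def n_def)
  finally show ?thesis .
qed

lemma D'_D_power: "adj D * D_power l \<doteq> D_power (l - 1)"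
proof (cases "l \<le> 0")
  case True
  then have "nat (- (l - 1)) = Suc (nat (- l))" by simp
  then have "adj D * D_power l = D_power (l - 1)" using True by (cases "l = 0") (simp_all add: D_power_def)
  then show ?thesis by simp
next
  case False
  then have "nat l = Suc (nat (l - 1))" by simp
  then have "adj D * D_power l = adj D * D * D ^ nat (l - 1)" using False by (simp add: D_power_def mult.assoc)
  also have "\<dots> \<doteq> 1 * D ^ nat (l - 1)" by (intro eqv_mult_right rel_D'D)
  also have "1 * D ^ nat (l - 1) = D_power (l - 1)" using False by (simp add: D_power_def)
  finally show ?thesis .
qed

lemma p_D_power_le: "p (D_power l) \<le> 1"
proof -
  have "(p D)\<^sup>2 = 1" using p_cstar[of D] eqv_p[OF rel_D'D] p_1 by simp
  then have "p D = 1" using p_nonneg[of D] by (simp add: power2_eq_1_iff)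
  then have "p (D ^ n) \<le> 1" "p (adj D ^ n) \<le> 1" for n
    using p_power[of D "n - 1"] p_power[of "adj D" "n - 1"] p_1 by (cases n; simp)+
  then show ?thesis by (simp add: D_power_def)
qed

lemma p_eqv_zero: "x \<doteq> y \<Longrightarrow> p (x - y) = 0"
  by (simp add: eqv_def)

text \<open>On \<open>a ^ m * D_power l\<close>, the letters \<open>a\<close>, \<open>D\<close> and
  \<open>adj D\<close> shift an exponent without error modulo \<open>p\<close>. The two
  \<open>b\<close> letters decay like \<open>cmod r ^ m\<close>, and \<open>adj a\<close> lowers the
  exponent up to a multiple of \<open>h * a ^ m\<close>, which decays like \<open>s ^ m\<close>. The
  character at 1 records which letters survive.\<close>

lemma letter_asymptotics:
  "(\<lambda>m. p (mon (Word [g]) * (a ^ m * D_power l)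
     - const (char_letter 1 g) * (a ^ nat (int m + letter_degree a_grading g) * D_power (l + letter_degree D_grading g)))) \<longlonglongrightarrow> 0"
proof -
  obtain M where M: "M > 0" "\<And>n. p (a ^ n) \<le> M" using a_power_bounds by metis
  have small: "(\<lambda>m. p (x * (a ^ m * D_power l))) \<longlonglongrightarrow> 0"
    if x: "x * a \<doteq> scaled c (a * x)" and c: "cmod c < 1" for x c
  proof -
    have "(\<lambda>m. cmod c ^ m * (M * p x)) \<longlonglongrightarrow> 0"
      using c by (intro tendsto_mult_left_zero LIMSEQ_power_zero) simp
    then show ?thesis
    proof (rule tendsto_zero_dominated)
      fix m
      have "p (x * (a ^ m * D_power l)) = p (scaled (c ^ m) (a ^ m * x) * D_power l)"
        using eqv_p[OF eqv_mult_right[OF commute_power[OF x]]] by (simp add: mult.assoc)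
      also have "\<dots> = cmod c ^ m * p (a ^ m * x * D_power l)"
        by (simp add: scaled_def mult.assoc p_scale norm_power)
      also have "p (a ^ m * x * D_power l) \<le> p (a ^ m) * p x * p (D_power l)"
        by (rule order_trans[OF p_mult]) (intro mult_right_mono p_mult p_nonneg)
      also have "\<dots> \<le> M * p x * 1"
        using M p_nonneg by (intro mult_mono p_D_power_le M) (auto intro!: mult_nonneg_nonneg less_imp_le)
      finally show "p (x * (a ^ m * D_power l)) \<le> cmod c ^ m * (M * p x)" by (simp add: mult_left_mono)
    qed
  qed
  have r: "cmod r < 1"
    using s unfolding s_eq by (simp add: power_less_one_iff)
  show ?thesis
  proof (cases g rule: letter_cases)
    case gen_a
    have "nat (int m + 1) = Suc m" for m by simp
    then show ?thesis by (simp add: gen_a mult.assoc)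
  next
    case gen_b
    have "b * a \<doteq> scaled r (a * b)" using rel_ba by (simp add: scaled_simps)
    then show ?thesis using small r by (simp add: gen_b)
  next
    case adj_b
    have "adj b * a \<doteq> scaled (cnj r) (a * adj b)" using b'a by (simp add: scaled_simps)
    then show ?thesis using small[of "adj b" "cnj r"] r by (simp add: adj_b)
  next
    case gen_D
    have "D * (a ^ m * D_power l) \<doteq> a ^ m * D_power (l + 1)" for m
    proof -
      have "D * a \<doteq> scaled 1 (a * D)" using eqv_sym[OF rel_aD] by (simp add: scaled_def)
      then have "D * a ^ m \<doteq> a ^ m * D" using commute_power[of D 1 m] by (simp add: scaled_def)
      then have "D * a ^ m * D_power l \<doteq> a ^ m * D * D_power l" by (rule eqv_mult_right)
      also have "\<dots> = a ^ m * (D * D_power l)" by (simp add: mult.assoc)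
      also have "\<dots> \<doteq> a ^ m * D_power (l + 1)" by (intro eqv_mult_left D_D_power)
      finally show ?thesis by (simp add: mult.assoc)
    qed
    then show ?thesis by (simp add: gen_D p_eqv_zero)
  next
    case adj_D
    have "adj D * (a ^ m * D_power l) \<doteq> a ^ m * D_power (l - 1)" for m
    proof -
      have "adj D * a \<doteq> scaled 1 (a * adj D)" using D'a by (simp add: scaled_def)
      then have "adj D * a ^ m \<doteq> a ^ m * adj D" using commute_power[of "adj D" 1 m] by (simp add: scaled_def)
      then have "adj D * a ^ m * D_power l \<doteq> a ^ m * adj D * D_power l" by (rule eqv_mult_right)
      also have "\<dots> = a ^ m * (adj D * D_power l)" by (simp add: mult.assoc)
      also have "\<dots> \<doteq> a ^ m * D_power (l - 1)" by (intro eqv_mult_left D'_D_power)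
      finally show ?thesis by (simp add: mult.assoc)
    qed
    then show ?thesis by (simp add: adj_D p_eqv_zero)
  next
    case adj_a
    have hl: "(\<lambda>m. p (const (of_real s) * h * (a ^ m * D_power l))) \<longlonglongrightarrow> 0"
    proof -
      have "h * a \<doteq> scaled (of_real s) (a * h)" using ha by (simp add: scaled_simps)
      then have "(\<lambda>m. p (h * (a ^ m * D_power l))) \<longlonglongrightarrow> 0" using small[of h "of_real s"] s by simp
      from tendsto_mult_right_zero[OF this, of s] show ?thesis using s by (simp add: p_scale mult.assoc)
    qed
    have "p (adj a * (a ^ Suc m * D_power l) - a ^ m * D_power l) = p (const (of_real s) * h * (a ^ m * D_power l))" for m
    proof -
      have "adj a * (a ^ Suc m * D_power l) - a ^ m * D_power l = adj a * a * (a ^ m * D_power l) - a ^ m * D_power l"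
        by (simp add: mult.assoc)
      also have "\<dots> \<doteq> (1 - const (of_real s) * h) * (a ^ m * D_power l) - a ^ m * D_power l"
        by (intro eqv_diff eqv_mult_right a'a eqv_refl)
      also have "\<dots> = - (const (of_real s) * h * (a ^ m * D_power l))" by (simp only: left_diff_distrib mult_1_left) simp
      finally show ?thesis using eqv_p p_uminus by metis
    qed
    then have "(\<lambda>m. p (adj a * (a ^ Suc m * D_power l) - a ^ m * D_power l)) \<longlonglongrightarrow> 0" using hl by (simp only:)
    then have "(\<lambda>m. p (adj a * (a ^ Suc m * D_power l) - a ^ nat (int (Suc m) - 1) * D_power l)) \<longlonglongrightarrow> 0" by simp
    \<comment> \<open>The term at \<open>m = 0\<close>, where \<open>nat\<close> truncates, does not
      affect the limit.\<close>
    then have "(\<lambda>m. p (adj a * (a ^ m * D_power l) - a ^ nat (int m - 1) * D_power l)) \<longlonglongrightarrow> 0"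
      by (rule LIMSEQ_imp_Suc)
    then show ?thesis by (simp add: adj_a)
  qed
qed

text \<open>Letters are prepended one at a time: the error of the tail is multiplied by the norm of
  the new letter, and its main term is handled by \<open>letter_asymptotics\<close> along the
  shifted index \<open>n + i\<close>.\<close>

lemma word_asymptotics:
  "(\<lambda>n. p (mon v * a ^ n - const (char_word 1 v) * (a ^ nat (int n + degree a_grading v) * D_power (degree D_grading v)))) \<longlonglongrightarrow> 0"
proof -
  have "(\<lambda>n. p (mon (Word u) * a ^ n - const (char_word 1 (Word u)) *
      (a ^ nat (int n + degree a_grading (Word u)) * D_power (degree D_grading (Word u))))) \<longlonglongrightarrow> 0" for u
  proof (induction u)
    case Nil
    have "mon (Word []) = (1 :: Uq2_gen star_poly)" by (metis single_one zero_word_def)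
    then show ?case by (simp add: D_power_def)
  next
    case (Cons g u)
    define i l c where "i = degree a_grading (Word u)" and "l = degree D_grading (Word u)"
      and "c = char_word 1 (Word u)"
    define f where "f m = mon (Word [g]) * (a ^ m * D_power l)
      - const (char_letter 1 g) * (a ^ nat (int m + letter_degree a_grading g) * D_power (l + letter_degree D_grading g))" for m
    let ?x = "\<lambda>n. mon (Word u) * a ^ n - const c * (a ^ nat (int n + i) * D_power l)"
    have "filterlim (\<lambda>n. nat (int n + i)) sequentially sequentially"
      unfolding filterlim_at_top
    proof
      fix Z show "\<forall>\<^sub>F n in sequentially. Z \<le> nat (int n + i)"
        using eventually_ge_at_top[of "Z + nat \<bar>i\<bar>"] by eventually_elim linarith
    qed
    moreover have "(\<lambda>m. p (f m)) \<longlonglongrightarrow> 0" unfolding f_def by (rule letter_asymptotics)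
    ultimately have "(\<lambda>n. p (f (nat (int n + i)))) \<longlonglongrightarrow> 0" by (rule filterlim_compose[rotated])
    then have "(\<lambda>n. p (mon (Word [g])) * p (?x n) + cmod c * p (f (nat (int n + i)))) \<longlonglongrightarrow> 0"
      using Cons.IH by (intro tendsto_add_zero tendsto_mult_right_zero) (simp_all add: i_def l_def c_def)
    then show ?case
    proof (rule Lim_null_comparison[rotated])
      \<comment> \<open>Exponents add correctly only when the intermediate exponent
        \<open>n + i\<close> is nonnegative, hence the restriction to large
        \<open>n\<close>.\<close>
      have ev: "\<forall>\<^sub>F n in sequentially. int n + i \<ge> 0"
        using eventually_ge_at_top[of "nat \<bar>i\<bar>"] by eventually_elim linarith
      then show "\<forall>\<^sub>F n in sequentially. norm (p (mon (Word (g # u)) * a ^ n - const (char_word 1 (Word (g # u))) *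
          (a ^ nat (int n + degree a_grading (Word (g # u))) * D_power (degree D_grading (Word (g # u))))))
        \<le> p (mon (Word [g])) * p (?x n) + cmod c * p (f (nat (int n + i)))"
      proof eventually_elim
        fix n assume n: "int n + i \<ge> 0"
        have ch: "char_word 1 (Word (g # u)) = char_letter 1 g * c" by (simp add: c_def)
        have da: "int n + degree a_grading (Word (g # u)) = int (nat (int n + i)) + letter_degree a_grading g"
          using n by (simp add: i_def)
        have dD: "degree D_grading (Word (g # u)) = l + letter_degree D_grading g" by (simp add: l_def)
        have mo: "mon (Word (g # u)) = mon (Word [g]) * mon (Word u)" by (simp add: mult_single)
        have eq: "mon (Word (g # u)) * a ^ n - const (char_word 1 (Word (g # u))) *
            (a ^ nat (int n + degree a_grading (Word (g # u))) * D_power (degree D_grading (Word (g # u))))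
          = mon (Word [g]) * ?x n + const c * f (nat (int n + i))"
          unfolding ch da dD mo f_def
          by (simp only: right_diff_distrib mult.assoc const_mult_left[of "mon (Word [g])"] mult.commute[of _ c] const_mult) simp
        have "p (mon (Word [g]) * ?x n + const c * f (nat (int n + i)))
          \<le> p (mon (Word [g])) * p (?x n) + cmod c * p (f (nat (int n + i)))"
          by (rule order_trans[OF p_triangle]) (intro add_mono p_mult, simp add: p_scale)
        then show "norm (p (mon (Word (g # u)) * a ^ n - const (char_word 1 (Word (g # u))) *
          (a ^ nat (int n + degree a_grading (Word (g # u))) * D_power (degree D_grading (Word (g # u))))))
          \<le> p (mon (Word [g])) * p (?x n) + cmod c * p (f (nat (int n + i)))"
          unfolding eq by (simp add: p_nonneg)
      qed
    qed
  qed
  then show ?thesis by (cases v) simp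
qed

text \<open>Homogeneity gives all words of \<open>x\<close> the same exponents \<open>i\<close> and
  \<open>l\<close>, so their coefficients combine linearly into
  \<open>character 1 x\<close>.\<close>

lemma homogeneous_asymptotics:
  assumes "homogeneous a_grading i x" "homogeneous D_grading l x"
  shows "(\<lambda>n. p (x * a ^ n - const (character 1 x) * (a ^ nat (int n + i) * D_power l))) \<longlonglongrightarrow> 0"
  using assms
proof (induction x rule: homogeneous_induct)
  case (mon v)
  then show ?case using word_asymptotics[of v] by (simp add: character_def linear_ext_single)
next
  case (add x y)
  show ?case
  proof (rule tendsto_zero_dominated[OF tendsto_add_zero[OF add]])
    fix n
    let ?z = "a ^ nat (int n + i) * D_power l"
    have "(x + y) * a ^ n - const (character 1 (x + y)) * ?z
      = (x * a ^ n - const (character 1 x) * ?z) + (y * a ^ n - const (character 1 y) * ?z)"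
      by (simp add: character_simps const_add distrib_right)
    then show "p ((x + y) * a ^ n - const (character 1 (x + y)) * ?z)
      \<le> p (x * a ^ n - const (character 1 x) * ?z) + p (y * a ^ n - const (character 1 y) * ?z)"
      by (simp only: p_triangle)
  qed
next
  case (scale c x)
  have "const c * x * a ^ n - const (character 1 (const c * x)) * (a ^ nat (int n + i) * D_power l)
    = const c * (x * a ^ n - const (character 1 x) * (a ^ nat (int n + i) * D_power l))" for n
    by (simp add: character_simps const_mult right_diff_distrib mult.assoc)
  then show ?case using tendsto_mult_right_zero[OF scale, of "cmod c"] by (simp add: p_scale)
qed (simp add: character_simps)

text \<open>For central \<open>x\<close> the asymptotics of \<open>x * a ^ n\<close> are those of \<open>a ^ n * x\<close>, and
  \<open>a ^ n\<close> is bounded below uniformly in \<open>n\<close>.\<close>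

lemma central_homogeneous_zero:
  assumes x: "cauchy x" "central x"
    and hom: "\<And>n. homogeneous a_grading 0 (x n)" "\<And>n. homogeneous D_grading l (x n)"
  shows "(\<lambda>n. p (x n - const (character 1 (x n)) * D_power l)) \<longlonglongrightarrow> 0"
proof -
  obtain M where M: "M > 0" "\<And>n. p (a ^ n) \<le> M" "\<And>n y. p y \<le> M * p (a ^ n * y)"
    using a_power_bounds by metis
  show ?thesis
  proof (rule LIMSEQ_I)
    fix \<epsilon> :: real assume e: "\<epsilon> > 0"
    \<comment> \<open>The final estimate is \<open>2 * M * M * \<delta>\<close>, which this choice
      makes half of \<open>\<epsilon>\<close>.\<close>
    define \<delta> where "\<delta> = \<epsilon> / (4 * M * M)"
    have d: "\<delta> > 0" using e M(1) by (simp add: \<delta>_def)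
    obtain k0 where k0: "\<And>m n. m \<ge> k0 \<Longrightarrow> n \<ge> k0 \<Longrightarrow> p (x m - x n) < \<delta>"
      using x(1) d unfolding cauchy_def by blast
    have "norm (p (x k - const (character 1 (x k)) * D_power l) - 0) < \<epsilon>" if k: "k \<ge> k0" for k
    proof -
      let ?y = "const (character 1 (x k)) * D_power l"
      \<comment> \<open>Here \<open>n\<close> and \<open>k\<close> are fixed and \<open>m\<close>
        grows. The element \<open>x k\<close> commutes with \<open>a ^ n\<close> only up to its
        distance from the later \<open>x m\<close>, but with a bound independent of
        \<open>n\<close>.\<close>
      have comm: "p (x k * a ^ n - a ^ n * x k) \<le> 2 * M * \<delta>" for n
      proof -
        have "(\<lambda>m. 2 * M * \<delta> + p (x m * a ^ n - a ^ n * x m)) \<longlonglongrightarrow> 2 * M * \<delta> + 0"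
          using x(2) by (intro tendsto_add tendsto_const) (simp add: central_def)
        moreover have "p (x k * a ^ n - a ^ n * x k) \<le> 2 * M * \<delta> + p (x m * a ^ n - a ^ n * x m)" if m: "m \<ge> k0" for m
        proof -
          have eq: "x k * a ^ n - a ^ n * x k
            = ((x k - x m) * a ^ n + a ^ n * (x m - x k)) + (x m * a ^ n - a ^ n * x m)"
            by (simp add: algebra_simps)
          have "p ((x k - x m) * a ^ n) \<le> \<delta> * M"
            by (rule order_trans[OF p_mult], intro mult_mono M(2) p_nonneg)
              (use k0[OF k m] d in \<open>auto simp: less_imp_le\<close>)
          moreover have "p (a ^ n * (x m - x k)) \<le> M * \<delta>"
            by (rule order_trans[OF p_mult], intro mult_mono M(2) p_nonneg)
              (use k0[OF m k] M(1) in \<open>auto simp: less_imp_le\<close>)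
          moreover have "p (x k * a ^ n - a ^ n * x k)
            \<le> (p ((x k - x m) * a ^ n) + p (a ^ n * (x m - x k))) + p (x m * a ^ n - a ^ n * x m)"
            unfolding eq by (rule order_trans[OF p_triangle]) (intro add_right_mono p_triangle)
          ultimately show ?thesis by (simp add: algebra_simps)
        qed
        ultimately have "p (x k * a ^ n - a ^ n * x k) \<le> 2 * M * \<delta> + 0"
          by (intro LIMSEQ_le_const) auto
        then show ?thesis by simp
      qed
      \<comment> \<open>Now \<open>n\<close> grows with \<open>k\<close> fixed; in the limit only
        the commutator bound is left.\<close>
      have "(\<lambda>n. M * (2 * M * \<delta> + p (x k * a ^ n - const (character 1 (x k)) * (a ^ nat (int n + 0) * D_power l))))
          \<longlonglongrightarrow> M * (2 * M * \<delta> + 0)"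
        by (intro tendsto_mult tendsto_add tendsto_const homogeneous_asymptotics hom)
      moreover have "p (x k - ?y) \<le> M * (2 * M * \<delta> + p (x k * a ^ n - const (character 1 (x k)) * (a ^ nat (int n + 0) * D_power l)))" for n
      proof -
        have eq: "a ^ n * (x k - ?y) = (a ^ n * x k - x k * a ^ n)
            + (x k * a ^ n - const (character 1 (x k)) * (a ^ nat (int n + 0) * D_power l))"
          by (simp add: right_diff_distrib const_mult_left)
        have "p (a ^ n * (x k - ?y)) \<le> p (a ^ n * x k - x k * a ^ n)
            + p (x k * a ^ n - const (character 1 (x k)) * (a ^ nat (int n + 0) * D_power l))"
          unfolding eq by (rule p_triangle)
        also have "p (a ^ n * x k - x k * a ^ n) \<le> 2 * M * \<delta>"
          using comm[of n] by (simp only: p_minus_commute)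
        finally have "M * p (a ^ n * (x k - ?y)) \<le> M * (2 * M * \<delta>
            + p (x k * a ^ n - const (character 1 (x k)) * (a ^ nat (int n + 0) * D_power l)))"
          using M(1) by (intro mult_left_mono) auto
        then show ?thesis using M(3)[of "x k - ?y" n] by linarith
      qed
      ultimately have "p (x k - ?y) \<le> M * (2 * M * \<delta> + 0)" using LIMSEQ_le_const by blast
      also have "\<dots> = \<epsilon> / 2" using M(1) by (simp add: \<delta>_def)
      finally show ?thesis using e p_nonneg[of "x k - ?y"] by simp
    qed
    then show "\<exists>N. \<forall>n\<ge>N. norm (p (x n - const (character 1 (x n)) * D_power l) - 0) < \<epsilon>" by blast
  qed
qed

section \<open>Commutation with \<open>b\<close> and homogeneous central elements\<close>

lemma r_nonzero: "r \<noteq> 0" and w_nonzero: "w \<noteq> 0" and cmod_r: "cmod r < 1"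
  using s w unfolding s_eq by (auto simp: power_less_one_iff)

lemma b_commute_inverse:
  assumes "x * b \<doteq> scaled c (b * x)" "c \<noteq> 0"
  shows "b * x \<doteq> scaled (inverse c) (x * b)"
proof -
  have "scaled (inverse c) (x * b) \<doteq> scaled (inverse c) (scaled c (b * x))"
    using eqv_mult_left[OF assms(1), of "const (inverse c)"] by (simp only: scaled_def)
  also have "\<dots> = b * x" using assms(2) by (simp only: scaled_simps) (simp add: scaled_def)
  finally show ?thesis by (rule eqv_sym)
qed

lemma b_commute_letter:
  "b * mon (Word [g]) \<doteq> scaled (r powi letter_degree a_grading g * w powi letter_degree D_grading g) (mon (Word [g]) * b)"
proof (cases g rule: letter_cases)
  case gen_a
  then show ?thesis using rel_ba by (simp add: scaled_simps)
next
  case adj_a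
  then show ?thesis using b_commute_inverse[of "adj a" r] rel_a'b r_nonzero
    by (simp add: scaled_simps power_int_minus)
next
  case gen_b
  then show ?thesis by (simp add: scaled_def)
next
  case adj_b
  then show ?thesis using rel_bb' by (simp add: scaled_def)
next
  case gen_D
  then show ?thesis using rel_bD by (simp add: scaled_simps)
next
  case adj_D
  have "adj D * b = adj D * (b * 1)" by simp
  also have "\<dots> \<doteq> adj D * (b * (D * adj D))" by (intro eqv_mult_left eqv_sym[OF rel_DD'])
  also have "\<dots> = adj D * (b * D) * adj D" by (simp only: mult.assoc)
  also have "\<dots> \<doteq> adj D * (const w * (D * b)) * adj D" by (intro eqv_mult_left eqv_mult_right rel_bD)
  also have "\<dots> = const w * (adj D * D * (b * adj D))" by (simp add: scaled_simps mult.assoc)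
  also have "\<dots> \<doteq> const w * (1 * (b * adj D))" by (intro eqv_mult_left eqv_mult_right rel_D'D)
  finally have "adj D * b \<doteq> scaled w (b * adj D)" by (simp add: scaled_simps)
  then show ?thesis using b_commute_inverse[of "adj D" w] w_nonzero adj_D by (simp add: power_int_minus)
qed

lemma b_commute_word:
  "b * mon v \<doteq> scaled (r powi degree a_grading v * w powi degree D_grading v) (mon v * b)"
proof -
  have "b * mon (Word u) \<doteq> scaled (r powi degree a_grading (Word u) * w powi degree D_grading (Word u)) (mon (Word u) * b)" for u
  proof (induction u)
    case Nil
    have "mon (Word []) = (1 :: Uq2_gen star_poly)" by (metis single_one zero_word_def)
    then show ?case by (simp add: scaled_def)
  next
    case (Cons g u)
    define c where "c = r powi letter_degree a_grading g * w powi letter_degree D_grading g"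
    define c' where "c' = r powi degree a_grading (Word u) * w powi degree D_grading (Word u)"
    have mo: "mon (Word (g # u)) = mon (Word [g]) * mon (Word u)" by (simp add: mult_single)
    have cc: "r powi degree a_grading (Word (g # u)) * w powi degree D_grading (Word (g # u)) = c * c'"
      using r_nonzero w_nonzero by (simp add: c_def c'_def power_int_add mult_ac)
    have "b * mon (Word (g # u)) = b * mon (Word [g]) * mon (Word u)" unfolding mo by (simp only: mult.assoc)
    also have "\<dots> \<doteq> scaled c (mon (Word [g]) * b) * mon (Word u)"
      unfolding c_def by (intro eqv_mult_right b_commute_letter)
    also have "\<dots> = scaled c (mon (Word [g])) * (b * mon (Word u))" by (simp only: scaled_simps mult.assoc)
    also have "\<dots> \<doteq> scaled c (mon (Word [g])) * scaled c' (mon (Word u) * b)"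
      using Cons unfolding c'_def by (intro eqv_mult_left)
    also have "\<dots> = scaled (c * c') (mon (Word (g # u)) * b)"
      unfolding mo by (simp only: scaled_simps mult.assoc) (simp only: mult.commute)
    finally show ?case by (simp only: cc)
  qed
  then show ?thesis by (cases v) simp
qed

lemma b_commute_homogeneous:
  assumes "homogeneous a_grading i x" "homogeneous D_grading l x"
  shows "b * x \<doteq> scaled (r powi i * w powi l) (x * b)"
  using assms
proof (induction x rule: homogeneous_induct)
  case (mon v)
  then show ?case using b_commute_word[of v] by simp
next
  case (add x y)
  have "b * (x + y) = b * x + b * y" by (rule distrib_left)
  also have "\<dots> \<doteq> scaled (r powi i * w powi l) (x * b) + scaled (r powi i * w powi l) (y * b)"
    using add by (rule eqv_add)
  also have "\<dots> = scaled (r powi i * w powi l) ((x + y) * b)"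
    by (simp only: scaled_def distrib_left distrib_right)
  finally show ?case .
next
  case (scale c x)
  have "b * (const c * x) = const c * (b * x)" by (rule const_mult_left)
  also have "\<dots> \<doteq> const c * scaled (r powi i * w powi l) (x * b)" using scale by (rule eqv_mult_left)
  also have "\<dots> = scaled (r powi i * w powi l) (const c * x * b)" by (simp only: scaled_simps mult.commute[of c])
  finally show ?case .
qed (simp add: scaled_def)

lemma central_homogeneous_null:
  assumes x: "cauchy x" "central x"
    and hom: "\<And>n. homogeneous a_grading i (x n)" "\<And>n. homogeneous D_grading l (x n)"
    and ne: "r powi i * w powi l \<noteq> 1"
  shows "(\<lambda>n. p (x n)) \<longlonglongrightarrow> 0"
proof -
  define \<mu> where "\<mu> = r powi i * w powi l"
  \<comment> \<open>\<open>z n\<close> has degree 0 in both gradings whatever the degrees of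
    \<open>x n\<close>, so \<open>central_homogeneous_zero\<close> identifies it asymptotically with
    a scalar.\<close>
  define z where "z n = adj (x n) * x n" for n
  obtain K where K: "K > 0" "\<And>n. p (x n) \<le> K" using cauchy_bounded x(1) by blast
  have eq: "p (x n * b - b * x n) = cmod (1 - \<mu>) * p (x n * b)" for n
  proof -
    have "x n * b - b * x n \<doteq> x n * b - scaled \<mu> (x n * b)"
      unfolding \<mu>_def by (intro eqv_diff eqv_refl b_commute_homogeneous hom)
    also have "\<dots> = const (1 - \<mu>) * (x n * b)"
      by (simp add: scaled_def left_diff_distrib const_diff)
    finally have "x n * b - b * x n \<doteq> const (1 - \<mu>) * (x n * b)" .
    from eqv_p[OF this] show ?thesis by (simp only: p_scale)
  qed
  have "(\<lambda>n. p (x n * b - b * x n)) \<longlonglongrightarrow> 0" using x(2) by (simp add: central_def)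
  then have "(\<lambda>n. cmod (1 - \<mu>) * p (x n * b)) \<longlonglongrightarrow> 0" by (simp only: eq)
  then have "(\<lambda>n. inverse (cmod (1 - \<mu>)) * (cmod (1 - \<mu>) * p (x n * b))) \<longlonglongrightarrow> 0"
    by (rule tendsto_mult_right_zero)
  moreover have "inverse (cmod (1 - \<mu>)) * (cmod (1 - \<mu>) * y) = y" for y
    using ne by (simp add: \<mu>_def)
  ultimately have xb: "(\<lambda>n. p (x n * b)) \<longlonglongrightarrow> 0" by (simp only:)
  have zb: "(\<lambda>n. p (z n * b)) \<longlonglongrightarrow> 0"
  proof (rule tendsto_zero_le[OF xb])
    fix n
    have "p (z n * b) \<le> p (adj (x n)) * p (x n * b)" unfolding z_def mult.assoc by (rule p_mult)
    also have "\<dots> \<le> K * p (x n * b)" unfolding p_adj by (intro mult_right_mono K p_nonneg)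
    finally show "p (z n * b) \<le> K * p (x n * b)" .
  qed
  have "homogeneous e 0 (z n)" if "homogeneous e j (x n)" for e j n
    using homogeneous_mult[OF homogeneous_adj[OF that] that] by (simp add: z_def)
  moreover have "cauchy z" "central z"
    unfolding z_def using x by (auto intro!: cauchy_mult cauchy_adj central_mult central_adj)
  ultimately have "(\<lambda>n. p (z n - const (character 1 (z n)) * D_power 0)) \<longlonglongrightarrow> 0"
    using hom by (intro central_homogeneous_zero) blast+
  then have zc: "(\<lambda>n. p (z n - const (character 1 (z n)))) \<longlonglongrightarrow> 0" by (simp add: D_power_def)
  have lim: "(\<lambda>n. inverse (p b) * (p (z n * b) + p (z n - const (character 1 (z n))) * p b)) \<longlonglongrightarrow> 0"
    by (intro tendsto_mult_right_zero tendsto_add_zero zb tendsto_mult_left_zero zc)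
  have le: "norm (cmod (character 1 (z n))) \<le> inverse (p b) * (p (z n * b) + p (z n - const (character 1 (z n))) * p b)" for n
  proof -
    let ?c = "const (character 1 (z n))"
    have "cmod (character 1 (z n)) * p b = p (?c * b)" by (simp add: p_scale)
    also have "\<dots> \<le> p (?c * b - z n * b) + p (z n * b)" using p_triangle[of "?c * b - z n * b" "z n * b"] by simp
    also have "p (?c * b - z n * b) \<le> p (z n - ?c) * p b"
      using p_mult[of "?c - z n" b] by (simp only: left_diff_distrib p_minus_commute[of ?c])
    finally have "cmod (character 1 (z n)) \<le> (p (z n * b) + p (z n - ?c) * p b) / p b"
      unfolding pos_le_divide_eq[OF b_pos] by linarith
    then show ?thesis by (simp only: divide_inverse mult.commute real_norm_def abs_norm_cancel)
  qed
  have c0: "(\<lambda>n. cmod (character 1 (z n))) \<longlonglongrightarrow> 0"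
    by (rule Lim_null_comparison[OF always_eventually lim]) (simp only: le simp_thms)
  have "(\<lambda>n. p (z n)) \<longlonglongrightarrow> 0"
  proof (rule tendsto_zero_dominated[OF tendsto_add_zero[OF zc c0]])
    show "p (z n) \<le> p (z n - const (character 1 (z n))) + cmod (character 1 (z n))" for n
      using p_triangle[of "z n - const (character 1 (z n))" "const (character 1 (z n))"] by (simp add: p_const)
  qed
  then have "(\<lambda>n. sqrt ((p (x n))\<^sup>2)) \<longlonglongrightarrow> sqrt 0" unfolding z_def p_cstar by (rule tendsto_real_sqrt)
  then show ?thesis by (simp add: p_nonneg)
qed

text \<open>Taking moduli removes \<open>w\<close>, and \<open>cmod r < 1\<close> leaves only the
  exponent 0. Hence nonzero degrees in \<open>a\<close> are excluded for every \<open>w\<close>;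
  only the degrees in \<open>D\<close> distinguish the two parts of the theorem.\<close>

lemma weight_one_imp: "r powi i * w powi l = 1 \<Longrightarrow> i = 0"
proof -
  assume "r powi i * w powi l = 1"
  then have "cmod (r powi i * w powi l) = 1" by (simp only: norm_one)
  then have "cmod r powi i = 1" by (simp only: norm_mult norm_power_int w power_int_1_left mult_1_right)
  then have "cmod r ^ nat \<bar>i\<bar> = 1"
    by (cases "0 \<le> i") (auto simp: power_int_def power_inverse)
  then show "i = 0"
    using cmod_r power_less_one_iff[of "cmod r" "nat \<bar>i\<bar>"] by force
qed

section \<open>General central elements, recovered from their components\<close>

lemma a_component_null:
  assumes x: "cauchy x" "central x" and i: "i \<noteq> 0"
  shows "(\<lambda>n. p (component a_grading i (x n))) \<longlonglongrightarrow> 0"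
proof (rule null_if_components_null[where e = D_grading])
  show "cauchy (\<lambda>n. component a_grading i (x n))" by (intro cauchy_component x)
  show "(\<lambda>n. p (component D_grading l (component a_grading i (x n)))) \<longlonglongrightarrow> 0" for l
  proof (rule central_homogeneous_null[where i = i and l = l])
    show "r powi i * w powi l \<noteq> 1" using weight_one_imp i by blast
  qed (simp_all add: cauchy_component central_component x)
qed

lemma p_const_diff: "p (const c - const d) = cmod (c - d)"
  by (simp only: p_const flip: const_diff)

lemma component_component:
  "component e i (component e j x) = (if i = j then component e i x else 0)"
  by (rule poly_mapping_eqI) (auto simp: component_def)

lemma central_approx_a_component:
  assumes x: "cauchy x" "central x"
  shows "(\<lambda>n. p (x n - component a_grading 0 (x n))) \<longlonglongrightarrow> 0"
proof (rule null_if_components_null[where e = a_grading])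
  show "cauchy (\<lambda>n. x n - component a_grading 0 (x n))" by (intro cauchy_diff cauchy_component x)
  show "(\<lambda>n. p (component a_grading i (x n - component a_grading 0 (x n)))) \<longlonglongrightarrow> 0" for i
    using a_component_null[OF x, of i] by (cases "i = 0") (simp_all add: component_diff component_component)
qed

lemma central_component_D_power:
  assumes x: "cauchy x" "central x"
  shows "(\<lambda>n. p (component D_grading l (component a_grading 0 (x n))
    - const (character 1 (component D_grading l (component a_grading 0 (x n)))) * D_power l)) \<longlonglongrightarrow> 0"
  by (rule central_homogeneous_zero) (simp_all add: cauchy_component central_component x)

theorem central_scalar:
  assumes x: "cauchy x" "central x" and irr: "\<And>l. l \<noteq> 0 \<Longrightarrow> w powi l \<noteq> 1"
  obtains c where "(\<lambda>n. p (x n - const c)) \<longlonglongrightarrow> 0"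
proof -
  define y where "y n = component a_grading 0 (x n)" for n
  define c where "c n = character 1 (component D_grading 0 (y n))" for n
  have y: "cauchy y" "central y" unfolding y_def by (intro cauchy_component central_component x)+
  have "(\<lambda>n. p (y n - component D_grading 0 (y n))) \<longlonglongrightarrow> 0"
  proof (rule null_if_components_null[where e = D_grading])
    show "cauchy (\<lambda>n. y n - component D_grading 0 (y n))" by (intro cauchy_diff cauchy_component y)
    show "(\<lambda>n. p (component D_grading l (y n - component D_grading 0 (y n)))) \<longlonglongrightarrow> 0" for l
    proof (cases "l = 0")
      case False
      have "(\<lambda>n. p (component D_grading l (y n))) \<longlonglongrightarrow> 0"
        using irr[OF False]
        by (intro central_homogeneous_null[where i = 0 and l = l])
          (simp_all add: cauchy_component central_component y, simp add: y_def)
      then show ?thesis using False by (simp add: component_diff component_component)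
    qed (simp add: component_diff component_component)
  qed
  moreover have "(\<lambda>n. p (component D_grading 0 (y n) - const (c n))) \<longlonglongrightarrow> 0"
    using central_component_D_power[OF x, of 0] by (simp add: y_def c_def D_power_def)
  moreover have "(\<lambda>n. p (x n - y n)) \<longlonglongrightarrow> 0"
    unfolding y_def by (rule central_approx_a_component[OF x])
  ultimately have "(\<lambda>n. (p (x n - y n) + p (y n - component D_grading 0 (y n))) + p (component D_grading 0 (y n) - const (c n))) \<longlonglongrightarrow> 0"
    by (intro tendsto_add_zero)
  then have xc: "(\<lambda>n. p (x n - const (c n))) \<longlonglongrightarrow> 0"
  proof (rule tendsto_zero_dominated)
    show "p (x n - const (c n)) \<le> (p (x n - y n) + p (y n - component D_grading 0 (y n))) + p (component D_grading 0 (y n) - const (c n))" for n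
      using p_triangle_diff[of "x n" "const (c n)" "component D_grading 0 (y n)"]
        p_triangle_diff[of "x n" "component D_grading 0 (y n)" "y n"] by linarith
  qed
  \<comment> \<open>Scalars are embedded isometrically because \<open>p 1 = 1\<close>, so the
    approximating scalars converge themselves.\<close>
  have "Cauchy c"
  proof (rule CauchyI)
    fix \<epsilon> :: real assume "\<epsilon> > 0"
    moreover have "cauchy (\<lambda>n. const (c n))"
    proof -
      have "(\<lambda>n. x n - const (c n)) \<in> NI" using xc by (simp only: null_iff)
      from cauchy_diff[OF x(1) null_cauchy[OF this]] show ?thesis by simp
    qed
    ultimately obtain N where "\<forall>m\<ge>N. \<forall>n\<ge>N. p (const (c m) - const (c n)) < \<epsilon>"
      unfolding cauchy_def by blast
    then show "\<exists>N. \<forall>m\<ge>N. \<forall>n\<ge>N. norm (c m - c n) < \<epsilon>" unfolding p_const_diff by blast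
  qed
  then obtain c' where c': "c \<longlonglongrightarrow> c'" by (metis Cauchy_convergent convergent_def)
  have "(\<lambda>n. p (x n - const (c n)) + cmod (c n - c')) \<longlonglongrightarrow> 0"
    using c' by (intro tendsto_add_zero xc) (simp add: LIM_zero tendsto_norm_zero)
  then have "(\<lambda>n. p (x n - const c')) \<longlonglongrightarrow> 0"
  proof (rule tendsto_zero_dominated)
    fix n
    show "p (x n - const c') \<le> p (x n - const (c n)) + cmod (c n - c')"
      using p_triangle_diff[of "x n" "const c'" "const (c n)"] by (simp only: p_const_diff)
  qed
  then show thesis by (rule that)
qed

text \<open>The estimate of a Fourier coefficient by the supremum over the circle: the averaging
  argument is applied to the modulus of \<open>character 1\<close>, whose values on the gauge orbit
  of \<open>x\<close> are the numbers \<open>character t x\<close>.\<close>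

lemma character_component_bound:
  assumes "\<And>t. cmod t = 1 \<Longrightarrow> cmod (character t x) \<le> K"
  shows "cmod (character 1 (component D_grading l x)) \<le> K"
proof -
  interpret g: gauge_bounded "\<lambda>y. cmod (character 1 y)" D_grading x K
  proof
    show "cmod (character 1 (y + z)) \<le> cmod (character 1 y) + cmod (character 1 z)" for y z
      unfolding character_simps by (rule norm_triangle_ineq)
    show "cmod (character 1 (const c * y)) = cmod c * cmod (character 1 y)" for c y
      unfolding character_simps by (rule norm_mult)
    show "cmod (character 1 (gauge D_grading t x)) \<le> K" if "cmod t = 1" for t
      using assms[OF that] unfolding character_gauge[OF that] .
  qed
  show ?thesis by (rule g.component_bound)
qed

text \<open>Each component is asymptotically a Fourier coefficient times a power of
  \<open>D\<close>, and these coefficients are controlled by the supremum over the circle. This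
  gives injectivity of the map from the center to the functions on the circle.\<close>

theorem central_null_if_characters_null:
  assumes x: "cauchy x" "central x"
    and ch: "\<And>\<epsilon>. \<epsilon> > 0 \<Longrightarrow> \<exists>N. \<forall>n\<ge>N. \<forall>t. cmod t = 1 \<longrightarrow> cmod (character t (x n)) \<le> \<epsilon>"
  shows "(\<lambda>n. p (x n)) \<longlonglongrightarrow> 0"
proof -
  define y where "y n = component a_grading 0 (x n)" for n
  have xy: "(\<lambda>n. p (x n - y n)) \<longlonglongrightarrow> 0"
    unfolding y_def by (rule central_approx_a_component[OF x])
  have "(\<lambda>n. p (y n)) \<longlonglongrightarrow> 0"
  proof (rule null_if_components_null[where e = D_grading])
    show "cauchy y" unfolding y_def by (intro cauchy_component x)
    fix l
    have "(\<lambda>n. cmod (character 1 (component D_grading l (y n)))) \<longlonglongrightarrow> 0"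
    proof (rule LIMSEQ_I)
      fix \<epsilon> :: real assume e: "\<epsilon> > 0"
      obtain N where N: "\<And>n t. n \<ge> N \<Longrightarrow> cmod t = 1 \<Longrightarrow> cmod (character t (x n)) \<le> \<epsilon> / 4"
        using ch[of "\<epsilon> / 4"] e by auto
      obtain M where M: "\<And>n. n \<ge> M \<Longrightarrow> p (x n - y n) < \<epsilon> / 4"
        using LIMSEQ_D[OF xy, of "\<epsilon> / 4"] e p_nonneg by fastforce
      have "cmod (character 1 (component D_grading l (y n))) \<le> \<epsilon> / 2" if n: "n \<ge> max M N" for n
      proof (rule character_component_bound)
        fix t :: complex assume t: "cmod t = 1"
        have "character t (y n) = character t (x n) - character t (x n - y n)" by (simp add: character_simps)
        then have "cmod (character t (y n)) \<le> cmod (character t (x n)) + cmod (character t (x n - y n))"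
          by (simp only: norm_triangle_ineq4)
        also have "\<dots> \<le> \<epsilon> / 4 + \<epsilon> / 4"
          using N[of n t] M[of n] n t character_bound[OF t, of "x n - y n"] by (intro add_mono) auto
        finally show "cmod (character t (y n)) \<le> \<epsilon> / 2" by simp
      qed
      then show "\<exists>N. \<forall>n\<ge>N. norm (cmod (character 1 (component D_grading l (y n))) - 0) < \<epsilon>"
        using e by (intro exI[of _ "max M N"]) fastforce
    qed
    moreover have "(\<lambda>n. p (component D_grading l (y n) - const (character 1 (component D_grading l (y n))) * D_power l)) \<longlonglongrightarrow> 0"
      unfolding y_def by (rule central_component_D_power[OF x])
    ultimately have "(\<lambda>n. p (component D_grading l (y n) - const (character 1 (component D_grading l (y n))) * D_power l)
        + cmod (character 1 (component D_grading l (y n)))) \<longlonglongrightarrow> 0" by (intro tendsto_add_zero)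
    then show "(\<lambda>n. p (component D_grading l (y n))) \<longlonglongrightarrow> 0"
    proof (rule tendsto_zero_dominated)
      fix n
      let ?u = "component D_grading l (y n)" and ?v = "const (character 1 (component D_grading l (y n))) * D_power l"
      have "p ?v \<le> cmod (character 1 ?u) * 1"
        unfolding p_scale by (intro mult_left_mono p_D_power_le) simp
      then show "p ?u \<le> p (?u - ?v) + cmod (character 1 ?u)"
        using p_triangle[of "?u - ?v" ?v] by simp
    qed
  qed
  from tendsto_add_zero[OF xy this] show ?thesis
  proof (rule tendsto_zero_dominated)
    show "p (x n) \<le> p (x n - y n) + p (y n)" for n using p_triangle[of "x n - y n" "y n"] by simp
  qed
qed

end

section \<open>Polynomials in the unitary generator\<close>

text \<open>For \<open>\<rho> > 1\<close> geometric growth exceeds linear growth already along the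
  exponents \<open>2 ^ k\<close>, the ones supplied by \<open>p_power_selfadjoint\<close>.\<close>

lemma linear_growth_bound:
  fixes \<rho> A B :: real
  assumes "\<And>k::nat. \<rho> ^ (2 ^ k) \<le> A * 2 ^ k + B" "0 \<le> \<rho>"
  shows "\<rho> \<le> 1"
proof (rule ccontr)
  assume "\<not> \<rho> \<le> 1"
  then have \<rho>: "\<rho> > 1" by simp
  have sub: "strict_mono (\<lambda>k. 2 ^ k :: nat)" by (simp add: strict_mono_def)
  have "(\<lambda>n. of_nat n * inverse \<rho> ^ n) \<longlonglongrightarrow> 0"
    using \<rho> by (intro powser_times_n_limit_0) (simp add: inverse_less_1_iff)
  moreover have "(\<lambda>n. inverse \<rho> ^ n) \<longlonglongrightarrow> 0"
    using \<rho> by (intro LIMSEQ_power_zero) (simp add: inverse_less_1_iff)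
  ultimately have "(\<lambda>n. A * (of_nat n * inverse \<rho> ^ n) + B * inverse \<rho> ^ n) \<longlonglongrightarrow> A * 0 + B * 0"
    by (intro tendsto_add tendsto_mult tendsto_const)
  from LIMSEQ_subseq_LIMSEQ[OF this sub]
  have "(\<lambda>k. A * (of_nat (2 ^ k) * inverse \<rho> ^ (2 ^ k)) + B * inverse \<rho> ^ (2 ^ k)) \<longlonglongrightarrow> 0"
    by (simp add: o_def)
  moreover have "1 \<le> A * (of_nat (2 ^ k) * inverse \<rho> ^ (2 ^ k)) + B * inverse \<rho> ^ (2 ^ k)" for k
  proof -
    have "inverse \<rho> ^ (2 ^ k) * \<rho> ^ (2 ^ k) \<le> inverse \<rho> ^ (2 ^ k) * (A * 2 ^ k + B)"
      using \<rho> by (intro mult_left_mono assms) simp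
    moreover have "inverse \<rho> ^ (2 ^ k) * \<rho> ^ (2 ^ k) = 1"
      using \<rho> by (simp flip: power_mult_distrib)
    ultimately show ?thesis by (simp add: algebra_simps)
  qed
  ultimately have "1 \<le> (0::real)" using LIMSEQ_le_const by blast
  then show False by simp
qed

section \<open>Words in \<open>D\<close> and the functions on the circle that they represent\<close>

fun D_word :: "Uq2_gen word \<Rightarrow> bool" where
  "D_word (Word u) \<longleftrightarrow> set u \<subseteq> {Gen Gen_D, Adj Gen_D}"

definition D_poly :: "Uq2_gen star_poly \<Rightarrow> bool" where
  "D_poly x \<longleftrightarrow> (\<forall>v\<in>Poly_Mapping.keys x. D_word v)"

lemma D_word_plus: "D_word (v + v') \<longleftrightarrow> D_word v \<and> D_word v'"
  by (cases v; cases v') auto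

lemma D_word_adj: "D_word v \<Longrightarrow> D_word (adj_word v)"
proof -
  have "set u \<subseteq> {Gen Gen_D, Adj Gen_D} \<Longrightarrow> set (rev (map adj_letter u)) \<subseteq> {Gen Gen_D, Adj Gen_D}" for u
    by (induction u) auto
  then show "D_word v \<Longrightarrow> D_word (adj_word v)" by (cases v) simp
qed

lemma D_poly_intros:
  "D_poly (const c)" "D_poly (gen Gen_D)"
  "D_poly x \<Longrightarrow> D_poly y \<Longrightarrow> D_poly (x + y)"
  "D_poly x \<Longrightarrow> D_poly y \<Longrightarrow> D_poly (x * y)"
  "D_poly x \<Longrightarrow> D_poly (adj x)"
proof -
  show "D_poly (const c)" "D_poly (gen Gen_D)"
    by (simp_all add: D_poly_def const_def gen_def zero_word_def)
  show "D_poly x \<Longrightarrow> D_poly y \<Longrightarrow> D_poly (x + y)"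
    unfolding D_poly_def using Poly_Mapping.keys_add[of x y] by blast
  show "D_poly (x * y)" if "D_poly x" "D_poly y"
    unfolding D_poly_def
  proof
    fix v assume "v \<in> Poly_Mapping.keys (x * y)"
    then obtain v1 v2 where "v = v1 + v2" "v1 \<in> Poly_Mapping.keys x" "v2 \<in> Poly_Mapping.keys y"
      using keys_mult[of x y] by blast
    then show "D_word v" using that by (simp add: D_poly_def D_word_plus)
  qed
  show "D_poly (adj x)" if "D_poly x"
    unfolding D_poly_def
  proof
    fix v assume "v \<in> Poly_Mapping.keys (adj x)"
    then have "adj_word v \<in> Poly_Mapping.keys x" by (simp add: in_keys_iff lookup_adj)
    then show "D_word v" using that D_word_adj[of "adj_word v"] by (simp add: D_poly_def)
  qed
qed

lemma D_poly_diff: "D_poly x \<Longrightarrow> D_poly y \<Longrightarrow> D_poly (x - y)"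
  using D_poly_intros(3)[OF _ D_poly_intros(4)[OF D_poly_intros(1)], of x y "-1"] by (simp add: const_uminus)

definition degree_le :: "('g \<Rightarrow> int) \<Rightarrow> nat \<Rightarrow> 'g star_poly \<Rightarrow> bool" where
  "degree_le e L x \<longleftrightarrow> (\<forall>v\<in>Poly_Mapping.keys x. \<bar>degree e v\<bar> \<le> int L)"

lemma degree_le_mult:
  assumes "degree_le e L x" "degree_le e M y"
  shows "degree_le e (L + M) (x * y)"
  unfolding degree_le_def
proof
  fix v assume "v \<in> Poly_Mapping.keys (x * y)"
  then obtain v1 v2 where "v = v1 + v2" "v1 \<in> Poly_Mapping.keys x" "v2 \<in> Poly_Mapping.keys y"
    using keys_mult[of x y] by blast
  moreover from this have "\<bar>degree e v1\<bar> \<le> int L" "\<bar>degree e v2\<bar> \<le> int M" using assms by (auto simp: degree_le_def)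
  ultimately show "\<bar>degree e v\<bar> \<le> int (L + M)" by simp
qed

lemma degree_le_adj: "degree_le e L x \<Longrightarrow> degree_le e L (adj x)"
  unfolding degree_le_def
proof
  fix v assume x: "\<forall>v\<in>Poly_Mapping.keys x. \<bar>degree e v\<bar> \<le> int L" and "v \<in> Poly_Mapping.keys (adj x)"
  then have "adj_word v \<in> Poly_Mapping.keys x" by (simp add: in_keys_iff lookup_adj)
  then show "\<bar>degree e v\<bar> \<le> int L" using x by fastforce
qed

lemma degree_le_power: "degree_le e L x \<Longrightarrow> degree_le e (n * L) (x ^ n)"
proof (induction n)
  case 0
  then show ?case by (simp add: degree_le_def)
next
  case (Suc n)
  then show ?case using degree_le_mult[of e L x "n * L" "x ^ n"] by simp
qed

lemma D_poly_power: "D_poly x \<Longrightarrow> D_poly (x ^ n)"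
  by (induction n) (simp_all add: D_poly_intros D_poly_intros(1)[of 1, unfolded const_1])

lemma character_power: "character t (x ^ n) = character t x ^ n"
  by (induction n) (simp_all add: character_simps)

lemma real_polynomial_is_character:
  assumes "real_polynomial_function g"
  shows "\<exists>x. D_poly x \<and> (\<forall>t. cmod t = 1 \<longrightarrow> character t x = of_real (g t))"
  using assms
proof induction
  case (linear g)
  let ?D = "gen Gen_D :: Uq2_gen star_poly"
  \<comment> \<open>A real linear functional on the plane is
    \<open>Re t * g 1 + Im t * g \<i>\<close>, and \<open>D + adj D\<close> and
    \<open>D - adj D\<close> have the character values \<open>2 * Re t\<close> and
    \<open>2 * \<i> * Im t\<close>.\<close>
  define x where "x = const (of_real (g 1) / 2) * (?D + adj ?D) + const (- \<i> * of_real (g \<i>) / 2) * (?D + const (- 1) * adj ?D)"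
  have "D_poly x" unfolding x_def by (intro D_poly_intros)
  moreover have "character t x = of_real (g t)" for t
  proof -
    have "t = Re t *\<^sub>R 1 + Im t *\<^sub>R \<i>" by (simp add: complex_eq_iff)
    then have "g t = g (Re t *\<^sub>R 1 + Im t *\<^sub>R \<i>)" by (rule arg_cong)
    also have "\<dots> = Re t * g 1 + Im t * g \<i>"
      using linear by (simp add: linear_simps)
    finally have g: "g t = Re t * g 1 + Im t * g \<i>" .
    have 1: "t + cnj t = 2 * of_real (Re t)" by (simp add: complex_eq_iff)
    have 2: "t - cnj t = 2 * \<i> * of_real (Im t)" by (simp add: complex_eq_iff)
    have "character t x = of_real (g 1) / 2 * (t + cnj t) + - \<i> * of_real (g \<i>) / 2 * (t - cnj t)"
      by (simp add: x_def character_simps)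
    also have "\<dots> = of_real (g t)" unfolding 1 2 g by (simp add: complex_eq_iff)
    finally show ?thesis .
  qed
  ultimately show ?case by blast
next
  case (const c)
  have "D_poly (Defs.const (of_real c))" by (rule D_poly_intros)
  then show ?case by (intro exI[of _ "Defs.const (of_real c)"]) (simp add: character_simps)
next
  case (add f g)
  then obtain x y where "D_poly x" "D_poly y"
    "\<forall>t. cmod t = 1 \<longrightarrow> character t x = of_real (f t)" "\<forall>t. cmod t = 1 \<longrightarrow> character t y = of_real (g t)" by blast
  then show ?case by (intro exI[of _ "x + y"]) (simp add: D_poly_intros character_simps)
next
  case (mult f g)
  then obtain x y where "D_poly x" "D_poly y"
    "\<forall>t. cmod t = 1 \<longrightarrow> character t x = of_real (f t)" "\<forall>t. cmod t = 1 \<longrightarrow> character t y = of_real (g t)" by blast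
  then show ?case by (intro exI[of _ "x * y"]) (simp add: D_poly_intros character_simps)
qed

text \<open>Stone-Weierstrass is applied to the real and the imaginary part separately, each within
  \<open>e / 2\<close>; the modulus of the error is at most the sum of the two.\<close>

lemma continuous_approx_character:
  fixes f :: "complex \<Rightarrow> complex"
  assumes f: "continuous_on (sphere 0 1) f" and e: "e > 0"
  shows "\<exists>x. D_poly x \<and> (\<forall>t. cmod t = 1 \<longrightarrow> cmod (character t x - f t) \<le> e)"
proof -
  have S: "compact (sphere (0::complex) 1)" by simp
  have e2: "e / 2 > 0" using e by simp
  obtain g where g: "real_polynomial_function g" "\<And>t. t \<in> sphere 0 1 \<Longrightarrow> \<bar>Re (f t) - g t\<bar> < e / 2"
    using Stone_Weierstrass_real_polynomial_function[OF S continuous_on_Re[OF f] e2] by blast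
  obtain g' where g': "real_polynomial_function g'" "\<And>t. t \<in> sphere 0 1 \<Longrightarrow> \<bar>Im (f t) - g' t\<bar> < e / 2"
    using Stone_Weierstrass_real_polynomial_function[OF S continuous_on_Im[OF f] e2] by blast
  obtain x where x: "D_poly x" "\<And>t. cmod t = 1 \<Longrightarrow> character t x = of_real (g t)"
    using real_polynomial_is_character[OF g(1)] by blast
  obtain y where y: "D_poly y" "\<And>t. cmod t = 1 \<Longrightarrow> character t y = of_real (g' t)"
    using real_polynomial_is_character[OF g'(1)] by blast
  have "D_poly (x + const \<i> * y)" by (intro D_poly_intros x y)
  moreover have "cmod (character t (x + const \<i> * y) - f t) \<le> e" if t: "cmod t = 1" for t
  proof -
    let ?z = "character t (x + const \<i> * y) - f t"
    have "Re ?z = g t - Re (f t)" "Im ?z = g' t - Im (f t)"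
      by (simp_all add: character_simps x(2)[OF t] y(2)[OF t])
    then show ?thesis using cmod_le[of ?z] g(2)[of t] g'(2)[of t] t
      by (simp add: abs_minus_commute[of "g t"] abs_minus_commute[of "g' t"])
  qed
  ultimately show ?thesis by blast
qed

section \<open>Norm and centrality of polynomials in \<open>D\<close>\<close>

context quantum_U2 begin

lemma D_word_eqv: "D_word v \<Longrightarrow> mon v \<doteq> D_power (degree D_grading v)"
  and char_D_word: "D_word v \<Longrightarrow> char_word 1 v = 1"
proof -
  have "mon (Word u) \<doteq> D_power (degree D_grading (Word u)) \<and> char_word 1 (Word u) = 1"
    if "set u \<subseteq> {Gen Gen_D, Adj Gen_D}" for u
    using that
  proof (induction u)
    case Nil
    have "mon (Word []) = (1 :: Uq2_gen star_poly)" by (metis single_one zero_word_def)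
    then show ?case by (simp add: D_power_def)
  next
    case (Cons g u)
    have mo: "mon (Word (g # u)) = mon (Word [g]) * mon (Word u)" by (simp add: mult_single)
    consider "g = Gen Gen_D" | "g = Adj Gen_D" using Cons.prems by auto
    then show ?case
    proof cases
      case 1
      have "mon (Word [g]) = D" by (simp add: 1 D gen_def)
      then have "mon (Word (g # u)) = D * mon (Word u)" by (simp only: mo)
      also have "\<dots> \<doteq> D * D_power (degree D_grading (Word u))" using Cons by (intro eqv_mult_left) auto
      also have "\<dots> \<doteq> D_power (degree D_grading (Word u) + 1)" by (rule D_D_power)
      finally show ?thesis using Cons by (simp add: 1 add.commute)
    next
      case 2
      have "mon (Word [g]) = adj D" by (simp add: 2 D gen_def adj_single)
      then have "mon (Word (g # u)) = adj D * mon (Word u)" by (simp only: mo)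
      also have "\<dots> \<doteq> adj D * D_power (degree D_grading (Word u))" using Cons by (intro eqv_mult_left) auto
      also have "\<dots> \<doteq> D_power (degree D_grading (Word u) - 1)" by (rule D'_D_power)
      finally show ?thesis using Cons by (simp add: 2 add.commute)
    qed
  qed
  then show "D_word v \<Longrightarrow> mon v \<doteq> D_power (degree D_grading v)" "D_word v \<Longrightarrow> char_word 1 v = 1"
    by (cases v; simp)+
qed

text \<open>All words in \<open>D\<close> and \<open>adj D\<close> of degree \<open>l\<close>
  represent the same power of \<open>D\<close>, and \<open>character 1\<close> adds up their
  coefficients.\<close>

lemma D_poly_component:
  assumes "D_poly x"
  shows "component D_grading l x \<doteq> const (character 1 (component D_grading l x)) * D_power l"
proof -
  show ?thesis
    using assms unfolding D_poly_def
  proof (induction x rule: star_poly_keys_induct)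
    case (mon v)
    have "component D_grading l (mon v) = (if degree D_grading v = l then mon v else 0)"
      by (simp add: component_def weight_single)
    moreover have "character 1 (mon v) = 1" using mon by (simp add: character_def linear_ext_single char_D_word)
    ultimately show ?case using D_word_eqv[OF mon] by (auto simp: character_simps)
  next
    case (add x y)
    show ?case using eqv_add[OF add] by (simp add: component_add character_simps const_add distrib_right)
  next
    case (scale c x)
    have "component D_grading l (const c * x) = const c * component D_grading l x"
      by (simp add: component_def weight_const_mult)
    then show ?case
      using eqv_mult_left[OF scale, of "const c"] by (simp add: character_simps const_mult mult.assoc)
  qed (simp add: component_def character_simps)
qed

text \<open>There are \<open>2 * L + 1\<close> possible degrees, and each component is a Fourier
  coefficient times an element of norm at most 1. The factor is crude but depends on the degree
  alone.\<close>

lemma D_poly_bound_weak: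
  assumes x: "D_poly x" "degree_le D_grading L x"
    and K: "\<And>t. cmod t = 1 \<Longrightarrow> cmod (character t x) \<le> K"
  shows "p x \<le> (2 * real L + 1) * K"
proof -
  have "x = (\<Sum>l\<in>{- int L..int L}. component D_grading l x)"
  proof (rule poly_mapping_eqI)
    fix v
    have "Poly_Mapping.lookup (\<Sum>l\<in>{- int L..int L}. component D_grading l x) v
      = (\<Sum>l\<in>{- int L..int L}. if l = degree D_grading v then Poly_Mapping.lookup x v else 0)"
      unfolding lookup_sum by (rule sum.cong) (auto simp: component_def)
    also have "\<dots> = Poly_Mapping.lookup x v"
    proof (cases "v \<in> Poly_Mapping.keys x")
      case True
      then have "\<bar>degree D_grading v\<bar> \<le> int L" using x(2) by (simp add: degree_le_def)
      then show ?thesis by (simp add: abs_le_iff)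
    qed (simp add: in_keys_iff)
    finally show "Poly_Mapping.lookup x v = Poly_Mapping.lookup (\<Sum>l\<in>{- int L..int L}. component D_grading l x) v" by simp
  qed
  then have "p x \<le> (\<Sum>l\<in>{- int L..int L}. p (component D_grading l x))" using p_sum by metis
  also have "\<dots> \<le> (\<Sum>l\<in>{- int L..int L}. K)"
  proof (rule sum_mono)
    fix l
    have "p (component D_grading l x) = cmod (character 1 (component D_grading l x)) * p (D_power l)"
      using eqv_p[OF D_poly_component[OF x(1)]] by (simp add: p_scale)
    also have "\<dots> \<le> cmod (character 1 (component D_grading l x)) * 1"
      by (intro mult_left_mono p_D_power_le) simp
    also have "\<dots> \<le> K" using character_component_bound[OF K] by simp
    finally show "p (component D_grading l x) \<le> K" .
  qed
  also have "\<dots> = (2 * real L + 1) * K" by simp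
  finally show ?thesis .
qed

text \<open>The crude bound is applied to large powers of \<open>adj x * x\<close>, whose degree grows only
  linearly.\<close>

lemma D_poly_bound:
  assumes x: "D_poly x" and K: "K > 0" "\<And>t. cmod t = 1 \<Longrightarrow> cmod (character t x) \<le> K"
  shows "p x \<le> K"
proof -
  obtain L where L: "degree_le D_grading L x"
    using finite_degree_bound unfolding degree_le_def by blast
  define y where "y = adj x * x"
  have y: "D_poly y" "adj y = y" "degree_le D_grading (L + L) y"
    using x L by (simp_all add: y_def D_poly_intros adj_mult degree_le_mult degree_le_adj)
  have "((p x / K)\<^sup>2) ^ (2 ^ k) \<le> (4 * real L) * 2 ^ k + 1" for k :: nat
  proof -
    let ?n = "2 ^ k :: nat"
    have ch: "cmod (character t (y ^ ?n)) \<le> (K\<^sup>2) ^ ?n" if t: "cmod t = 1" for t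
    proof -
      have "cmod (character t (y ^ ?n)) = ((cmod (character t x))\<^sup>2) ^ ?n"
        by (simp add: y_def character_simps character_power norm_power norm_mult power2_eq_square)
      also have "\<dots> \<le> (K\<^sup>2) ^ ?n" by (intro power_mono K t) auto
      finally show ?thesis .
    qed
    have "((p x)\<^sup>2) ^ ?n = p (y ^ ?n)" unfolding p_power_selfadjoint[OF y(2)] by (simp add: y_def p_cstar)
    also have "\<dots> \<le> (2 * real (?n * (L + L)) + 1) * (K\<^sup>2) ^ ?n"
      by (intro D_poly_bound_weak D_poly_power y degree_le_power ch)
    finally have "((p x)\<^sup>2) ^ ?n / (K\<^sup>2) ^ ?n \<le> 2 * real (?n * (L + L)) + 1"
      using K(1) by (simp add: pos_divide_le_eq)
    then show ?thesis by (simp add: power_divide algebra_simps)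
  qed
  then have "(p x / K)\<^sup>2 \<le> 1" by (rule linear_growth_bound) simp
  then have "p x / K \<le> 1" using power2_le_imp_le[of "p x / K" 1] by simp
  then show ?thesis using K(1) by (simp add: pos_divide_le_eq)
qed

text \<open>For \<open>w = 1\<close> the relation between \<open>b\<close> and \<open>D\<close>
  becomes a commutation. The adjoint letters follow by unitarity of \<open>D\<close> and by taking
  adjoints.\<close>

lemma D_central:
  assumes w1: "w = 1"
  shows "D * y \<doteq> y * D"
proof -
  have bD: "b * D \<doteq> D * b" using rel_bD by (simp add: w1)
  have "b * adj D \<doteq> adj D * b"
    using b_commute_letter[of "Adj Gen_D"] w1 by (simp add: a_grading_def D gen_def adj_single scaled_def)
  from eqv_adj[OF this] have b'D: "D * adj b \<doteq> adj b * D" by (simp add: adj_mult)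
  have a'D: "adj a * D \<doteq> D * adj a" using eqv_adj[OF D'a] by (simp add: adj_mult)
  have letter: "D * mon (Word [g]) \<doteq> mon (Word [g]) * D" for g
  proof (cases g rule: letter_cases)
    case adj_D
    then show ?thesis using eqv_trans[OF rel_DD' eqv_sym[OF rel_D'D]] by simp
  qed (simp_all add: eqv_sym[OF rel_aD] eqv_sym[OF a'D] eqv_sym[OF bD] b'D)
  have word: "D * mon (Word u) \<doteq> mon (Word u) * D" for u
  proof (induction u)
    case Nil
    have "mon (Word []) = (1 :: Uq2_gen star_poly)" by (metis single_one zero_word_def)
    then show ?case by simp
  next
    case (Cons g u)
    have mo: "mon (Word (g # u)) = mon (Word [g]) * mon (Word u)" by (simp add: mult_single)
    have "D * mon (Word (g # u)) = D * mon (Word [g]) * mon (Word u)" by (simp only: mo mult.assoc)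
    also have "\<dots> \<doteq> mon (Word [g]) * D * mon (Word u)" by (intro eqv_mult_right letter)
    also have "\<dots> = mon (Word [g]) * (D * mon (Word u))" by (simp only: mult.assoc)
    also have "\<dots> \<doteq> mon (Word [g]) * (mon (Word u) * D)" by (intro eqv_mult_left Cons)
    also have "\<dots> = mon (Word (g # u)) * D" by (simp only: mo mult.assoc)
    finally show ?case .
  qed
  show ?thesis
  proof (induction y rule: star_poly_mon_induct)
    case (mon v)
    show ?case using word by (cases v) simp
  next
    case (add x y)
    then show ?case using eqv_add by (simp only: distrib_left distrib_right)
  next
    case (scale c x)
    have "D * (const c * x) = const c * (D * x)" by (rule const_mult_left)
    also have "\<dots> \<doteq> const c * (x * D)" using scale by (rule eqv_mult_left)
    finally show ?case by (simp only: mult.assoc)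
  qed simp
qed

lemma D_poly_central:
  assumes w1: "w = 1" and x: "D_poly x"
  shows "x * y \<doteq> y * x"
proof -
  have D'y: "adj D * y \<doteq> y * adj D" for y
    using eqv_adj[OF eqv_sym[OF D_central[OF w1, of "adj y"]]] by (simp add: adj_mult)
  have word: "mon (Word u) * y \<doteq> y * mon (Word u)" if "set u \<subseteq> {Gen Gen_D, Adj Gen_D}" for u y
    using that
  proof (induction u arbitrary: y)
    case Nil
    have "mon (Word []) = (1 :: Uq2_gen star_poly)" by (metis single_one zero_word_def)
    then show ?case by simp
  next
    case (Cons g u)
    have mo: "mon (Word (g # u)) = mon (Word [g]) * mon (Word u)" by (simp add: mult_single)
    have g: "mon (Word [g]) = D \<or> mon (Word [g]) = adj D"
      using Cons.prems by (auto simp: D gen_def adj_single)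
    have gy: "mon (Word [g]) * y \<doteq> y * mon (Word [g])" for y
      using g D_central[OF w1] D'y by auto
    have "mon (Word (g # u)) * y = mon (Word [g]) * (mon (Word u) * y)" by (simp only: mo mult.assoc)
    also have "\<dots> \<doteq> mon (Word [g]) * (y * mon (Word u))" using Cons by (intro eqv_mult_left) auto
    also have "\<dots> = mon (Word [g]) * y * mon (Word u)" by (simp only: mult.assoc)
    also have "\<dots> \<doteq> y * mon (Word [g]) * mon (Word u)" by (intro eqv_mult_right gy)
    also have "\<dots> = y * mon (Word (g # u))" by (simp only: mo mult.assoc)
    finally show ?case .
  qed
  show ?thesis
    using x unfolding D_poly_def
  proof (induction x rule: star_poly_keys_induct)
    case (mon v)
    then show ?case using word by (cases v) simp
  next
    case (add x x')
    then show ?case using eqv_add by (simp only: distrib_left distrib_right)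
  next
    case (scale c x)
    have "const c * x * y = const c * (x * y)" by (rule mult.assoc)
    also have "\<dots> \<doteq> const c * (y * x)" using scale by (rule eqv_mult_left)
    finally show ?case by (simp only: const_mult_left)
  qed simp
qed

text \<open>Uniform approximation of \<open>f\<close> on the circle becomes a Cauchy sequence in the
  seminorm because the constant in \<open>D_poly_bound\<close> is a bound over the circle with no
  extra factor. This provides surjectivity of the map from the center to the functions on the
  circle.\<close>

theorem continuous_function_from_center:
  assumes w1: "w = 1" and f: "continuous_on (sphere 0 1) f"
  obtains x where "cauchy x" "central x" "\<And>t. cmod t = 1 \<Longrightarrow> (\<lambda>n. character t (x n)) \<longlonglongrightarrow> f t"
proof -
  have "\<exists>x. D_poly x \<and> (\<forall>t. cmod t = 1 \<longrightarrow> cmod (character t x - f t) \<le> inverse (real (Suc n)))" for n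
    by (rule continuous_approx_character[OF f]) simp
  then obtain x where x: "\<And>n. D_poly (x n)"
    "\<And>n t. cmod t = 1 \<Longrightarrow> cmod (character t (x n) - f t) \<le> inverse (real (Suc n))" by metis
  have "cauchy x"
    unfolding cauchy_def
  proof (intro allI impI)
    fix \<epsilon> :: real assume "\<epsilon> > 0"
    then obtain N where N: "inverse (real (Suc N)) < \<epsilon> / 4" using reals_Archimedean[of "\<epsilon> / 4"] by auto
    have le: "inverse (real (Suc n)) \<le> inverse (real (Suc N))" if "n \<ge> N" for n
      using that by (intro le_imp_inverse_le) auto
    have "p (x m - x n) < \<epsilon>" if mn: "m \<ge> N" "n \<ge> N" for m n
    proof -
      have "p (x m - x n) \<le> \<epsilon> / 2"
      proof (rule D_poly_bound)
        show "D_poly (x m - x n)" by (intro D_poly_diff x)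
        show "\<epsilon> / 2 > 0" using \<open>\<epsilon> > 0\<close> by simp
        fix t :: complex assume t: "cmod t = 1"
        have "character t (x m - x n) = (character t (x m) - f t) - (character t (x n) - f t)"
          by (simp add: character_simps)
        then have "cmod (character t (x m - x n)) \<le> cmod (character t (x m) - f t) + cmod (character t (x n) - f t)"
          by (simp only: norm_triangle_ineq4)
        then show "cmod (character t (x m - x n)) \<le> \<epsilon> / 2"
          using x(2)[OF t, of m] x(2)[OF t, of n] le[OF mn(1)] le[OF mn(2)] N by linarith
      qed
      then show ?thesis using \<open>\<epsilon> > 0\<close> by simp
    qed
    then show "\<exists>N. \<forall>m\<ge>N. \<forall>n\<ge>N. p (x m - x n) < \<epsilon>" by blast
  qed
  moreover have "central x"
    unfolding central_def using D_poly_central[OF w1 x(1)] by (simp add: eqv_def)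
  moreover have "(\<lambda>n. character t (x n)) \<longlonglongrightarrow> f t" if "cmod t = 1" for t
  proof (rule LIM_zero_cancel, rule Lim_null_comparison)
    show "\<forall>\<^sub>F n in sequentially. norm (character t (x n) - f t) \<le> inverse (real (Suc n))"
      using x(2)[OF that] by simp
  qed (rule LIMSEQ_inverse_real_of_nat)
  ultimately show thesis by (rule that)
qed

end

section \<open>The center of the algebra\<close>

context cstar_seminorm begin

text \<open>Freezing \<open>y\<close> at a late index \<open>k\<close> reduces to a fixed
  polynomial, and the bound on \<open>x\<close> controls the remainder. Thus commuting
  asymptotically with polynomials implies commuting with every element of the completion.\<close>

lemma central_commutator_null:
  assumes x: "cauchy x" "central x" and y: "cauchy y"
  shows "(\<lambda>n. p (x n * y n - y n * x n)) \<longlonglongrightarrow> 0"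
proof (rule LIMSEQ_I)
  fix \<epsilon> :: real assume e: "\<epsilon> > 0"
  obtain K where K: "K > 0" "\<And>n. p (x n) \<le> K" using cauchy_bounded x(1) by blast
  have e': "\<epsilon> / (4 * K) > 0" using e K by simp
  obtain k where k: "\<And>m n. m \<ge> k \<Longrightarrow> n \<ge> k \<Longrightarrow> p (y m - y n) < \<epsilon> / (4 * K)"
    using y e' unfolding cauchy_def by blast
  have "(\<lambda>n. p (x n * y k - y k * x n)) \<longlonglongrightarrow> 0" using x(2) by (simp add: central_def)
  from LIMSEQ_D[OF this, of "\<epsilon> / 2"] e obtain M
    where M: "\<And>n. n \<ge> M \<Longrightarrow> norm (p (x n * y k - y k * x n) - 0) < \<epsilon> / 2" by auto
  have "norm (p (x n * y n - y n * x n) - 0) < \<epsilon>" if n: "n \<ge> max M k" for n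
  proof -
    have "x n * y n - y n * x n = (x n * (y n - y k) + (y k - y n) * x n) + (x n * y k - y k * x n)"
      by (simp add: algebra_simps)
    then have "p (x n * y n - y n * x n)
        \<le> p (x n * (y n - y k) + (y k - y n) * x n) + p (x n * y k - y k * x n)"
      by (simp only: p_triangle)
    also have "p (x n * (y n - y k) + (y k - y n) * x n) \<le> p (x n * (y n - y k)) + p ((y k - y n) * x n)"
      by (rule p_triangle)
    also have "p (x n * (y n - y k)) \<le> K * (\<epsilon> / (4 * K))"
      by (rule order_trans[OF p_mult], rule mult_mono)
        (use K k[of n k] n in \<open>auto simp: p_nonneg less_imp_le\<close>)
    also have "p ((y k - y n) * x n) \<le> (\<epsilon> / (4 * K)) * K"
      by (rule order_trans[OF p_mult], rule mult_mono)
        (use K k[of k n] n e' in \<open>auto simp: p_nonneg less_imp_le\<close>)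
    also have "p (x n * y k - y k * x n) < \<epsilon> / 2" using M[of n] n by simp
    also have "K * (\<epsilon> / (4 * K)) + (\<epsilon> / (4 * K)) * K + \<epsilon> / 2 = \<epsilon>" using K(1) by (simp add: field_simps)
    finally show ?thesis by (simp add: p_nonneg)
  qed
  then show "\<exists>N. \<forall>n\<ge>N. norm (p (x n * y n - y n * x n) - 0) < \<epsilon>" by blast
qed

text \<open>Constant sequences suffice to show that a representative of a central class is
  \<open>central\<close>; the converse is \<open>central_commutator_null\<close>.\<close>

lemma center_CC: "center CC = cauchy_class p ` {x. cauchy x \<and> central x}"
proof (intro equalityI subsetI)
  fix X assume X: "X \<in> center CC"
  then obtain x where x: "cauchy x" "X = cauchy_class p x" by (auto simp: center_def elim: CC_cases)
  have "central x"
    unfolding central_def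
  proof
    fix y
    have "X \<otimes>\<^bsub>CC\<^esub> cauchy_class p (\<lambda>n. y) = cauchy_class p (\<lambda>n. y) \<otimes>\<^bsub>CC\<^esub> X"
      using X by (simp add: center_def)
    then have "cauchy_class p (\<lambda>n. x n * y) = cauchy_class p (\<lambda>n. y * x n)" using x by (simp add: CC_mult)
    then show "(\<lambda>n. p (x n * y - y * x n)) \<longlonglongrightarrow> 0"
      by (simp add: class_eq_iff null_iff p_minus_commute[of "y * _"])
  qed
  then show "X \<in> cauchy_class p ` {x. cauchy x \<and> central x}" using x by blast
next
  fix X assume "X \<in> cauchy_class p ` {x. cauchy x \<and> central x}"
  then obtain x where x: "cauchy x" "central x" "X = cauchy_class p x" by blast
  have "X \<otimes>\<^bsub>CC\<^esub> Y = Y \<otimes>\<^bsub>CC\<^esub> X" if "Y \<in> carrier CC" for Y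
  proof -
    obtain y where y: "cauchy y" "Y = cauchy_class p y" using \<open>Y \<in> carrier CC\<close> by (rule CC_cases)
    have "(\<lambda>n. x n * y n - y n * x n) \<in> NI"
      using central_commutator_null[OF x(1,2) y(1)] by (simp only: null_iff)
    then have "cauchy_class p (\<lambda>n. y n * x n) = cauchy_class p (\<lambda>n. x n * y n)" by (rule class_eqI)
    then show ?thesis using x y by (simp add: CC_mult)
  qed
  then show "X \<in> center CC" using x by (simp add: center_def)
qed

end

section \<open>Gauge invariance of the universal seminorm and instantiation of the locale\<close>

lemma scaled_diff: "scaled c x - scaled c y = scaled c (x - y)"
  and scaled_1: "scaled 1 x = x"
  by (simp_all add: scaled_def right_diff_distrib)

lemma gauge_scaled: "gauge e z (scaled c x) = scaled c (gauge e z x)"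
  by (simp add: gauge_def scaled_def weight_const_mult)

text \<open>Every relation is homogeneous for any assignment \<open>e\<close> of degrees to the
  generators, the ones containing the unit being of degree 0.\<close>

lemma gauge_relation:
  assumes z: "cmod z = 1" and R: "R \<in> Uq2_relations q"
  shows "\<exists>c. gauge e z R = const c * R"
proof -
  define A B C where "A = z powi e Gen_a" and "B = z powi e Gen_b" and "C = z powi e Gen_D"
  have n: "cmod A = 1" "cmod B = 1" "cmod C = 1" using z by (simp_all add: A_def B_def C_def norm_power_int)
  have u: "u * cnj u = 1" "cnj u * u = 1" if "cmod u = 1" for u
    using that complex_norm_square[of u] by (simp_all add: mult.commute)
  note uu = u[OF n(1)] u[OF n(2)] u[OF n(3)]
  let ?a = "gen Gen_a" and ?b = "gen Gen_b" and ?D = "gen Gen_D"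
  note g = gauge_simps[OF z, of e]
  note gg = g(1-5) g(6)[of Gen_a] g(6)[of Gen_b] g(6)[of Gen_D] g(7)
  note simps = gg A_def[symmetric] B_def[symmetric] C_def[symmetric] scaled_simps gauge_scaled mult.assoc
  have 1: "gauge e z (?b * ?a - const q * (?a * ?b)) = const (B * A) * (?b * ?a - const q * (?a * ?b))"
    by (simp add: simps scaled_diff[symmetric] mult_ac)
  have 2: "gauge e z (adj ?a * ?b - const q * (?b * adj ?a)) = const (cnj A * B) * (adj ?a * ?b - const q * (?b * adj ?a))"
    by (simp add: simps scaled_diff[symmetric] mult_ac)
  have 3: "gauge e z (?b * adj ?b - adj ?b * ?b) = const 1 * (?b * adj ?b - adj ?b * ?b)"
    by (simp add: simps uu scaled_1)
  have 4: "gauge e z (?a * adj ?a + ?b * adj ?b - 1) = const 1 * (?a * adj ?a + ?b * adj ?b - 1)"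
    by (simp add: simps uu scaled_1)
  have 5: "gauge e z (?a * ?D - ?D * ?a) = const (A * C) * (?a * ?D - ?D * ?a)"
    by (simp add: simps scaled_diff mult.commute[of A C])
  have 6: "gauge e z (?b * ?D - const w * (?D * ?b)) = const (B * C) * (?b * ?D - const w * (?D * ?b))" for w
    by (simp add: simps scaled_diff[symmetric] mult_ac)
  have 7: "gauge e z (?D * adj ?D - 1) = const 1 * (?D * adj ?D - 1)"
    and 8: "gauge e z (adj ?D * ?D - 1) = const 1 * (adj ?D * ?D - 1)"
    by (simp_all add: simps uu scaled_1)
  have 9: "gauge e z (adj ?a * ?a + const c * (adj ?b * ?b) - 1) = const 1 * (adj ?a * ?a + const c * (adj ?b * ?b) - 1)" for c
    by (simp add: simps uu scaled_1)
  show ?thesis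
    using R unfolding Uq2_relations_def Let_def
    by (elim insertE emptyE; hypsubst) (rule exI, rule 1 2 3 4 5 6 7 8 9)+
qed

text \<open>Composition with a gauge automorphism maps the set of seminorms under the supremum into
  itself.\<close>

lemma universal_gauge:
  assumes q: "cmod q \<noteq> 1" and z: "cmod z = 1"
  shows "universal_seminorm (Uq2_relations q) (gauge e z x) \<le> universal_seminorm (Uq2_relations q) x"
proof (rule universal_least)
  fix p assume p: "p \<in> rel_seminorms (Uq2_relations q)"
  then interpret cstar_seminorm p by (rule rel_seminormD)
  note g = gauge_simps[OF z]
  have "cstar_seminorm (\<lambda>x. p (gauge e z x))"
    by unfold_locales (simp_all only: g p_nonneg p_triangle p_scale p_mult p_cstar)
  moreover have "p (gauge e z R) = 0" if R: "R \<in> Uq2_relations q" for R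
  proof -
    obtain c where "gauge e z R = const c * R" using gauge_relation[OF z R] by blast
    then show ?thesis using p R by (simp add: p_scale rel_seminorms_def)
  qed
  ultimately have "(\<lambda>x. p (gauge e z x)) \<in> rel_seminorms (Uq2_relations q)"
    by (simp add: rel_seminorms_def)
  then show "p (gauge e z x) \<le> universal_seminorm (Uq2_relations q) x"
    by (rule universal_upper[OF Uq2_admissible[OF q]])
qed

lemma (in cstar_seminorm) eqv_inverse_scale:
  assumes "x \<doteq> const c * y" "c \<noteq> 0" shows "y \<doteq> const (inverse c) * x"
proof -
  have "const (inverse c) * x \<doteq> const (inverse c) * (const c * y)" using assms(1) by (rule eqv_mult_left)
  also have "\<dots> = y" using assms(2) by (simp flip: mult.assoc const_mult)
  finally show ?thesis by (rule eqv_sym)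
qed

lemma quantum_U2_universal:
  assumes q: "q \<noteq> 0" "cmod q \<noteq> 1"
  obtains a b D r s \<kappa> where
    "quantum_U2 (universal_seminorm (Uq2_relations q)) a b D r (q\<^sup>2 / (complex_of_real (cmod q))\<^sup>2) s \<kappa>"
proof -
  let ?U = "universal_seminorm (Uq2_relations q)"
  have U: "?U \<in> rel_seminorms (Uq2_relations q)" by (rule universal_rel_seminorm[OF Uq2_admissible[OF q(2)]])
  then interpret cstar_seminorm ?U by (rule rel_seminormD)
  interpret gauge_invariant_seminorm ?U by unfold_locales (rule universal_gauge[OF q(2)])
  define w where "w = q\<^sup>2 / (complex_of_real (cmod q))\<^sup>2"
  define c where "c = (cmod q)\<^sup>2"
  have c: "c > 0" using q by (simp add: c_def)
  have w: "cmod w = 1" using q by (simp add: w_def norm_divide norm_power)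
  let ?a = "gen Gen_a" and ?b = "gen Gen_b" and ?D = "gen Gen_D"
  have U0: "?U R = 0" if "R \<in> Uq2_relations q" for R
    using U that by (simp add: rel_seminorms_def)
  have rel: "eqv (?b * ?a) (const q * (?a * ?b))" "eqv (adj ?a * ?b) (const q * (?b * adj ?a))"
    "eqv (?b * adj ?b) (adj ?b * ?b)" "eqv (?a * ?D) (?D * ?a)" "eqv (?b * ?D) (const w * (?D * ?b))"
    "eqv (?D * adj ?D) (1)" "eqv (adj ?D * ?D) (1)"
    and n: "?U (?a * adj ?a + ?b * adj ?b - 1) = 0" "?U (adj ?a * ?a + const (of_real c) * (adj ?b * ?b) - 1) = 0"
    unfolding eqv_def by (rule U0, simp add: Uq2_relations_def Let_def w_def c_def)+
  have aa': "eqv (?a * adj ?a) (1 - ?b * adj ?b)"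
    using n(1) by (simp add: eqv_def algebra_simps)
  have "eqv (adj ?a * ?a) (1 - const (of_real c) * (adj ?b * ?b))"
    using n(2) by (simp add: eqv_def algebra_simps)
  also have "eqv \<dots> (1 - const (of_real c) * (?b * adj ?b))"
    by (intro eqv_diff eqv_refl eqv_mult_left eqv_sym[OF rel(3)])
  finally have a'a: "eqv (adj ?a * ?a) (1 - const (of_real c) * (?b * adj ?b))" .
  have b_pos: "?U ?b > 0" by (rule universal_norm_b_pos[OF q])
  have ch: "cmod (character t x) \<le> ?U x" if "cmod t = 1" for t x
    using universal_upper[OF Uq2_admissible[OF q(2)] character_rel_seminorm[OF that]] .
  show thesis
  proof (cases "cmod q < 1")
    case True
    have "quantum_U2 ?U ?a ?b ?D q w c 1"
    proof
      show "c < 1" using True by (simp add: c_def power_less_one_iff)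
    qed (use rel aa' a'a b_pos ch w c in \<open>simp_all add: c_def\<close>)
    then show thesis using that unfolding w_def by blast
  next
    case False
    have "quantum_U2 ?U (adj ?a) ?b ?D (inverse q) w (inverse c) c"
    proof
      show "eqv (?b * adj ?a) (const (inverse q) * (adj ?a * ?b))"
        by (rule eqv_inverse_scale[OF rel(2) q(1)])
      show "eqv (adj (adj ?a) * ?b) (const (inverse q) * (?b * adj (adj ?a)))"
        unfolding adj_adj by (rule eqv_inverse_scale[OF rel(1) q(1)])
      have "1 < c" using False q(2) by (simp add: c_def)
      then show "inverse c < 1" by (simp add: inverse_less_1_iff)
      show "inverse c = (cmod (inverse q))\<^sup>2" by (simp add: c_def norm_inverse power_inverse)
      show "eqv (adj ?a * adj (adj ?a)) (1 - const (of_real c) * (?b * adj ?b))"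
        unfolding adj_adj by (rule a'a)
      have "const (of_real (inverse c)) * (const (of_real c) * (?b * adj ?b)) = ?b * adj ?b"
        using c by (simp flip: mult.assoc const_mult)
      then show "eqv (adj (adj ?a) * adj ?a) (1 - const (of_real (inverse c)) * (const (of_real c) * (?b * adj ?b)))"
        using aa' by (simp only: adj_adj)
      show "eqv (adj ?a * ?D) (?D * adj ?a)"
        using eqv_adj[OF commute_adj_unitary[OF rel(6,7,4)]] by (simp add: adj_mult)
    qed (use rel b_pos ch w c in \<open>simp_all\<close>)
    then show thesis using that unfolding w_def by blast
  qed
qed

text \<open>The base is \<open>cis (2 * Arg q)\<close>, so a nonzero power equal to 1 would make
  \<open>Arg q / pi\<close> a quotient of integers.\<close>

lemma Uq2_weight_powi_ne_1:
  assumes q: "q \<noteq> 0" "Arg q / pi \<notin> \<rat>" and l: "l \<noteq> 0"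
  shows "(q\<^sup>2 / (complex_of_real (cmod q))\<^sup>2) powi l \<noteq> 1"
proof
  assume one: "(q\<^sup>2 / (complex_of_real (cmod q))\<^sup>2) powi l = 1"
  have "q / complex_of_real (cmod q) = cis (Arg q)"
    using q(1) by (simp add: cis_Arg sgn_eq)
  then have "q\<^sup>2 / (complex_of_real (cmod q))\<^sup>2 = cis (2 * Arg q)"
    by (simp add: Complex.DeMoivre flip: power_divide)
  then have "cis (of_int l * (2 * Arg q)) = 1" using one by (simp add: cis_power_int)
  then have "cos (of_int l * (2 * Arg q)) = 1" by (simp add: complex_eq_iff)
  then obtain k :: int where "of_int l * (2 * Arg q) = of_int k * 2 * pi"
    by (auto simp: cos_one_2pi_int)
  then have "Arg q / pi = of_int k / of_int l" using l by (simp add: field_simps)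
  then show False using q(2) by simp
qed

lemma C_Uq2_completion: "C_Uq2 q = cstar_completion (universal_seminorm (Uq2_relations q))"
  by (simp add: C_Uq2_def universal_cstar_def)

lemma center_C_Uq2_irrational:
  assumes q: "q \<noteq> 0" "cmod q \<noteq> 1" "Arg q / pi \<notin> \<rat>"
  shows "center (C_Uq2 q) = range (\<lambda>c. c \<odot>\<^bsub>C_Uq2 q\<^esub> \<one>\<^bsub>C_Uq2 q\<^esub>)"
    and "\<one>\<^bsub>C_Uq2 q\<^esub> \<noteq> \<zero>\<^bsub>C_Uq2 q\<^esub>"
proof -
  let ?U = "universal_seminorm (Uq2_relations q)"
  obtain a b D r s \<kappa> where "quantum_U2 ?U a b D r (q\<^sup>2 / (complex_of_real (cmod q))\<^sup>2) s \<kappa>"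
    using quantum_U2_universal[OF q(1,2)] .
  then interpret quantum_U2 ?U a b D r "q\<^sup>2 / (complex_of_real (cmod q))\<^sup>2" s \<kappa> .
  have scalar: "c \<odot>\<^bsub>C_Uq2 q\<^esub> \<one>\<^bsub>C_Uq2 q\<^esub> = cauchy_class ?U (\<lambda>n. const c)" for c
    by (simp add: C_Uq2_completion CC_one CC_smult)
  show "center (C_Uq2 q) = range (\<lambda>c. c \<odot>\<^bsub>C_Uq2 q\<^esub> \<one>\<^bsub>C_Uq2 q\<^esub>)"
    unfolding scalar
  proof (intro equalityI subsetI)
    fix X assume "X \<in> center (C_Uq2 q)"
    then obtain x where x: "cauchy x" "central x" "X = cauchy_class ?U x"
      unfolding C_Uq2_completion center_CC by blast
    obtain c where "(\<lambda>n. ?U (x n - const c)) \<longlonglongrightarrow> 0"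
      using central_scalar[OF x(1,2)] Uq2_weight_powi_ne_1[OF q(1,3)] by blast
    then have "(\<lambda>n. x n - const c) \<in> null_ideal ?U" by (simp only: null_iff)
    then have "X = cauchy_class ?U (\<lambda>n. const c)" unfolding x(3) by (rule class_eqI[symmetric])
    then show "X \<in> range (\<lambda>c. cauchy_class ?U (\<lambda>n. const c))" by blast
  next
    fix X assume "X \<in> range (\<lambda>c. cauchy_class ?U (\<lambda>n. const c))"
    then obtain c where c: "X = cauchy_class ?U (\<lambda>n. const c)" by blast
    have "central (\<lambda>n. const c)" unfolding central_def by (simp add: const_central)
    then show "X \<in> center (C_Uq2 q)" unfolding C_Uq2_completion center_CC c by simp
  qed
  have "\<not> (\<lambda>n. ?U (0 - 1)) \<longlonglongrightarrow> 0"
    by (simp add: p_1 LIMSEQ_const_iff)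
  then show "\<one>\<^bsub>C_Uq2 q\<^esub> \<noteq> \<zero>\<^bsub>C_Uq2 q\<^esub>"
    unfolding C_Uq2_completion CC_one CC_zero class_eq_iff null_iff .
qed

lemma center_C_Uq2_real:
  assumes q: "q \<noteq> 0" "cmod q \<noteq> 1" "q \<in> \<real>"
  shows "cstar_isomorphic (center_algebra (C_Uq2 q)) (continuous_functions (sphere (0::complex) 1))"
proof -
  let ?U = "universal_seminorm (Uq2_relations q)" and ?S = "sphere (0::complex) 1"
  \<comment> \<open>For real \<open>q\<close> the generators \<open>b\<close> and \<open>D\<close>
    commute, which makes \<open>D\<close> central.\<close>
  have w1: "q\<^sup>2 / (complex_of_real (cmod q))\<^sup>2 = 1"
  proof -
    obtain y where y: "q = of_real y" using q(3) by (rule Reals_cases)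
    then have "(complex_of_real (cmod q))\<^sup>2 = q\<^sup>2" by (simp flip: of_real_power)
    then show ?thesis using q(1) by simp
  qed
  obtain a b D r s \<kappa> where "quantum_U2 ?U a b D r (q\<^sup>2 / (complex_of_real (cmod q))\<^sup>2) s \<kappa>"
    using quantum_U2_universal[OF q(1,2)] .
  then interpret quantum_U2 ?U a b D r 1 s \<kappa> unfolding w1 .
  \<comment> \<open>The Gelfand transform restricted to the circle of characters. It is defined with
    the chosen representative; \<open>conv\<close> below shows that every Cauchy representative has
    the same limits.\<close>
  define \<phi> where "\<phi> X = (\<lambda>t\<in>?S. lim (\<lambda>n. character t (rep X n)))" for X
  \<comment> \<open>Uniformity in \<open>t\<close> is what makes the limit function continuous, and
    it supplies the hypothesis of \<open>central_null_if_characters_null\<close> in the proof of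
    injectivity.\<close>
  have unif: "\<exists>N. \<forall>n\<ge>N. \<forall>t\<in>?S. cmod (character t (x n) - \<phi> (cauchy_class ?U x) t) \<le> \<epsilon>"
    if x: "cauchy x" and e: "\<epsilon> > 0" for x \<epsilon>
  proof -
    let ?r = "rep (cauchy_class ?U x)"
    have null: "(\<lambda>n. ?r n - x n) \<in> null_ideal ?U" by (rule rep_class)
    have r: "cauchy ?r" using cauchy_add[OF null_cauchy[OF null] x] by simp
    have lim: "(\<lambda>n. character t (?r n)) \<longlonglongrightarrow> \<phi> (cauchy_class ?U x) t" if t: "t \<in> ?S" for t
    proof -
      have "Cauchy (\<lambda>n. character t (?r n))"
      proof (rule CauchyI)
        fix \<delta> :: real assume "\<delta> > 0"
        then obtain N where "\<forall>m\<ge>N. \<forall>n\<ge>N. ?U (?r m - ?r n) < \<delta>" using r unfolding cauchy_def by blast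
        moreover have "cmod (character t (?r m) - character t (?r n)) \<le> ?U (?r m - ?r n)" for m n
          using character_bound[of t "?r m - ?r n"] t by (simp add: character_simps)
        ultimately show "\<exists>N. \<forall>m\<ge>N. \<forall>n\<ge>N. norm (character t (?r m) - character t (?r n)) < \<delta>"
          by (meson order_le_less_trans)
      qed
      then show ?thesis using t by (simp add: \<phi>_def Cauchy_convergent_iff convergent_LIMSEQ_iff)
    qed
    have e2: "\<epsilon> / 2 > 0" using e by simp
    obtain M where M: "\<And>n. n \<ge> M \<Longrightarrow> ?U (?r n - x n) < \<epsilon> / 2"
      using order_tendstoD(2)[OF null[unfolded null_iff] e2] unfolding eventually_sequentially by blast
    obtain N where N: "\<And>m n. m \<ge> N \<Longrightarrow> n \<ge> N \<Longrightarrow> ?U (?r m - ?r n) < \<epsilon> / 2"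
      using r e2 unfolding cauchy_def by blast
    have "cmod (character t (x n) - \<phi> (cauchy_class ?U x) t) \<le> \<epsilon>" if n: "n \<ge> max M N" and t: "t \<in> ?S" for n t
    proof (rule LIMSEQ_le_const2)
      show "(\<lambda>m. cmod (character t (x n) - character t (?r m))) \<longlonglongrightarrow> cmod (character t (x n) - \<phi> (cauchy_class ?U x) t)"
        by (intro tendsto_norm tendsto_diff tendsto_const lim t)
      have "cmod (character t (x n) - character t (?r m)) \<le> \<epsilon>" if m: "m \<ge> N" for m
      proof -
        have "cmod (character t (x n) - character t (?r m)) \<le> ?U (x n - ?r m)"
          using character_bound[of t "x n - ?r m"] t by (simp add: character_simps)
        also have "\<dots> \<le> ?U (x n - ?r n) + ?U (?r n - ?r m)" by (rule p_triangle_diff)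
        also have "\<dots> \<le> \<epsilon>" using M[of n] N[of n m] n m p_minus_commute[of "x n" "?r n"] by simp
        finally show ?thesis .
      qed
      then show "\<exists>N. \<forall>m\<ge>N. cmod (character t (x n) - character t (?r m)) \<le> \<epsilon>" by blast
    qed
    then show ?thesis by blast
  qed
  have conv: "(\<lambda>n. character t (x n)) \<longlonglongrightarrow> \<phi> (cauchy_class ?U x) t" if x: "cauchy x" and t: "t \<in> ?S" for x t
  proof (rule LIMSEQ_I)
    fix \<epsilon> :: real assume "\<epsilon> > 0"
    then obtain N where "\<forall>n\<ge>N. \<forall>t\<in>?S. cmod (character t (x n) - \<phi> (cauchy_class ?U x) t) \<le> \<epsilon> / 2"
      using unif[OF x, of "\<epsilon> / 2"] by auto
    then show "\<exists>N. \<forall>n\<ge>N. norm (character t (x n) - \<phi> (cauchy_class ?U x) t) < \<epsilon>"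
      using t \<open>\<epsilon> > 0\<close> by (intro exI[of _ N]) fastforce
  qed
  have eqI: "\<phi> (cauchy_class ?U x) = (\<lambda>t\<in>?S. f t)"
    if "cauchy x" "\<And>t. t \<in> ?S \<Longrightarrow> (\<lambda>n. character t (x n)) \<longlonglongrightarrow> f t" for x f
  proof
    fix t
    show "\<phi> (cauchy_class ?U x) t = (\<lambda>t\<in>?S. f t) t"
    proof (cases "t \<in> ?S")
      case True
      then show ?thesis using LIMSEQ_unique[OF conv[OF that(1) True] that(2)[OF True]] by simp
    next
      case False
      then show ?thesis by (simp add: \<phi>_def)
    qed
  qed
  have cont: "continuous_on ?S (\<phi> (cauchy_class ?U x))" if x: "cauchy x" for x
  proof (rule uniform_limit_theorem)
    show "uniform_limit ?S (\<lambda>n t. character t (x n)) (\<phi> (cauchy_class ?U x)) sequentially"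
      unfolding uniform_limit_iff eventually_sequentially
    proof (intro allI impI)
      fix \<epsilon> :: real assume "\<epsilon> > 0"
      then obtain N where N: "\<forall>n\<ge>N. \<forall>t\<in>?S. cmod (character t (x n) - \<phi> (cauchy_class ?U x) t) \<le> \<epsilon> / 2"
        using unif[OF x, of "\<epsilon> / 2"] by auto
      show "\<exists>N. \<forall>n\<ge>N. \<forall>t\<in>?S. dist (character t (x n)) (\<phi> (cauchy_class ?U x) t) < \<epsilon>"
        using N \<open>\<epsilon> > 0\<close> unfolding dist_norm by (intro exI[of _ N]) fastforce
    qed
    show "\<forall>\<^sub>F n in sequentially. continuous_on ?S (\<lambda>t. character t (x n))"
      by (intro always_eventually allI continuous_on_character)
  qed simp
  let ?A = "center_algebra (C_Uq2 q)" and ?B = "continuous_functions ?S"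
  have A: "carrier ?A = cauchy_class ?U ` {x. cauchy x \<and> central x}"
    by (simp add: center_algebra_def C_Uq2_completion center_CC)
  have opA: "mult ?A = mult CC" "add ?A = add CC" "one ?A = one CC" "smult ?A = smult CC" "involution ?A = involution CC"
    by (simp_all add: center_algebra_def C_Uq2_completion)
  have "\<phi> \<in> star_hom ?A ?B"
    unfolding star_hom_def
  proof (intro CollectI conjI ring_hom_memI ballI allI)
    fix X assume "X \<in> carrier ?A"
    then obtain x where x: "cauchy x" "X = cauchy_class ?U x" unfolding A by blast
    note cx = conv[OF x(1)]
    show "\<phi> X \<in> carrier ?B"
      using cont[OF x(1)] by (simp add: x continuous_functions_def) (simp add: \<phi>_def)
    show "\<phi> (c \<odot>\<^bsub>?A\<^esub> X) = c \<odot>\<^bsub>?B\<^esub> \<phi> X" for c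
      unfolding opA x CC_smult continuous_functions_def
      by (simp, rule eqI) (auto simp: character_simps cauchy_scale x intro!: tendsto_mult cx)
    show "\<phi> (star\<^bsub>?A\<^esub> X) = star\<^bsub>?B\<^esub> (\<phi> X)"
      unfolding opA x CC_star continuous_functions_def
      by (simp, rule eqI) (auto simp: character_simps cauchy_adj x lim_cnj intro!: cx)
    fix Y assume "Y \<in> carrier ?A"
    then obtain y where y: "cauchy y" "Y = cauchy_class ?U y" unfolding A by blast
    note cy = conv[OF y(1)]
    show "\<phi> (X \<otimes>\<^bsub>?A\<^esub> Y) = \<phi> X \<otimes>\<^bsub>?B\<^esub> \<phi> Y"
      unfolding opA x y CC_mult[OF x(1) y(1)] continuous_functions_def
      by (simp, rule eqI) (auto simp: character_simps cauchy_mult x y intro!: tendsto_mult cx cy)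
    show "\<phi> (X \<oplus>\<^bsub>?A\<^esub> Y) = \<phi> X \<oplus>\<^bsub>?B\<^esub> \<phi> Y"
      unfolding opA x y CC_add[OF x(1) y(1)] continuous_functions_def
      by (simp, rule eqI) (auto simp: character_simps cauchy_add x y intro!: tendsto_add cx cy)
  next
    show "\<phi> \<one>\<^bsub>?A\<^esub> = \<one>\<^bsub>?B\<^esub>"
      unfolding opA CC_one continuous_functions_def
      by (simp, rule eqI) (simp_all add: character_simps)
  qed
  moreover have "bij_betw \<phi> (carrier ?A) (carrier ?B)"
    unfolding bij_betw_def
  proof
    show "inj_on \<phi> (carrier ?A)"
    proof (rule inj_onI)
      fix X Y assume "X \<in> carrier ?A" "Y \<in> carrier ?A" and eq: "\<phi> X = \<phi> Y"
      then obtain x y where x: "cauchy x" "central x" "X = cauchy_class ?U x"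
        and y: "cauchy y" "central y" "Y = cauchy_class ?U y" unfolding A by blast
      have "(\<lambda>n. ?U (y n - x n)) \<longlonglongrightarrow> 0"
      proof (rule central_null_if_characters_null)
        show "cauchy (\<lambda>n. y n - x n)" by (intro cauchy_diff x y)
        show "central (\<lambda>n. y n - x n)" by (rule central_diff[OF y(2) x(2)])
        fix \<epsilon> :: real assume e: "\<epsilon> > 0"
        obtain M where M: "\<And>n t. n \<ge> M \<Longrightarrow> t \<in> ?S \<Longrightarrow> cmod (character t (x n) - \<phi> X t) \<le> \<epsilon> / 2"
          using unif[OF x(1) half_gt_zero[OF e], folded x(3)] by blast
        obtain N where N: "\<And>n t. n \<ge> N \<Longrightarrow> t \<in> ?S \<Longrightarrow> cmod (character t (y n) - \<phi> X t) \<le> \<epsilon> / 2"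
          using unif[OF y(1) half_gt_zero[OF e], folded y(3), folded eq] by blast
        have "cmod (character t (y n - x n)) \<le> \<epsilon>" if "n \<ge> max M N" "cmod t = 1" for n t
        proof -
          have "character t (y n - x n) = (character t (y n) - \<phi> X t) - (character t (x n) - \<phi> X t)"
            by (simp add: character_simps)
          then have "cmod (character t (y n - x n)) \<le> cmod (character t (y n) - \<phi> X t) + cmod (character t (x n) - \<phi> X t)"
            by (simp only: norm_triangle_ineq4)
          then show ?thesis using M[of n t] N[of n t] that by simp
        qed
        then show "\<exists>N. \<forall>n\<ge>N. \<forall>t. cmod t = 1 \<longrightarrow> cmod (character t (y n - x n)) \<le> \<epsilon>" by blast
      qed
      then have "(\<lambda>n. y n - x n) \<in> null_ideal ?U" by (simp only: null_iff)
      then show "X = Y" unfolding x(3) y(3) by (rule class_eqI)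
    qed
    show "\<phi> ` carrier ?A = carrier ?B"
    proof (intro equalityI subsetI)
      fix f assume "f \<in> \<phi> ` carrier ?A"
      then show "f \<in> carrier ?B"
        using ring_hom_closed[of \<phi> ?A ?B] \<open>\<phi> \<in> star_hom ?A ?B\<close> by (auto simp: star_hom_def)
    next
      fix f assume "f \<in> carrier ?B"
      then have f: "f \<in> extensional ?S" "continuous_on ?S f" by (simp_all add: continuous_functions_def)
      obtain x where x: "cauchy x" "central x" "\<And>t. cmod t = 1 \<Longrightarrow> (\<lambda>n. character t (x n)) \<longlonglongrightarrow> f t"
        using continuous_function_from_center[OF refl f(2)] by blast
      have "\<phi> (cauchy_class ?U x) = (\<lambda>t\<in>?S. f t)" using x by (intro eqI) auto
      also have "\<dots> = f" using f(1) by (rule extensional_restrict)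
      finally show "f \<in> \<phi> ` carrier ?A" unfolding A using x by blast
    qed
  qed
  ultimately show ?thesis unfolding cstar_isomorphic_def by blast
qed

theorem theorem3p2:
  fixes q :: complex
  assumes "q \<noteq> 0" and "cmod q \<noteq> 1"
  shows "(q \<in> \<real> \<longrightarrow>
            cstar_isomorphic (center_algebra (C_Uq2 q)) (continuous_functions (sphere (0::complex) 1))) \<and>
         (q \<notin> \<real> \<and> Arg q / pi \<notin> \<rat> \<longrightarrow>
            center (C_Uq2 q) = range (\<lambda>c. c \<odot>\<^bsub>C_Uq2 q\<^esub> \<one>\<^bsub>C_Uq2 q\<^esub>) \<and>
            \<one>\<^bsub>C_Uq2 q\<^esub> \<noteq> \<zero>\<^bsub>C_Uq2 q\<^esub>)"
  using center_C_Uq2_real[OF assms] center_C_Uq2_irrational[OF assms] by blast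

end
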